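(* Consider the DSCMD-N iteration described in the context, and suppose that the network, stochastic-subgradient, noise and mirror-map assumptions listed in the context hold. Let $\alpha_t=\frac1{\sqrt{t+1}}$ and $r_t=\frac1{(t+1)^{\kappa}}$ for all $t\ge0$, with $\kappa\in(\frac12,1)$ and $\kappa\neq\frac34$. Let $$C_\kappa=\max\Big\{C_1+\Big|\tfrac{1-2(2\kappa-\frac12)}{1-(2\kappa-\frac12)}\Big|C_6,\ \sqrt2C_2+2\sqrt2C_3,\ \frac{2^{1-\kappa}C_4}{1-\kappa},\ \frac{2^{\frac32-\kappa}C_5}{\frac32-\kappa},\ \frac{C_6}{|\frac32-2\kappa|}\Big\},$$ where $C_1,\dots,C_6$ are the constants defined in the context. Then for every $l\in\mathcal V$ and every integer $T\ge3$, with $\hat x_l^T=\frac1T\sum_{t=1}^Tx_l^t$, $$\mathbb E[F(\hat x_l^T)]-F(x^* )\le\frac{5C_\kappa}{T^{\kappa-\frac12}}.$$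
   Context: Problem. $\mathcal V=\{1,\dots,N\}$ is a set of agents; $\mathcal X\subseteq\mathbb R^n$ is nonempty, convex and compact; $f_i,\chi_i:\mathbb R^n\to\mathbb R$ ($i\in\mathcal V$) are convex, possibly nonsmooth; $F_i=f_i+\chi_i$, $F=\sum_{i=1}^N F_i$. The problem is to minimize $F$ over $\mathcal X$; $\mathcal X^*$ is the set of minimizers and $x^*\in\mathcal X^*$. $\|\cdot\|$ is the Euclidean norm. $G_\chi=\max_{i\in\mathcal V}\sup\{\|g\|:g\in\partial\chi_i(x),\,x\in\mathcal X\}$. Mirror map. $\Phi:\mathbb R^n\to\mathbb R$ is continuously differentiable and $\sigma_\Phi$-strongly convex ($\sigma_\Phi>0$): $\Phi(x)\ge\Phi(y)+\langle\nabla\Phi(y),x-y\rangle+\frac{\sigma_\Phi}{2}\|x-y\|^2$. Its Bregman divergence is $D_\Phi(x,y)=\Phi(x)-\Phi(y)-\langle\nabla\Phi(y),x-y\rangle$, and $D_{\Phi,\mathcal X}^2=\sup_{x,y\in\mathcal X}D_\Phi(x,y)$ with $D_{\Phi,\mathcal X}\ge 0$. DSCMD-N. Starting from deterministic $x_i^0\in\mathcal X$, with stepsizes $\alpha_t>0$ and noise magnitudes $r_t>0$, for $t=0,1,2,\dots$ and $i\in\mathcal V$: $$y_i^t=\sum_{j=1}^N[P^t]_{ij}(x_j^t+r_t\xi_{ij}^t),\qquad x_i^{t+1}=\arg\min_{x\in\mathcal X}\Big\{\langle\tilde g_i^t,x\rangle+\frac1{\alpha_t}D_\Phi(x,y_i^t)+\chi_i(x)\Big\}.$$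 Here $P^t$ is an $N\times N$ weight matrix, $\xi_{ij}^t$ is a random vector in $\mathbb R^n$, and $\tilde g_i^t=\tilde g_i(y_i^t)$ is a stochastic subgradient of $f_i$ queried at $y_i^t$. $\mathcal F_t$ is the $\sigma$-algebra of the history up to time $t$ ($\mathcal F_{-1}$ trivial); all processes are adapted, the noises and stochastic subgradients of time $t$ being $\mathcal F_t$-measurable. Network assumption. Each $P^t$ is doubly stochastic with nonnegative entries; $E^t=\{(i,j):[P^t]_{ij}>0\}$; there is an integer $B\ge1$ such that the graph $(\mathcal V,\bigcup_{t=sB+1}^{(s+1)B}E^t)$ is strongly connected for every $s\ge0$; there is $\theta\in(0,1)$ with $[P^t]_{ii}\ge\theta$ for all $i,t$ and $[P^t]_{ij}\ge\theta$ whenever $(j,i)\in E^t$. Stochastic-subgradient assumption. There is $G_f\ge0$ such that at any $x\in\mathcal X$, $\mathbb E[\tilde g_i(x)\mid\mathcal F_{t-1}]=g_i(x)\in\partial f_i(x)$ and $\mathbb E[\|\tilde g_i(x)\|^2\mid\mathcal F_{t-1}]\le G_f^2$; the same holds at the query points: conditionally on $\mathcal F_{t-1}$ and the time-$t$ noises, $\tilde g_i^t$ has mean $g_i(y_i^t)\in\partial f_i(y_i^t)$ and second moment (of the norm) at most $G_f^2$. Noise assumption. At each time $t$, the noise on link $(i,j)$ is independent of the noise on link $(i',j')$ for $i\ne i'$, $j\neq j'$; and $\mathbb E[\|\xi_{ij}^t\|^2\mid\mathcal F_{t-1}]\le\nu$ for all $i,j\in\mathcal V$ and $t$. Mirror-map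 assumption. $\|\nabla\Phi(x)-\nabla\Phi(y)\|\le L_\Phi\|x-y\|$ for all $x,y\in\mathbb R^n$; and $D_\Phi(a,\sum_{i=1}^N\nu_ib_i)\le\sum_{i=1}^N\nu_iD_\Phi(a,b_i)$ for all $a,b_1,\dots,b_N\in\mathbb R^n$ and $\nu_i\in[0,1]$ with $\sum_i\nu_i=1$. Constants. With $\omega=(1-\frac{\theta}{4N^2})^{-2}$ and $\gamma=(1-\frac{\theta}{4N^2})^{1/B}$: $C_1=\frac{2N\omega}{1-\gamma}[(N+1)G_f+NG_\chi]\sum_{j=1}^N\|x_j^0\|$; $C_2=ND_{\Phi,\mathcal X}^2$; $C_3=\big((4N+\frac{2N^2\omega}{1-\gamma})[(N+1)G_f+NG_\chi]+NG_\chi\big)\frac{G_f+G_\chi}{\sigma_\Phi}+\frac{NG_f^2}{2\sigma_\Phi}$; $C_4=(4N+\frac{2N^2\omega}{1-\gamma})[(N+1)G_f+NG_\chi]N\sqrt\nu+(G_f+G_\chi)N^2\sqrt\nu$; $C_5=\sqrt{2/\sigma_\Phi}\,D_{\Phi,\mathcal X}L_\Phi N\sqrt\nu$; $C_6=NL_\Phi\nu$. *)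

theory Defs
  imports "HOL-Probability.Probability" "Graph_Theory.Digraph_Component"
begin

section \<open>Convex analysis\<close>

definition subdiff :: "('a::euclidean_space \<Rightarrow> real) \<Rightarrow> 'a \<Rightarrow> 'a set" where
  "subdiff f x = {g. \<forall>z. f z \<ge> f x + inner g (z - x)}"

definition subgrad_bound :: "'a set \<Rightarrow> ('a::euclidean_space \<Rightarrow> real) \<Rightarrow> real" where
  "subgrad_bound X f = Sup {norm g | g x. x \<in> X \<and> g \<in> subdiff f x}"

definition grad :: "('a::euclidean_space \<Rightarrow> real) \<Rightarrow> 'a \<Rightarrow> 'a" where
  "grad f x = (THE D. GDERIV f x :> D)"

definition cont_differentiable :: "('a::euclidean_space \<Rightarrow> real) \<Rightarrow> bool" where
  "cont_differentiable f \<longleftrightarrow> (\<forall>x. GDERIV f x :> grad f x) \<and> continuous_on UNIV (grad f)"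

definition strongly_convex :: "real \<Rightarrow> ('a::euclidean_space \<Rightarrow> real) \<Rightarrow> bool" where
  "strongly_convex \<sigma> f \<longleftrightarrow>
     (\<forall>x y. f x \<ge> f y + inner (grad f y) (x - y) + \<sigma> / 2 * (norm (x - y))\<^sup>2)"

definition bregman :: "('a::euclidean_space \<Rightarrow> real) \<Rightarrow> 'a \<Rightarrow> 'a \<Rightarrow> real" where
  "bregman \<Phi> x y = \<Phi> x - \<Phi> y - inner (grad \<Phi> y) (x - y)"

definition bregman_diam :: "('a::euclidean_space \<Rightarrow> real) \<Rightarrow> 'a set \<Rightarrow> real" where
  "bregman_diam \<Phi> X = sqrt (SUP (x, y) \<in> X \<times> X. bregman \<Phi> x y)"

definition mirror_map_assumption ::
  "nat \<Rightarrow> ('a::euclidean_space \<Rightarrow> real) \<Rightarrow> real \<Rightarrow> bool" where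
  "mirror_map_assumption N \<Phi> L \<longleftrightarrow>
     (\<forall>x y. norm (grad \<Phi> x - grad \<Phi> y) \<le> L * norm (x - y)) \<and>
     (\<forall>a b w. (\<forall>i\<in>{1..N}. 0 \<le> w i \<and> w i \<le> 1) \<and> (\<Sum>i=1..N. w i) = 1 \<longrightarrow>
        bregman \<Phi> a (\<Sum>i=1..N. w i *\<^sub>R b i) \<le> (\<Sum>i=1..N. w i * bregman \<Phi> a (b i)))"


section \<open>Communication network\<close>

definition doubly_stochastic :: "nat \<Rightarrow> (nat \<Rightarrow> nat \<Rightarrow> real) \<Rightarrow> bool" where
  "doubly_stochastic N A \<longleftrightarrow>
     (\<forall>i\<in>{1..N}. \<forall>j\<in>{1..N}. 0 \<le> A i j) \<and>
     (\<forall>i\<in>{1..N}. (\<Sum>j=1..N. A i j) = 1) \<and>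
     (\<forall>j\<in>{1..N}. (\<Sum>i=1..N. A i j) = 1)"

definition edges :: "nat \<Rightarrow> (nat \<Rightarrow> nat \<Rightarrow> real) \<Rightarrow> (nat \<times> nat) set" where
  "edges N A = {(i, j). i \<in> {1..N} \<and> j \<in> {1..N} \<and> A i j > 0}"

(* The reversed pair (j, i) in the last clause is intended as it stands; it forces the support
   of every weight matrix to be symmetric. *)
definition network_assumption ::
  "nat \<Rightarrow> (nat \<Rightarrow> nat \<Rightarrow> nat \<Rightarrow> real) \<Rightarrow> nat \<Rightarrow> real \<Rightarrow> bool" where
  "network_assumption N P B \<theta> \<longleftrightarrow>
     (\<forall>t. doubly_stochastic N (P t)) \<and>
     B \<ge> 1 \<and>
     (\<forall>s. strongly_connected (with_proj
        \<lparr>pverts = {1..N}, parcs = (\<Union>t\<in>{s * B + 1..(s + 1) * B}. edges N (P t))\<rparr>)) \<and>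
     0 < \<theta> \<and> \<theta> < 1 \<and>
     (\<forall>t. \<forall>i\<in>{1..N}. P t i i \<ge> \<theta>) \<and>
     (\<forall>t. \<forall>i\<in>{1..N}. \<forall>j\<in>{1..N}. (j, i) \<in> edges N (P t) \<longrightarrow> P t i j \<ge> \<theta>)"


section \<open>Conditioning\<close>

definition vec_cond_exp ::
  "'w measure \<Rightarrow> 'w measure \<Rightarrow> ('w \<Rightarrow> 'a::euclidean_space) \<Rightarrow> 'w \<Rightarrow> 'a" where
  "vec_cond_exp M G Z \<omega> = (\<Sum>b\<in>Basis. real_cond_exp M G (\<lambda>\<omega>'. inner (Z \<omega>') b) \<omega> *\<^sub>R b)"

(* The bound is stated for the extended nonnegative conditional expectation because
   real_cond_exp of a nonintegrable function is not meaningful; in particular the bound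
   implies that the second moment is finite. *)
definition cond_second_moment_le ::
  "'w measure \<Rightarrow> 'w measure \<Rightarrow> ('w \<Rightarrow> 'a::euclidean_space) \<Rightarrow> real \<Rightarrow> bool" where
  "cond_second_moment_le M G Z c \<longleftrightarrow>
     (AE \<omega> in M. nn_cond_exp M G (\<lambda>\<omega>'. ennreal ((norm (Z \<omega>'))\<^sup>2)) \<omega> \<le> ennreal c)"

(* past M \<F> t is the sigma-algebra with index t - 1; the one with index -1 is trivial. *)
definition past :: "'w measure \<Rightarrow> (nat \<Rightarrow> 'w measure) \<Rightarrow> nat \<Rightarrow> 'w measure" where
  "past M \<F> t = (case t of 0 \<Rightarrow> sigma (space M) {} | Suc s \<Rightarrow> \<F> s)"

(* The sigma-algebra generated by the history before time t and the link noises of time t. *)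
definition past_and_noise ::
  "nat \<Rightarrow> 'w measure \<Rightarrow> (nat \<Rightarrow> 'w measure) \<Rightarrow> (nat \<Rightarrow> nat \<Rightarrow> nat \<Rightarrow> 'w \<Rightarrow> 'a::euclidean_space)
     \<Rightarrow> nat \<Rightarrow> 'w measure" where
  "past_and_noise N M \<F> \<xi> t = sigma (space M)
     (sets (past M \<F> t) \<union>
      {\<xi> i j t -` A \<inter> space M | i j A. i \<in> {1..N} \<and> j \<in> {1..N} \<and> A \<in> sets borel})"


section \<open>Stochastic assumptions and the iteration\<close>

(* Agents are indexed by 1..N. The process indices are: x i t, y i t and \<xi> i j t for agents
   i, j and time t; gt i t z \<omega> is the answer of the stochastic oracle of agent i at time t
   when it is queried at the point z. *)

definition adapted_processes ::
  "nat \<Rightarrow> 'w measure \<Rightarrow> (nat \<Rightarrow> 'w measure) \<Rightarrow> 'a set \<Rightarrow> (nat \<Rightarrow> nat \<Rightarrow> 'w \<Rightarrow> 'a)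
     \<Rightarrow> (nat \<Rightarrow> nat \<Rightarrow> 'w \<Rightarrow> 'a) \<Rightarrow> (nat \<Rightarrow> nat \<Rightarrow> nat \<Rightarrow> 'w \<Rightarrow> 'a::euclidean_space)
     \<Rightarrow> (nat \<Rightarrow> nat \<Rightarrow> 'a \<Rightarrow> 'w \<Rightarrow> 'a) \<Rightarrow> bool" where
  "adapted_processes N M \<F> X x y \<xi> gt \<longleftrightarrow>
     filtration (space M) \<F> \<and>
     (\<forall>t. subalgebra M (\<F> t)) \<and>
     (\<forall>t. \<forall>i\<in>{1..N}.
        x i t \<in> borel_measurable (past M \<F> t) \<and>
        y i t \<in> borel_measurable (\<F> t) \<and>
        (\<forall>j\<in>{1..N}. \<xi> i j t \<in> borel_measurable (\<F> t)) \<and>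
        (\<forall>z\<in>X. gt i t z \<in> borel_measurable (\<F> t)) \<and>
        (\<lambda>\<omega>. gt i t (y i t \<omega>) \<omega>) \<in> borel_measurable (\<F> t))"

definition stochastic_subgradient_assumption ::
  "nat \<Rightarrow> 'w measure \<Rightarrow> (nat \<Rightarrow> 'w measure) \<Rightarrow> 'a set \<Rightarrow> (nat \<Rightarrow> 'a \<Rightarrow> real)
     \<Rightarrow> (nat \<Rightarrow> nat \<Rightarrow> 'w \<Rightarrow> 'a) \<Rightarrow> (nat \<Rightarrow> nat \<Rightarrow> nat \<Rightarrow> 'w \<Rightarrow> 'a::euclidean_space)
     \<Rightarrow> (nat \<Rightarrow> nat \<Rightarrow> 'a \<Rightarrow> 'w \<Rightarrow> 'a) \<Rightarrow> (nat \<Rightarrow> 'a \<Rightarrow> 'a) \<Rightarrow> real \<Rightarrow> bool" where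
  "stochastic_subgradient_assumption N M \<F> X f y \<xi> gt g Gf \<longleftrightarrow>
     Gf \<ge> 0 \<and>
     (\<forall>t. \<forall>i\<in>{1..N}. \<forall>z\<in>X.
        g i z \<in> subdiff (f i) z \<and>
        (AE \<omega> in M. vec_cond_exp M (past M \<F> t) (gt i t z) \<omega> = g i z) \<and>
        cond_second_moment_le M (past M \<F> t) (gt i t z) (Gf\<^sup>2)) \<and>
     (\<forall>t. \<forall>i\<in>{1..N}.
        (AE \<omega> in M. g i (y i t \<omega>) \<in> subdiff (f i) (y i t \<omega>)) \<and>
        (AE \<omega> in M. vec_cond_exp M (past_and_noise N M \<F> \<xi> t) (\<lambda>\<omega>'. gt i t (y i t \<omega>') \<omega>') \<omega>
                      = g i (y i t \<omega>)) \<and>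
        cond_second_moment_le M (past_and_noise N M \<F> \<xi> t) (\<lambda>\<omega>'. gt i t (y i t \<omega>') \<omega>') (Gf\<^sup>2))"

definition noise_assumption ::
  "nat \<Rightarrow> 'w measure \<Rightarrow> (nat \<Rightarrow> 'w measure)
     \<Rightarrow> (nat \<Rightarrow> nat \<Rightarrow> nat \<Rightarrow> 'w \<Rightarrow> 'a::euclidean_space) \<Rightarrow> real \<Rightarrow> bool" where
  "noise_assumption N M \<F> \<xi> \<nu> \<longleftrightarrow>
     \<nu> \<ge> 0 \<and>
     (\<forall>t. \<forall>i\<in>{1..N}. \<forall>j\<in>{1..N}. \<forall>i'\<in>{1..N}. \<forall>j'\<in>{1..N}. i \<noteq> i' \<and> j \<noteq> j' \<longrightarrow>
        prob_space.indep_var M borel (\<xi> i j t) borel (\<xi> i' j' t)) \<and>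
     (\<forall>t. \<forall>i\<in>{1..N}. \<forall>j\<in>{1..N}. cond_second_moment_le M (past M \<F> t) (\<xi> i j t) \<nu>)"

definition dscmd_n ::
  "nat \<Rightarrow> 'w measure \<Rightarrow> 'a set \<Rightarrow> (nat \<Rightarrow> 'a \<Rightarrow> real) \<Rightarrow> ('a \<Rightarrow> real) \<Rightarrow> (nat \<Rightarrow> nat \<Rightarrow> nat \<Rightarrow> real)
     \<Rightarrow> (nat \<Rightarrow> real) \<Rightarrow> (nat \<Rightarrow> real) \<Rightarrow> (nat \<Rightarrow> 'a) \<Rightarrow> (nat \<Rightarrow> nat \<Rightarrow> 'w \<Rightarrow> 'a)
     \<Rightarrow> (nat \<Rightarrow> nat \<Rightarrow> 'w \<Rightarrow> 'a) \<Rightarrow> (nat \<Rightarrow> nat \<Rightarrow> nat \<Rightarrow> 'w \<Rightarrow> 'a::euclidean_space)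
     \<Rightarrow> (nat \<Rightarrow> nat \<Rightarrow> 'a \<Rightarrow> 'w \<Rightarrow> 'a) \<Rightarrow> bool" where
  "dscmd_n N M X chi \<Phi> P \<alpha> r x0 x y \<xi> gt \<longleftrightarrow>
     (\<forall>i\<in>{1..N}. x0 i \<in> X) \<and>
     (\<forall>\<omega>\<in>space M. \<forall>i\<in>{1..N}. x i 0 \<omega> = x0 i) \<and>
     (\<forall>\<omega>\<in>space M. \<forall>t. \<forall>i\<in>{1..N}.
        y i t \<omega> = (\<Sum>j=1..N. P t i j *\<^sub>R (x j t \<omega> + r t *\<^sub>R \<xi> i j t \<omega>))) \<and>
     (\<forall>\<omega>\<in>space M. \<forall>t. \<forall>i\<in>{1..N}.
        is_arg_min
          (\<lambda>z. inner (gt i t (y i t \<omega>) \<omega>) z + 1 / \<alpha> t * bregman \<Phi> z (y i t \<omega>) + chi i z)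
          (\<lambda>z. z \<in> X) (x i (Suc t) \<omega>))"


section \<open>Constants\<close>

definition G_chi :: "nat \<Rightarrow> 'a set \<Rightarrow> (nat \<Rightarrow> 'a::euclidean_space \<Rightarrow> real) \<Rightarrow> real" where
  "G_chi N X chi = Max ((\<lambda>i. subgrad_bound X (chi i)) ` {1..N})"

definition omega_const :: "nat \<Rightarrow> real \<Rightarrow> real" where
  "omega_const N \<theta> = 1 / (1 - \<theta> / (4 * (real N)\<^sup>2))\<^sup>2"

definition gamma_const :: "nat \<Rightarrow> nat \<Rightarrow> real \<Rightarrow> real" where
  "gamma_const N B \<theta> = (1 - \<theta> / (4 * (real N)\<^sup>2)) powr (1 / real B)"

(* In C1 to C6, D is the Bregman diameter itself, not its square. *)

definition C1 ::
  "nat \<Rightarrow> real \<Rightarrow> real \<Rightarrow> real \<Rightarrow> real \<Rightarrow> (nat \<Rightarrow> 'a::euclidean_space) \<Rightarrow> real" where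
  "C1 N \<omega> \<gamma> Gf Gchi x0 =
     2 * real N * \<omega> / (1 - \<gamma>) * ((real N + 1) * Gf + real N * Gchi)
       * (\<Sum>j=1..N. norm (x0 j))"

definition C2 :: "nat \<Rightarrow> real \<Rightarrow> real" where
  "C2 N D = real N * D\<^sup>2"

definition C3 :: "nat \<Rightarrow> real \<Rightarrow> real \<Rightarrow> real \<Rightarrow> real \<Rightarrow> real \<Rightarrow> real" where
  "C3 N \<omega> \<gamma> Gf Gchi \<sigma> =
     ((4 * real N + 2 * (real N)\<^sup>2 * \<omega> / (1 - \<gamma>)) * ((real N + 1) * Gf + real N * Gchi)
        + real N * Gchi) * ((Gf + Gchi) / \<sigma>)
     + real N * Gf\<^sup>2 / (2 * \<sigma>)"

definition C4 :: "nat \<Rightarrow> real \<Rightarrow> real \<Rightarrow> real \<Rightarrow> real \<Rightarrow> real \<Rightarrow> real" where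
  "C4 N \<omega> \<gamma> Gf Gchi \<nu> =
     (4 * real N + 2 * (real N)\<^sup>2 * \<omega> / (1 - \<gamma>)) * ((real N + 1) * Gf + real N * Gchi)
        * real N * sqrt \<nu>
     + (Gf + Gchi) * (real N)\<^sup>2 * sqrt \<nu>"

definition C5 :: "nat \<Rightarrow> real \<Rightarrow> real \<Rightarrow> real \<Rightarrow> real \<Rightarrow> real" where
  "C5 N \<sigma> D L \<nu> = sqrt (2 / \<sigma>) * D * L * real N * sqrt \<nu>"

definition C6 :: "nat \<Rightarrow> real \<Rightarrow> real \<Rightarrow> real" where
  "C6 N L \<nu> = real N * L * \<nu>"

definition C_kappa :: "real \<Rightarrow> real \<Rightarrow> real \<Rightarrow> real \<Rightarrow> real \<Rightarrow> real \<Rightarrow> real \<Rightarrow> real" where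
  "C_kappa \<kappa> c1 c2 c3 c4 c5 c6 = Max
     {c1 + \<bar>(1 - 2 * (2 * \<kappa> - 1/2)) / (1 - (2 * \<kappa> - 1/2))\<bar> * c6,
      sqrt 2 * c2 + 2 * sqrt 2 * c3,
      2 powr (1 - \<kappa>) * c4 / (1 - \<kappa>),
      2 powr (3/2 - \<kappa>) * c5 / (3/2 - \<kappa>),
      c6 / \<bar>3/2 - 2 * \<kappa>\<bar>}"

end

theory Submission
  imports Defs
begin

text \<open>Agents disagree because their prox steps and the link noises differ. The part of the disagreement
  that is inherited from the past contracts geometrically: over a window of \<open>B\<close> steps the variance of
  the agents' states drops by a factor \<open>1 - \<theta> / (2 * N\<^sup>2)\<close>, since every gap between consecutive initial
  values must be crossed by an edge, and at its first crossing it contributes to the variance lost in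
  the row of the averaging matrix belonging to that edge.

  The query points \<open>y\<close> need not lie in \<open>X\<close>, so the distance of a prox step from \<open>y\<close> cannot be bounded by
  the stepsize alone. In the regret this distance is absorbed by the strong convexity of the mirror map.
  In the disagreement the prox step is compared with the noiseless average of the states, which does lie
  in \<open>X\<close>; this costs a factor \<open>sqrt (L / \<sigma>)\<close> on the noise, absent from the stated constants. That
  factor is paid for at the end: either the claimed bound already exceeds the oscillation of the objective
  on \<open>X\<close>, or the surplus is dominated by a geometric mean of the terms with the constants \<open>C3\<close>, \<open>C4\<close>, \<open>C5\<close>.\<close>

section \<open>Convex functions and the Bregman divergence\<close>

text \<open>The surplus must be bounded by constants that do not contain
  \<open>sqrt (L / \<sigma>)\<close>. Its square is linear in \<open>L * \<nu> / \<sigma>\<close>.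
  So is the product of the terms with \<open>C3\<close>, \<open>C4\<close> and \<open>C5\<close>, up
  to one more factor \<open>\<tau>\<close>, which is \<open>(Gf + Gchi) * D / sqrt \<sigma>\<close>.
  This \<open>\<tau>\<close> is, up to \<open>N\<close> and a numerical constant, the available
  bound for the oscillation of the objective on \<open>X\<close>. Hence, unless the claimed bound
  already exceeds that oscillation bound, \<open>\<tau>\<close> is at least a multiple of
  \<open>C_kappa / (N * T powr (\<kappa> - 1/2))\<close>. Dividing by \<open>\<tau>\<close> turns a
  cubic bound in \<open>C_kappa\<close> for the product into a quadratic one for the square of the
  surplus. The power of \<open>T\<close> introduced in this way is affordable because the noise
  radii decay with \<open>\<kappa> < 1\<close>, and the single factor
  \<open>1 / (1 - \<kappa>)\<close> allowed by the term with \<open>C4\<close> dictates how the sum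
  of the radii has to be estimated.\<close>

lemma subdiffD: "g \<in> subdiff f x \<Longrightarrow> f x - f z \<le> inner g (x - z)"
  by (auto simp: subdiff_def inner_diff_right algebra_simps)

text \<open>The epigraph is separated from the open vertical ray below \<open>(x, f x)\<close>; the
  ray without its endpoint keeps the two convex sets disjoint. Dividing the horizontal part of the
  normal by its vertical part gives the subgradient.\<close>

lemma subdiff_nonempty:
  fixes f :: "'a::euclidean_space \<Rightarrow> real"
  assumes "convex_on UNIV f"
  obtains g where "g \<in> subdiff f x"
proof -
  define E where "E = epigraph UNIV f"
  define T where "T = {x} \<times> {..<f x}"
  have E: "(z, r) \<in> E \<longleftrightarrow> f z \<le> r" for z r by (simp add: E_def epigraph_def)
  have "convex E" using assms by (simp add: E_def convex_epigraph)
  moreover have "convex T" unfolding T_def by (intro convex_Times) auto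
  moreover have "E \<noteq> {}" using E[of x "f x"] by auto
  moreover have "T \<noteq> {}" by (auto simp: T_def)
  moreover have "E \<inter> T = {}" by (auto simp: T_def E)
  ultimately obtain a b where a: "a \<noteq> 0" and le: "\<forall>s\<in>E. inner a s \<le> b"
    and ge: "\<forall>s\<in>T. inner a s \<ge> b"
    by (metis separating_hyperplane_sets)
  obtain u c where uc: "a = (u, c)" by (cases a)
  have le': "inner u z + c * f z \<le> b" for z
    using le E[of z "f z"] by (fastforce simp: uc)
  have ge': "b \<le> inner u x + c * r" if "r < f x" for r
    using ge that by (fastforce simp: uc T_def)
  have "c \<le> 0"
    using le'[of x] ge'[of "f x - 1"] by (simp add: algebra_simps)
  \<comment> \<open>A vertical hyperplane is excluded by testing at \<open>x + u\<close>, which is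
    possible because \<open>f\<close> is finite everywhere.\<close>
  moreover have "c \<noteq> 0"
  proof
    assume c: "c = 0"
    have "inner u (x + u) \<le> inner u x"
      using le'[of "x + u"] ge'[of "f x - 1"] by (simp add: c)
    then have "inner u u \<le> 0" by (simp add: inner_add_right)
    then have "u = 0" by (metis inner_eq_zero_iff inner_ge_zero order_antisym)
    with c a uc show False by (simp add: zero_prod_def)
  qed
  ultimately have c: "c < 0" by simp
  have main: "inner u z + c * f z \<le> inner u x + c * f x" for z
  proof (rule field_le_epsilon)
    fix e :: real assume e: "e > 0"
    have "b \<le> inner u x + c * (f x - e / (- c))"
      using e c by (intro ge') (simp add: divide_pos_neg)
    also have "\<dots> = inner u x + c * f x + e" using c by (simp add: field_simps)
    finally show "inner u z + c * f z \<le> inner u x + c * f x + e" using le'[of z] by simp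
  qed
  define k where "k = - c"
  have "(1 / k) *\<^sub>R u \<in> subdiff f x"
    unfolding subdiff_def
  proof (intro CollectI allI)
    fix z
    have "inner u (z - x) \<le> (f z - f x) * k"
      using main[of z] by (simp add: k_def inner_diff_right algebra_simps)
    then have "inner u (z - x) / k \<le> f z - f x"
      using c by (subst pos_divide_le_eq) (auto simp: k_def)
    then show "f x + inner ((1 / k) *\<^sub>R u) (z - x) \<le> f z" by simp
  qed
  then show thesis by (rule that)
qed

text \<open>A subgradient is tested in its own direction: a unit step along \<open>sgn g\<close>
  raises \<open>f\<close> by at least \<open>norm g\<close>, and \<open>f\<close> is bounded on the
  compact set of points within distance one of \<open>X\<close>. Boundedness is what makes the real
  \<open>Sup\<close> in \<open>subgrad_bound\<close> a genuine upper bound.\<close>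

lemma bdd_above_subgradient_norms:
  fixes f :: "'a::euclidean_space \<Rightarrow> real"
  assumes f: "convex_on UNIV f" and X: "compact X"
  shows "bdd_above {norm g | g x. x \<in> X \<and> g \<in> subdiff f x}"
proof -
  define K where "K = {x + y | x y. x \<in> X \<and> y \<in> cball (0::'a) 1}"
  have "compact K" unfolding K_def by (intro compact_sums X compact_cball)
  moreover have "continuous_on K f"
    using convex_on_continuous[OF open_UNIV f] continuous_on_subset by blast
  ultimately have "bounded (f ` K)" by (intro compact_imp_bounded compact_continuous_image)
  then obtain b where b: "\<And>z. z \<in> K \<Longrightarrow> \<bar>f z\<bar> \<le> b" by (auto simp: bounded_iff)
  have "norm g \<le> 2 * b" if "x \<in> X" "g \<in> subdiff f x" for x g
  proof -
    have xK: "x + y \<in> K" if "norm y \<le> 1" for y using that \<open>x \<in> X\<close> by (auto simp: K_def)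
    have n: "norm (sgn g) \<le> 1" by (simp add: norm_sgn)
    have "norm g = inner g (sgn g)"
      by (cases "g = 0") (auto simp: sgn_div_norm dot_square_norm power2_eq_square)
    also have "\<dots> \<le> f (x + sgn g) - f x"
      using that(2) by (auto simp: subdiff_def algebra_simps dest: spec[of _ "x + sgn g"])
    also have "\<dots> \<le> 2 * b" using b[OF xK[OF n]] b[OF xK[of 0]] by simp
    finally show ?thesis .
  qed
  then show ?thesis by (intro bdd_aboveI[of _ "2 * b"]) auto
qed

lemma subdiff_norm_le:
  fixes f :: "'a::euclidean_space \<Rightarrow> real"
  assumes "convex_on UNIV f" "compact X" "x \<in> X" "g \<in> subdiff f x"
  shows "norm g \<le> subgrad_bound X f"
  unfolding subgrad_bound_def
  by (rule cSup_upper) (use assms bdd_above_subgradient_norms in auto)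

lemma G_chi_ge:
  "i \<in> {1..N} \<Longrightarrow> subgrad_bound X (chi i) \<le> G_chi N X chi"
  by (auto simp: G_chi_def)

lemma G_chi_lipschitz:
  fixes chi :: "nat \<Rightarrow> 'a::euclidean_space \<Rightarrow> real"
  assumes "convex_on UNIV (chi i)" "compact X" "x \<in> X" "i \<in> {1..N}"
  shows "chi i x - chi i z \<le> G_chi N X chi * norm (x - z)"
proof -
  obtain g where g: "g \<in> subdiff (chi i) x" using subdiff_nonempty[OF assms(1)] .
  have "chi i x - chi i z \<le> norm g * norm (x - z)"
    using subdiffD[OF g, of z] norm_cauchy_schwarz[of g "x - z"] by linarith
  also have "\<dots> \<le> G_chi N X chi * norm (x - z)"
    using subdiff_norm_le[OF assms(1-3) g] G_chi_ge[OF assms(4), of X chi]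
    by (intro mult_right_mono) auto
  finally show ?thesis .
qed

lemma G_chi_nonneg:
  fixes chi :: "nat \<Rightarrow> 'a::euclidean_space \<Rightarrow> real"
  assumes "convex_on UNIV (chi i)" "compact X" "x \<in> X" "i \<in> {1..N}"
  shows "0 \<le> G_chi N X chi"
proof -
  obtain g where g: "g \<in> subdiff (chi i) x" using subdiff_nonempty[OF assms(1)] .
  then show ?thesis
    using subdiff_norm_le[OF assms(1-3) g] G_chi_ge[OF assms(4), of X chi] norm_ge_zero[of g] by linarith
qed

section \<open>Bregman divergence and the proximal inequality\<close>

lemma bregman_three_point:
  "bregman \<Phi> a c = bregman \<Phi> a b + bregman \<Phi> b c + inner (grad \<Phi> b - grad \<Phi> c) (a - b)"
  by (simp add: bregman_def inner_diff_left inner_diff_right algebra_simps)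

lemma bregman_ge:
  "strongly_convex \<sigma> \<Phi> \<Longrightarrow> \<sigma> / 2 * (norm (x - y))\<^sup>2 \<le> bregman \<Phi> x y"
  unfolding strongly_convex_def bregman_def by (smt (verit))

text \<open>Adding the nonnegative divergence in the opposite order leaves only the inner product of
  the gradient difference with the displacement, so nothing is integrated along the segment. The
  result has \<open>L\<close> instead of \<open>L / 2\<close>, which is the constant in
  \<open>C6\<close>.\<close>

lemma bregman_le:
  assumes sc: "strongly_convex \<sigma> \<Phi>" "0 \<le> \<sigma>"
    and lip: "norm (grad \<Phi> x - grad \<Phi> y) \<le> L * norm (x - y)"
  shows "bregman \<Phi> x y \<le> L * (norm (x - y))\<^sup>2"
proof -
  have "0 \<le> bregman \<Phi> y x" using bregman_ge[OF sc(1), of y x] sc(2)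
    by (smt (verit) divide_nonneg_nonneg mult_nonneg_nonneg zero_le_power2)
  then have "bregman \<Phi> x y \<le> inner (grad \<Phi> x - grad \<Phi> y) (x - y)"
    by (simp add: bregman_def inner_diff_left inner_diff_right algebra_simps)
  also have "\<dots> \<le> (L * norm (x - y)) * norm (x - y)"
    by (rule order_trans[OF norm_cauchy_schwarz mult_right_mono[OF lip norm_ge_zero]])
  finally show ?thesis by (simp add: power2_eq_square mult.assoc)
qed

lemma real_le_of_le_add_mult:
  fixes a c :: real
  assumes "\<And>s. 0 < s \<Longrightarrow> s \<le> 1 \<Longrightarrow> 0 \<le> a + s * c"
  shows "0 \<le> a"
proof (rule ccontr)
  assume "\<not> 0 \<le> a"
  define s where "s = min 1 (- a / (2 * (\<bar>c\<bar> + 1)))"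
  have s: "0 < s" "s \<le> 1" "s \<le> - a / (2 * (\<bar>c\<bar> + 1))"
    using \<open>\<not> 0 \<le> a\<close> by (auto simp: s_def divide_less_0_iff)
  have "s * c \<le> s * (\<bar>c\<bar> + 1)" using s by (intro mult_left_mono) auto
  also have "\<dots> \<le> - a / 2" using s(3) by (simp add: field_simps)
  finally show False using assms[OF s(1,2)] \<open>\<not> 0 \<le> a\<close> by simp
qed

text \<open>First-order optimality of the proximal point. As \<open>chi\<close> may be nonsmooth,
  the minimiser is compared with points of the segment from \<open>z\<close> to \<open>x\<close>:
  convexity handles \<open>chi\<close>, the Lipschitz gradient makes the change of the divergence
  linear up to a term quadratic in \<open>s\<close>, and letting \<open>s\<close> tend to 0 leaves a
  gradient inner product that the three-point identity rewrites.\<close>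

lemma bregman_prox_ineq:
  fixes \<Phi> :: "'a::euclidean_space \<Rightarrow> real"
  assumes X: "convex X" and chi: "convex_on UNIV chi" and \<alpha>: "\<alpha> > 0"
    and sc: "strongly_convex \<sigma> \<Phi>" "0 \<le> \<sigma>"
    and lip: "\<And>x y. norm (grad \<Phi> x - grad \<Phi> y) \<le> L * norm (x - y)"
    and z: "is_arg_min (\<lambda>z. inner g z + 1 / \<alpha> * bregman \<Phi> z y + chi z) (\<lambda>z. z \<in> X) z"
    and x: "x \<in> X"
  shows "\<alpha> * inner g (z - x) + \<alpha> * (chi z - chi x) \<le> bregman \<Phi> x y - bregman \<Phi> z y - bregman \<Phi> x z"
proof -
  define d where "d = x - z"
  have zX: "z \<in> X" and zmin: "\<And>w. w \<in> X \<Longrightarrow> inner g z + 1 / \<alpha> * bregman \<Phi> z y + chi z \<le>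
      inner g w + 1 / \<alpha> * bregman \<Phi> w y + chi w"
    using z by (auto simp: is_arg_min_linorder)
  have "0 \<le> (\<alpha> * inner g d + \<alpha> * (chi x - chi z) + inner (grad \<Phi> z - grad \<Phi> y) d)
      + s * (L * (norm d)\<^sup>2)" if s: "0 < s" "s \<le> 1" for s
  proof -
    define w where "w = z + s *\<^sub>R d"
    have weq: "w = (1 - s) *\<^sub>R z + s *\<^sub>R x" by (simp add: w_def d_def algebra_simps)
    have wX: "w \<in> X" unfolding weq using X x zX s by (intro convexD) auto
    have cw: "chi w \<le> (1 - s) * chi z + s * chi x"
      unfolding weq using chi s by (intro convex_onD) auto
    \<comment> \<open>The gradient inequality is based at \<open>w\<close>, not at \<open>z\<close>,
      so that it bounds the increment of \<open>\<Phi>\<close> from above; replacing the gradient at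
      \<open>w\<close> by the one at \<open>z\<close> costs only second order in
      \<open>s\<close>.\<close>
    have "0 \<le> bregman \<Phi> z w" using bregman_ge[OF sc(1), of z w] sc(2)
      by (smt (verit) divide_nonneg_nonneg mult_nonneg_nonneg zero_le_power2)
    then have "\<Phi> w - \<Phi> z \<le> s * inner (grad \<Phi> w) d"
      by (simp add: bregman_def w_def)
    also have "s * inner (grad \<Phi> w) d = s * inner (grad \<Phi> z) d + s * inner (grad \<Phi> w - grad \<Phi> z) d"
      by (simp add: inner_diff_left right_diff_distrib)
    also have "s * inner (grad \<Phi> w - grad \<Phi> z) d \<le> s * ((L * norm (w - z)) * norm d)"
      using s by (intro mult_left_mono order_trans[OF norm_cauchy_schwarz mult_right_mono[OF lip norm_ge_zero]]) auto
    also have "(L * norm (w - z)) * norm d = s * (L * (norm d)\<^sup>2)"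
      using s by (simp add: w_def power2_eq_square)
    finally have dPhi: "\<Phi> w - \<Phi> z \<le> s * inner (grad \<Phi> z) d + s * (s * (L * (norm d)\<^sup>2))"
      by simp
    have "bregman \<Phi> w y - bregman \<Phi> z y = \<Phi> w - \<Phi> z - s * inner (grad \<Phi> y) d"
      by (simp add: bregman_def w_def inner_diff_right inner_add_right)
    then have bw: "bregman \<Phi> w y - bregman \<Phi> z y
        \<le> s * inner (grad \<Phi> z - grad \<Phi> y) d + s * (s * (L * (norm d)\<^sup>2))"
      using dPhi by (simp add: inner_diff_left right_diff_distrib)
    have gw: "inner g w = inner g z + s * inner g d" by (simp add: w_def inner_add_right)
    have "0 \<le> s * inner g d + 1 / \<alpha> * (bregman \<Phi> w y - bregman \<Phi> z y) + (chi w - chi z)"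
      using zmin[OF wX] by (simp add: gw right_diff_distrib)
    then have "0 \<le> \<alpha> * (s * inner g d + 1 / \<alpha> * (bregman \<Phi> w y - bregman \<Phi> z y) + (chi w - chi z))"
      using \<alpha> by (intro mult_nonneg_nonneg) auto
    also have "\<dots> = \<alpha> * (s * inner g d) + (bregman \<Phi> w y - bregman \<Phi> z y) + \<alpha> * (chi w - chi z)"
      using \<alpha> by (simp add: distrib_left)
    also have "\<alpha> * (chi w - chi z) \<le> \<alpha> * (s * (chi x - chi z))"
      using cw \<alpha> by (intro mult_left_mono) (auto simp: algebra_simps)
    finally have "0 \<le> \<alpha> * (s * inner g d) + (s * inner (grad \<Phi> z - grad \<Phi> y) d + s * (s * (L * (norm d)\<^sup>2)))
        + \<alpha> * (s * (chi x - chi z))" using bw by linarith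
    also have "\<dots> = s * ((\<alpha> * inner g d + \<alpha> * (chi x - chi z) + inner (grad \<Phi> z - grad \<Phi> y) d)
        + s * (L * (norm d)\<^sup>2))" by (simp only: algebra_simps)
    finally have "0 \<le> s * ((\<alpha> * inner g d + \<alpha> * (chi x - chi z) + inner (grad \<Phi> z - grad \<Phi> y) d)
        + s * (L * (norm d)\<^sup>2))" .
    then show ?thesis using s by (simp add: zero_le_mult_iff)
  qed
  then have "0 \<le> \<alpha> * inner g d + \<alpha> * (chi x - chi z) + inner (grad \<Phi> z - grad \<Phi> y) d"
    by (rule real_le_of_le_add_mult)
  moreover have "inner g (z - x) = - inner g d" by (simp add: d_def inner_diff_right)
  moreover have "bregman \<Phi> x y - bregman \<Phi> z y - bregman \<Phi> x z = inner (grad \<Phi> z - grad \<Phi> y) d"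
    using bregman_three_point[of \<Phi> x y z] unfolding d_def by linarith
  ultimately show ?thesis by (simp add: right_diff_distrib)
qed

lemma
  fixes \<Phi> :: "'a::euclidean_space \<Rightarrow> real"
  assumes \<Phi>: "cont_differentiable \<Phi>"
  shows cont_differentiable_continuous: "continuous_on UNIV \<Phi>"
    and cont_differentiable_continuous_grad: "continuous_on UNIV (grad \<Phi>)"
proof -
  show "continuous_on UNIV (grad \<Phi>)" using \<Phi> by (simp add: cont_differentiable_def)
  have "isCont \<Phi> x" for x
    using \<Phi> by (auto simp: cont_differentiable_def gderiv_def intro: has_derivative_continuous)
  then show "continuous_on UNIV \<Phi>" by (simp add: continuous_at_imp_continuous_on)
qed

lemma continuous_on_bregman:
  fixes \<Phi> :: "'a::euclidean_space \<Rightarrow> real"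
  assumes "cont_differentiable \<Phi>"
  shows "continuous_on S (\<lambda>(x, y). bregman \<Phi> x y)"
proof -
  note c = cont_differentiable_continuous[OF assms] cont_differentiable_continuous_grad[OF assms]
  have "continuous_on UNIV (\<lambda>p. \<Phi> (fst p) - \<Phi> (snd p) - inner (grad \<Phi> (snd p)) (fst p - snd p))"
    by (intro continuous_intros continuous_on_compose2[OF c(1)] continuous_on_compose2[OF c(2)]) auto
  then show ?thesis
    by (auto simp: bregman_def case_prod_beta' intro: continuous_on_subset)
qed

lemma
  fixes \<Phi> :: "'a::euclidean_space \<Rightarrow> real"
  assumes \<Phi>: "cont_differentiable \<Phi>" and X: "compact X" and x: "x \<in> X" and y: "y \<in> X"
  shows bregman_le_diam: "bregman \<Phi> x y \<le> (bregman_diam \<Phi> X)\<^sup>2"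
    and bregman_diam_nonneg: "0 \<le> bregman_diam \<Phi> X"
proof -
  define S where "S = (SUP (x, y) \<in> X \<times> X. bregman \<Phi> x y)"
  have "compact ((\<lambda>(x, y). bregman \<Phi> x y) ` (X \<times> X))"
    by (intro compact_continuous_image continuous_on_bregman \<Phi> compact_Times X)
  then have bdd: "bdd_above ((\<lambda>(x, y). bregman \<Phi> x y) ` (X \<times> X))"
    by (intro bounded_imp_bdd_above compact_imp_bounded)
  have le: "bregman \<Phi> a b \<le> S" if "a \<in> X" "b \<in> X" for a b
    unfolding S_def using that by (intro cSUP_upper2[OF bdd, of "(a, b)"]) auto
  have "0 \<le> S" using le[OF x x] by (simp add: bregman_def)
  moreover have "bregman_diam \<Phi> X = sqrt S" by (simp only: bregman_diam_def S_def)
  ultimately show "bregman \<Phi> x y \<le> (bregman_diam \<Phi> X)\<^sup>2" "0 \<le> bregman_diam \<Phi> X"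
    using le[OF x y] by simp_all
qed

lemma norm_le_bregman_diam:
  fixes \<Phi> :: "'a::euclidean_space \<Rightarrow> real"
  assumes \<Phi>: "cont_differentiable \<Phi>" and X: "compact X" and x: "x \<in> X" and y: "y \<in> X"
    and sc: "strongly_convex \<sigma> \<Phi>" "0 < \<sigma>"
  shows "norm (x - y) \<le> sqrt (2 / \<sigma>) * bregman_diam \<Phi> X"
proof -
  have "\<sigma> / 2 * (norm (x - y))\<^sup>2 \<le> (bregman_diam \<Phi> X)\<^sup>2"
    using bregman_ge[OF sc(1), of x y] bregman_le_diam[OF \<Phi> X x y] by linarith
  then have "(norm (x - y))\<^sup>2 \<le> 2 / \<sigma> * (bregman_diam \<Phi> X)\<^sup>2"
    using sc(2) by (simp add: field_simps)
  also have "\<dots> = (sqrt (2 / \<sigma>) * bregman_diam \<Phi> X)\<^sup>2"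
    using sc(2) by (simp add: power_mult_distrib)
  finally show ?thesis
  proof (rule power2_le_imp_le)
    show "0 \<le> sqrt (2 / \<sigma>) * bregman_diam \<Phi> X"
      using bregman_diam_nonneg[OF \<Phi> X x y] sc(2) by simp
  qed
qed

section \<open>Contraction of the consensus dynamics\<close>

definition predecessor :: "real set \<Rightarrow> real \<Rightarrow> real" where
  "predecessor S v = Max {u \<in> S. u < v}"

lemma le_predecessor: "finite S \<Longrightarrow> u \<in> S \<Longrightarrow> u < v \<Longrightarrow> u \<le> predecessor S v"
  by (auto simp: predecessor_def)

text \<open>The intervals from \<open>predecessor S v\<close> to \<open>v\<close> do not overlap and
  lie between \<open>a\<close> and \<open>b\<close>, whatever elements of \<open>S\<close> are
  missing from \<open>A\<close>. The induction removes the largest element and lowers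
  \<open>b\<close> to its predecessor, which still bounds the others.\<close>

lemma sum_gaps_le:
  assumes S: "finite S" and A: "finite A" "A \<subseteq> S"
    and "\<And>v. v \<in> A \<Longrightarrow> a \<le> predecessor S v" "\<And>v. v \<in> A \<Longrightarrow> v \<le> b" "a \<le> b"
  shows "(\<Sum>v\<in>A. v - predecessor S v) \<le> b - a"
  using A assms(4-)
proof (induction A arbitrary: b rule: finite_linorder_max_induct)
  case empty
  then show ?case by simp
next
  case (insert v A)
  have "(\<Sum>v\<in>A. v - predecessor S v) \<le> predecessor S v - a"
    using insert.prems insert.hyps by (intro insert.IH) (auto intro!: le_predecessor[OF S])
  moreover have "v \<notin> A" using insert.hyps by auto
  ultimately show ?case using insert.prems(3)[of v] insert.hyps(1) by simp
qed

text \<open>The gaps telescope. The minimum is left out because its predecessor would be the maximum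
  of the empty set.\<close>

lemma sum_gaps:
  assumes "finite S" "S \<noteq> {}"
  shows "(\<Sum>v\<in>S - {Min S}. v - predecessor S v) = Max S - Min S"
  using assms
proof (induction S rule: finite_linorder_max_induct)
  case empty
  then show ?case by simp
next
  case (insert v S)
  show ?case
  proof (cases "S = {}")
    case False
    have v: "v \<notin> S" "Min S \<in> S" using insert.hyps False by auto
    have "Min S < v" using insert.hyps v(2) by blast
    have Mn: "Min (insert v S) = Min S" 
      using insert.hyps(1) False \<open>Min S < v\<close> by (metis Min_insert min.absorb2 order.strict_implies_order)
    have Mx: "Max (insert v S) = v"

    proof -
      have "Max S < v" using insert.hyps False Max_in[of S] by blast
      then show ?thesis using insert.hyps(1) False by (metis Max_insert max.absorb1 order.strict_implies_order)
    qed
    have p: "predecessor (insert v S) w = predecessor S w" if "w \<in> S" for w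
      unfolding predecessor_def using insert.hyps that by (intro arg_cong[where f = Max]) auto
    have pv: "predecessor (insert v S) v = Max S"
      unfolding predecessor_def using insert.hyps by (intro arg_cong[where f = Max]) auto
    have "insert v S - {Min S} = insert v (S - {Min S})" using \<open>Min S < v\<close> by auto
    then have "(\<Sum>w\<in>insert v S - {Min S}. w - predecessor (insert v S) w)
        = (v - Max S) + (\<Sum>w\<in>S - {Min S}. w - predecessor (insert v S) w)"
      using insert.hyps v by (simp add: pv)
    also have "(\<Sum>w\<in>S - {Min S}. w - predecessor (insert v S) w) = (\<Sum>w\<in>S - {Min S}. w - predecessor S w)"
      by (intro sum.cong) (auto simp: p)
    finally show ?thesis using insert.IH False by (simp add: Mn Mx)
  qed simp
qed

section \<open>Averaging and the variance of the states\<close>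

definition mix :: "nat \<Rightarrow> (nat \<Rightarrow> nat \<Rightarrow> real) \<Rightarrow> (nat \<Rightarrow> 'a::real_vector) \<Rightarrow> nat \<Rightarrow> 'a" where
  "mix N A u i = (\<Sum>j=1..N. A i j *\<^sub>R u j)"

definition mean :: "nat \<Rightarrow> (nat \<Rightarrow> 'a::real_vector) \<Rightarrow> 'a" where
  "mean N u = (1 / real N) *\<^sub>R (\<Sum>j=1..N. u j)"

definition dispersion :: "nat \<Rightarrow> (nat \<Rightarrow> 'a::real_normed_vector) \<Rightarrow> real" where
  "dispersion N u = (\<Sum>i=1..N. (norm (u i - mean N u))\<^sup>2)"

text \<open>Written with \<open>L2_set\<close> so that Minkowski's inequality gives subadditivity,
  which \<open>dispersion\<close> lacks.\<close>

definition sdev :: "nat \<Rightarrow> (nat \<Rightarrow> 'a::real_normed_vector) \<Rightarrow> real" where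
  "sdev N u = L2_set (\<lambda>i. norm (u i - mean N u)) {1..N}"

lemma dispersion_nonneg: "0 \<le> dispersion N u"
  by (auto simp: dispersion_def intro: sum_nonneg)

lemma sdev_eq: "sdev N u = sqrt (dispersion N u)"
  by (simp add: sdev_def L2_set_def dispersion_def)

lemma sdev_nonneg: "0 \<le> sdev N u"
  by (simp add: sdev_eq dispersion_nonneg)

lemma dispersion_real:
  fixes u :: "nat \<Rightarrow> real"
  assumes N: "N \<ge> 1"
  shows "dispersion N u = (\<Sum>i=1..N. (u i)\<^sup>2) - (\<Sum>i=1..N. u i)\<^sup>2 / real N"
proof -
  define s where "s = (\<Sum>i=1..N. u i)"
  have "dispersion N u = (\<Sum>i=1..N. (u i)\<^sup>2 - 2 * s / real N * u i + (s / real N)\<^sup>2)"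
    by (simp add: dispersion_def mean_def s_def power2_diff algebra_simps)
  also have "\<dots> = (\<Sum>i=1..N. (u i)\<^sup>2) - 2 * s / real N * s + real N * (s / real N)\<^sup>2"
    unfolding sum.distrib sum_subtractf sum_distrib_left[symmetric] s_def by simp
  also have "\<dots> = (\<Sum>i=1..N. (u i)\<^sup>2) - s\<^sup>2 / real N"
    using N by (simp add: power2_eq_square field_simps)
  finally show ?thesis by (simp add: s_def)
qed

lemma sum_mix:
  fixes u :: "nat \<Rightarrow> real"
  assumes "doubly_stochastic N A"
  shows "(\<Sum>i=1..N. mix N A u i) = (\<Sum>j=1..N. u j)"
proof -
  have "(\<Sum>i=1..N. mix N A u i) = (\<Sum>j=1..N. \<Sum>i=1..N. A i j * u j)"
    unfolding mix_def by (subst sum.swap) simp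
  also have "\<dots> = (\<Sum>j=1..N. (\<Sum>i=1..N. A i j) * u j)" by (simp add: sum_distrib_right)
  also have "\<dots> = (\<Sum>j=1..N. u j)"
    using assms by (intro sum.cong) (auto simp: doubly_stochastic_def)
  finally show ?thesis .
qed

definition row_variance :: "nat \<Rightarrow> (nat \<Rightarrow> nat \<Rightarrow> real) \<Rightarrow> (nat \<Rightarrow> real) \<Rightarrow> nat \<Rightarrow> real" where
  "row_variance N A u i = (\<Sum>j=1..N. A i j * (u j - mix N A u i)\<^sup>2)"

text \<open>The law of total variance. Unit row sums make each \<open>row_variance\<close> a
  variance, and unit column sums preserve the sum of the values and reassemble the weighted squares.
  One averaging step thus loses exactly the variance within the rows.\<close>

lemma dispersion_mix:
  fixes u :: "nat \<Rightarrow> real"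
  assumes A: "doubly_stochastic N A" and N: "N \<ge> 1"
  shows "dispersion N u = dispersion N (mix N A u) + (\<Sum>i=1..N. row_variance N A u i)"
proof -
  have row: "row_variance N A u i = (\<Sum>j=1..N. A i j * (u j)\<^sup>2) - (mix N A u i)\<^sup>2" if i: "i \<in> {1..N}" for i
  proof -
    define m where "m = mix N A u i"
    have "row_variance N A u i = (\<Sum>j=1..N. A i j * (u j)\<^sup>2 - 2 * m * (A i j * u j) + m\<^sup>2 * A i j)"
      by (simp add: row_variance_def m_def power2_diff algebra_simps)
    also have "\<dots> = (\<Sum>j=1..N. A i j * (u j)\<^sup>2) - 2 * m * (\<Sum>j=1..N. A i j * u j) + m\<^sup>2 * (\<Sum>j=1..N. A i j)"
      by (simp add: sum.distrib sum_subtractf flip: sum_distrib_left)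
    also have "(\<Sum>j=1..N. A i j) = 1" using A i by (simp add: doubly_stochastic_def)
    also have "(\<Sum>j=1..N. A i j * u j) = m" by (simp add: m_def mix_def)
    finally show ?thesis by (simp add: m_def power2_eq_square)
  qed
  have "(\<Sum>i=1..N. \<Sum>j=1..N. A i j * (u j)\<^sup>2) = (\<Sum>j=1..N. (u j)\<^sup>2)"
    using sum_mix[OF A, of "\<lambda>j. (u j)\<^sup>2"] by (simp add: mix_def)
  then have "(\<Sum>i=1..N. row_variance N A u i) = (\<Sum>j=1..N. (u j)\<^sup>2) - (\<Sum>i=1..N. (mix N A u i)\<^sup>2)"
    by (simp add: row sum_subtractf)
  then show ?thesis using sum_mix[OF A, of u] by (simp add: dispersion_real[OF N])
qed

text \<open>Two entries of weight at least \<open>\<theta>\<close> suffice, because the mean of the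
  row cannot be close to both values at once.\<close>

lemma row_variance_ge:
  assumes A: "doubly_stochastic N A" and ij: "i \<in> {1..N}" "j \<in> {1..N}"
    and \<theta>: "0 \<le> \<theta>" "\<theta> \<le> A i i" "\<theta> \<le> A i j"
  shows "\<theta> / 2 * (u i - u j)\<^sup>2 \<le> row_variance N A u i"
proof -
  define m where "m = mix N A u i"
  have nn: "0 \<le> A i k * (u k - m)\<^sup>2" if "k \<in> {1..N}" for k
    using A ij that by (simp add: doubly_stochastic_def)
  show ?thesis
  proof (cases "i = j")
    case True
    then show ?thesis using nn by (auto simp: row_variance_def m_def intro: sum_nonneg)
  next
    case False
    have "0 \<le> \<theta> / 2 * ((u i - m) + (u j - m))\<^sup>2" using \<theta> by simp
    then have "\<theta> / 2 * (u i - u j)\<^sup>2 \<le> \<theta> * (u i - m)\<^sup>2 + \<theta> * (u j - m)\<^sup>2"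
      by (simp add: power2_eq_square algebra_simps)
    also have "\<dots> \<le> A i i * (u i - m)\<^sup>2 + A i j * (u j - m)\<^sup>2"
      using \<theta> by (intro add_mono mult_right_mono) auto
    also have "\<dots> = (\<Sum>k\<in>{i, j}. A i k * (u k - m)\<^sup>2)" using False by simp
    also have "\<dots> \<le> (\<Sum>k=1..N. A i k * (u k - m)\<^sup>2)"
      using ij nn by (intro sum_mono2) auto
    finally show ?thesis by (simp add: row_variance_def m_def)
  qed
qed

lemma row_variance_nonneg:
  assumes A: "doubly_stochastic N A" and i: "i \<in> {1..N}"
  shows "0 \<le> row_variance N A u i"
  unfolding row_variance_def using assms by (intro sum_nonneg) (auto simp: doubly_stochastic_def)

lemma mix_ge:
  fixes u :: "nat \<Rightarrow> real"
  assumes A: "doubly_stochastic N A" and i: "i \<in> {1..N}"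
    and "\<And>j. j \<in> {1..N} \<Longrightarrow> A i j \<noteq> 0 \<Longrightarrow> v \<le> u j"
  shows "v \<le> mix N A u i"
proof -
  have "(\<Sum>j=1..N. A i j * v) \<le> (\<Sum>j=1..N. A i j * u j)"
  proof (rule sum_mono)
    fix j assume "j \<in> {1..N}"
    then show "A i j * v \<le> A i j * u j"
      using assms by (cases "A i j = 0") (auto simp: doubly_stochastic_def intro!: mult_left_mono)
  qed
  moreover have "(\<Sum>j=1..N. A i j * v) = v"
    using A i by (simp add: doubly_stochastic_def flip: sum_distrib_right)
  ultimately show ?thesis by (simp add: mix_def)
qed

lemma mix_le:
  fixes u :: "nat \<Rightarrow> real"
  assumes A: "doubly_stochastic N A" and i: "i \<in> {1..N}"
    and "\<And>j. j \<in> {1..N} \<Longrightarrow> A i j \<noteq> 0 \<Longrightarrow> u j \<le> v"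
  shows "mix N A u i \<le> v"
  using mix_ge[OF A i, where u = "\<lambda>j. - u j" and v = "- v"] assms(3)
  by (simp add: mix_def sum_negf)

section \<open>Repeated averaging and contraction over one window\<close>

primrec mixes :: "nat \<Rightarrow> (nat \<Rightarrow> nat \<Rightarrow> nat \<Rightarrow> real) \<Rightarrow> (nat \<Rightarrow> 'a::real_vector) \<Rightarrow> nat \<Rightarrow> nat \<Rightarrow> 'a" where
  "mixes N P u 0 = u"
| "mixes N P u (Suc k) = mix N (P k) (mixes N P u k)"

lemma mixes_add: "mixes N P u (a + b) = mixes N (\<lambda>k. P (a + k)) (mixes N P u a) b"
  by (induction b) auto

lemma mixes_Suc_left: "mixes N P u (Suc b) = mixes N (\<lambda>k. P (Suc k)) (mix N (P 0) u) b"
  using mixes_add[of N P u 1 b] by simp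

lemma mixes_plus: "mixes N P (\<lambda>i. u i + v i) k = (\<lambda>i. mixes N P u k i + mixes N P v k i)"
  by (induction k) (auto simp: mix_def scaleR_add_right sum.distrib)

lemma mixes_inner:
  fixes u :: "nat \<Rightarrow> 'a::real_inner"
  shows "inner (mixes N P u k i) b = mixes N P (\<lambda>j. inner (u j) b) k i"
  by (induction k arbitrary: i) (auto simp: mix_def inner_sum_left)

lemma dispersion_mixes:
  fixes u :: "nat \<Rightarrow> real"
  assumes "\<And>k. doubly_stochastic N (P k)" and N: "N \<ge> 1"
  shows "dispersion N u = dispersion N (mixes N P u K) + (\<Sum>k<K. \<Sum>i=1..N. row_variance N (P k) (mixes N P u k) i)"
  by (induction K) (use dispersion_mix[OF assms(1) N] in \<open>auto simp: algebra_simps\<close>)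

text \<open>Before the first step with an edge between \<open>U\<close> and its complement, every
  row averages within its own group, so the group \<open>U\<close> stays above \<open>v\<close> and
  the other one below \<open>w\<close>. The first crossing edge therefore still sees both bounds.
  Only weights from \<open>U\<close> to the complement are searched for; symmetry of the support
  excludes influence in the other direction as well.\<close>

lemma first_crossing:
  fixes u :: "nat \<Rightarrow> real"
  assumes ds: "\<And>k. doubly_stochastic N (P k)"
    and supp: "\<And>k i j. i \<in> {1..N} \<Longrightarrow> j \<in> {1..N} \<Longrightarrow> P k j i > 0 \<Longrightarrow> P k i j > 0"
    and cut: "\<exists>k<B. \<exists>i\<in>U. \<exists>j\<in>{1..N} - U. P k i j > 0"
    and U: "U \<subseteq> {1..N}" and v: "\<And>i. i \<in> U \<Longrightarrow> v \<le> u i"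
    and w: "\<And>i. i \<in> {1..N} - U \<Longrightarrow> u i \<le> w"
  shows "\<exists>k<B. \<exists>i\<in>{1..N}. \<exists>j\<in>{1..N}. P k i j > 0 \<and> v \<le> mixes N P u k i \<and> mixes N P u k j \<le> w"
proof -
  define Q where "Q k \<longleftrightarrow> (\<exists>i\<in>U. \<exists>j\<in>{1..N} - U. P k i j > 0)" for k
  define k0 where "k0 = (LEAST k. Q k)"
  obtain k1 where k1: "k1 < B" "Q k1" using cut by (auto simp: Q_def)
  have k0: "Q k0" "k0 < B" using LeastI[of Q, OF k1(2)] Least_le[of Q, OF k1(2)] k1(1) by (auto simp: k0_def)
  have before: "P k i j = 0 \<and> P k j i = 0" if "k < k0" "i \<in> U" "j \<in> {1..N} - U" for k i j
  proof -
    have "\<not> Q k" using that(1) not_less_Least by (auto simp: k0_def)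
    then have "\<not> P k i j > 0" using that by (auto simp: Q_def)
    moreover have "\<not> P k j i > 0" using supp[of i j k] that U calculation by auto
    moreover have "0 \<le> P k i j" "0 \<le> P k j i" using ds[of k] that U by (auto simp: doubly_stochastic_def)
    ultimately show ?thesis by simp
  qed
  have inv: "(\<forall>i\<in>U. v \<le> mixes N P u k i) \<and> (\<forall>i\<in>{1..N} - U. mixes N P u k i \<le> w)" if "k \<le> k0" for k
    using that
  proof (induction k)
    case 0
    then show ?case using v w by auto
  next
    case (Suc k)
    have IH: "\<forall>i\<in>U. v \<le> mixes N P u k i" "\<forall>i\<in>{1..N} - U. mixes N P u k i \<le> w"
      using Suc by auto
    show ?case
    proof (intro conjI ballI)
      fix i assume i: "i \<in> U"
      have "v \<le> mix N (P k) (mixes N P u k) i"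
        using ds U i IH(1) before[of k i] Suc.prems by (intro mix_ge) auto
      then show "v \<le> mixes N P u (Suc k) i" by simp
    next
      fix i assume i: "i \<in> {1..N} - U"
      have "mix N (P k) (mixes N P u k) i \<le> w"
        using ds i IH(2) before[of k _ i] Suc.prems by (intro mix_le) auto
      then show "mixes N P u (Suc k) i \<le> w" by simp
    qed
  qed
  obtain i j where ij: "i \<in> U" "j \<in> {1..N} - U" "P k0 i j > 0" using k0(1) by (auto simp: Q_def)
  show ?thesis
    using inv[of k0] ij U k0(2) by (intro exI[of _ k0] conjI bexI[of _ i] bexI[of _ j]) auto
qed

lemma sum_squares_le_square_sum:
  fixes g :: "'b \<Rightarrow> real"
  assumes "finite A" "\<And>v. v \<in> A \<Longrightarrow> 0 \<le> g v"
  shows "(\<Sum>v\<in>A. (g v)\<^sup>2) \<le> (\<Sum>v\<in>A. g v)\<^sup>2"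
  using assms
proof (induction A rule: finite_induct)
  case (insert v A)
  have "0 \<le> g v * (\<Sum>v\<in>A. g v)" using insert.prems by (intro mult_nonneg_nonneg sum_nonneg) auto
  then show ?case using insert by (auto simp: power2_sum)
qed simp

lemma strongly_connected_cut:
  assumes sc: "strongly_connected (with_proj \<lparr>pverts = V, parcs = E\<rparr>)"
    and U: "U \<subseteq> V" "U \<noteq> {}" "U \<noteq> V"
  obtains i j where "i \<in> U" "j \<in> V - U" "(i, j) \<in> E"
proof -
  obtain a b where ab: "a \<in> U" "b \<in> V - U" using U by blast
  have "(a, b) \<in> rtrancl_on V E"
    using sc ab U(1) by (auto simp: strongly_connected_def reachable_def arcs_ends_def arc_to_ends_def)
  then have "b \<in> U \<or> (\<exists>i\<in>U. \<exists>j\<in>V - U. (i, j) \<in> E)"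
    by (induction rule: rtrancl_on_induct) (use ab in auto)
  then show thesis using ab that by auto
qed

lemma norm_sq_eq_sum_Basis:
  fixes x :: "'a::euclidean_space"
  shows "(norm x)\<^sup>2 = (\<Sum>b\<in>Basis. (inner x b)\<^sup>2)"
  unfolding power2_norm_eq_inner by (subst euclidean_inner) (simp add: power2_eq_square)

lemma dispersion_inner:
  fixes u :: "nat \<Rightarrow> 'a::euclidean_space"
  shows "dispersion N u = (\<Sum>b\<in>Basis. dispersion N (\<lambda>i. inner (u i) b))"
proof -
  have "dispersion N u = (\<Sum>i=1..N. \<Sum>b\<in>Basis. (inner (u i - mean N u) b)\<^sup>2)"
    by (simp only: dispersion_def norm_sq_eq_sum_Basis)
  also have "\<dots> = (\<Sum>b\<in>Basis. \<Sum>i=1..N. (inner (u i - mean N u) b)\<^sup>2)" by (rule sum.swap)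
  also have "\<dots> = (\<Sum>b\<in>Basis. dispersion N (\<lambda>i. inner (u i) b))"
    by (simp add: dispersion_def mean_def inner_diff_left inner_sum_left)
  finally show ?thesis .
qed

lemma sdev_add: "sdev N (\<lambda>i. u i + v i) \<le> sdev N u + sdev N v"
proof -
  have "sdev N (\<lambda>i. u i + v i) \<le> L2_set (\<lambda>i. norm (u i - mean N u) + norm (v i - mean N v)) {1..N}"
    unfolding sdev_def
  proof (rule L2_set_mono)
    fix i
    have *: "u i + v i - mean N (\<lambda>i. u i + v i) = (u i - mean N u) + (v i - mean N v)"
      by (simp add: mean_def sum.distrib scaleR_add_right)
    show "norm (u i + v i - mean N (\<lambda>i. u i + v i)) \<le> norm (u i - mean N u) + norm (v i - mean N v)"
      unfolding * by (rule norm_triangle_ineq)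
  qed auto
  also have "\<dots> \<le> sdev N u + sdev N v" unfolding sdev_def by (rule L2_set_triangle_ineq)
  finally show ?thesis .
qed

text \<open>Centring at the mean only decreases the sum of squares.\<close>

lemma sdev_le_sum_norm:
  fixes u :: "nat \<Rightarrow> 'a::euclidean_space"
  assumes N: "N \<ge> 1"
  shows "sdev N u \<le> (\<Sum>i=1..N. norm (u i))"
proof -
  have "dispersion N u \<le> (\<Sum>b\<in>Basis. \<Sum>i=1..N. (inner (u i) b)\<^sup>2)"
    by (subst dispersion_inner, intro sum_mono) (simp add: dispersion_real[OF N])
  also have "\<dots> = (\<Sum>i=1..N. \<Sum>b\<in>Basis. (inner (u i) b)\<^sup>2)" by (rule sum.swap)
  also have "\<dots> = (\<Sum>i=1..N. (norm (u i))\<^sup>2)"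
    by (simp only: norm_sq_eq_sum_Basis)
  finally have "sdev N u \<le> L2_set (\<lambda>i. norm (u i)) {1..N}" by (simp add: sdev_eq L2_set_def)
  also have "\<dots> \<le> (\<Sum>i=1..N. norm (u i))" by (rule L2_set_le_sum) auto
  finally show ?thesis .
qed

lemma sum_norm_diff_le_sdev:
  assumes l: "l \<in> {1..N}"
  shows "(\<Sum>i=1..N. norm (u l - u i)) \<le> 2 * real N * sdev N u"
proof -
  have le: "norm (u i - mean N u) \<le> sdev N u" if "i \<in> {1..N}" for i
    using member_le_L2_set[of "{1..N}" i "\<lambda>i. norm (u i - mean N u)"] that by (simp add: sdev_def)
  have "(\<Sum>i=1..N. norm (u l - u i)) \<le> (\<Sum>i=1..N. 2 * sdev N u)"
  proof (rule sum_mono)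
    fix i assume "i \<in> {1..N}"
    then show "norm (u l - u i) \<le> 2 * sdev N u"
      using le[OF l] le[of i] norm_triangle_ineq4[of "u l - mean N u" "u i - mean N u"] by simp
  qed
  then show ?thesis by simp
qed

text \<open>Each gap between consecutive initial values is charged to a time and a row with an edge
  spanning it. Gaps charged to the same row are spanned by one single edge and do not overlap, so
  the square of its length dominates the sum of their squares. The total loss is thus at least
  \<open>\<theta> / 2\<close> times the sum of all squared gaps. Cauchy-Schwarz over at most
  \<open>N\<close> gaps and the bound of each deviation by the range cost a factor \<open>N\<close>
  each.\<close>

lemma mixes_contraction:
  fixes u :: "nat \<Rightarrow> real"
  assumes ds: "\<And>k. doubly_stochastic N (P k)" and N: "N \<ge> 1" and \<theta>: "0 < \<theta>"
    and diag: "\<And>k i. i \<in> {1..N} \<Longrightarrow> \<theta> \<le> P k i i"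
    and supp: "\<And>k i j. i \<in> {1..N} \<Longrightarrow> j \<in> {1..N} \<Longrightarrow> P k j i > 0 \<Longrightarrow> \<theta> \<le> P k i j"
    and cut: "\<And>U. U \<subseteq> {1..N} \<Longrightarrow> U \<noteq> {} \<Longrightarrow> U \<noteq> {1..N} \<Longrightarrow> \<exists>k<B. \<exists>i\<in>U. \<exists>j\<in>{1..N} - U. P k i j > 0"
  shows "dispersion N (mixes N P u B) \<le> (1 - \<theta> / (2 * (real N)\<^sup>2)) * dispersion N u"
proof -
  define S where "S = u ` {1..N}"
  define V where "V = S - {Min S}"
  define x where "x = mixes N P u"
  have S: "finite S" "S \<noteq> {}" using N by (auto simp: S_def)
  have below: "{w \<in> S. w < v} \<noteq> {}" if "v \<in> V" for v
  proof -
    have "v \<in> S" "v \<noteq> Min S" using that by (auto simp: V_def)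
    then have "Min S \<in> {w \<in> S. w < v}" using Min_in[OF S] Min_le[OF S(1), of v] by auto
    then show ?thesis by blast
  qed
  have pred: "predecessor S v \<in> S" "predecessor S v < v" if "v \<in> V" for v
    using Max_in[of "{w \<in> S. w < v}"] below[OF that] S(1) by (auto simp: predecessor_def)
  have "\<exists>k<B. \<exists>i\<in>{1..N}. \<exists>j\<in>{1..N}. P k i j > 0 \<and> v \<le> x k i \<and> x k j \<le> predecessor S v"
    if v: "v \<in> V" for v
    unfolding x_def
  proof (rule first_crossing[OF ds, where U = "{i \<in> {1..N}. v \<le> u i}"])
    show "P k i j > 0" if "i \<in> {1..N}" "j \<in> {1..N}" "P k j i > 0" for k i j
      using supp[OF that] \<theta> by linarith
    have "v \<in> S" using v by (simp add: V_def)
    then have "{i \<in> {1..N}. v \<le> u i} \<noteq> {}" by (auto simp: S_def)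
    moreover obtain k where "k \<in> {1..N}" "u k < v"
      using pred[OF v] by (auto simp: S_def)
    then have "{i \<in> {1..N}. v \<le> u i} \<noteq> {1..N}" by (metis (no_types, lifting) mem_Collect_eq not_le)
    ultimately show "\<exists>k<B. \<exists>i\<in>{i \<in> {1..N}. v \<le> u i}. \<exists>j\<in>{1..N} - {i \<in> {1..N}. v \<le> u i}. P k i j > 0"
      by (intro cut) auto
    show "u i \<le> predecessor S v" if "i \<in> {1..N} - {i \<in> {1..N}. v \<le> u i}" for i
      using that by (intro le_predecessor[OF S(1)]) (auto simp: S_def)
  qed auto
  then have "\<forall>v\<in>V. \<exists>p. fst p < B \<and> snd p \<in> {1..N} \<and> (\<exists>j\<in>{1..N}. P (fst p) (snd p) j > 0
      \<and> v \<le> x (fst p) (snd p) \<and> x (fst p) j \<le> predecessor S v)"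
    by fastforce
  \<comment> \<open>The column of the edge is not recorded, so that the fibres of \<open>h\<close>
    correspond to the summands \<open>row_variance\<close>.\<close>
  then obtain h where h: "\<And>v. v \<in> V \<Longrightarrow> fst (h v) < B \<and> snd (h v) \<in> {1..N} \<and> (\<exists>j\<in>{1..N}. P (fst (h v)) (snd (h v)) j > 0
      \<and> v \<le> x (fst (h v)) (snd (h v)) \<and> x (fst (h v)) j \<le> predecessor S v)"
    by metis
  define I where "I = {..<B} \<times> {1..N}"
  have V: "finite V" using S by (simp add: V_def)
  have hI: "h ` V \<subseteq> I"
  proof
    fix p assume "p \<in> h ` V"
    then show "p \<in> I" using h by (auto simp only: I_def mem_Times_iff lessThan_iff)
  qed
  have fib: "\<theta> / 2 * (\<Sum>v | v \<in> V \<and> h v = p. (v - predecessor S v)\<^sup>2) \<le> row_variance N (P (fst p)) (x (fst p)) (snd p)"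
    if p: "p \<in> I" for p
  proof (cases "{v \<in> V. h v = p} = {}")
    case True
    then show ?thesis unfolding True using p by (auto simp: I_def intro: row_variance_nonneg[OF ds])
  next
    case False
    define A where "A = {v \<in> V. h v = p}"
    obtain k i where ki: "p = (k, i)" by (cases p)
    have A: "finite A" "A \<noteq> {}" "A \<subseteq> V" using False V by (auto simp: A_def)
    have Mn: "Min A \<in> A" using A by simp
    then have "Min A \<in> V" "h (Min A) = p" by (auto simp: A_def)
    \<comment> \<open>The partner found for the smallest value of the fibre serves the whole fibre,
      since larger values have predecessors that are no smaller.\<close>
    then obtain j where j: "j \<in> {1..N}" "P k i j > 0" "x k j \<le> predecessor S (Min A)"
      and i: "i \<in> {1..N}" "Min A \<le> x k i"
      using h[of "Min A"] ki by auto
    have up: "v \<le> x k i" if "v \<in> A" for v using that h[of v] ki by (auto simp: A_def)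
    have lo: "x k j \<le> predecessor S v" if "v \<in> A" for v
    proof -
      have vV: "v \<in> V" "Min A \<le> v" using that A by (auto simp: A_def)
      have "predecessor S (Min A) \<le> predecessor S v"
        using pred[OF \<open>Min A \<in> V\<close>] vV by (intro le_predecessor[OF S(1)]) auto
      then show ?thesis using j(3) by simp
    qed
    have "x k j \<le> x k i" using j(3) i(2) pred(2)[OF \<open>Min A \<in> V\<close>] by linarith
    then have "(\<Sum>v\<in>A. v - predecessor S v) \<le> x k i - x k j"
      using A up lo by (intro sum_gaps_le[OF S(1)]) (auto simp: V_def)
    then have "(\<Sum>v\<in>A. v - predecessor S v)\<^sup>2 \<le> (x k i - x k j)\<^sup>2"
      using A pred(2) by (intro power_mono sum_nonneg) (auto simp: less_imp_le)
    moreover have "(\<Sum>v\<in>A. (v - predecessor S v)\<^sup>2) \<le> (\<Sum>v\<in>A. v - predecessor S v)\<^sup>2"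
      using A pred(2) by (intro sum_squares_le_square_sum) (auto simp: less_imp_le)
    ultimately have "\<theta> / 2 * (\<Sum>v\<in>A. (v - predecessor S v)\<^sup>2) \<le> \<theta> / 2 * (x k i - x k j)\<^sup>2"
      using \<theta> by (intro mult_left_mono) auto
    also have "\<dots> \<le> row_variance N (P k) (x k) i"
    proof -
      \<comment> \<open>\<open>supp\<close> is applied twice: positivity of \<open>P k i j\<close>
        makes \<open>P k j i\<close> positive, and this in turn bounds \<open>P k i j\<close> below
        by \<open>\<theta>\<close>.\<close>
      have "P k j i > 0" using supp[OF j(1) i(1) j(2)] \<theta> by linarith
      then show ?thesis
        using i(1) j(1) \<theta> by (intro row_variance_ge[OF ds]) (auto intro: diag supp)
    qed
    finally show ?thesis by (simp add: A_def ki)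
  qed
  have "Max S - Min S \<le> (\<Sum>v\<in>V. v - predecessor S v)" using sum_gaps[OF S] by (simp add: V_def)
  moreover have "Min S \<le> Max S" using S by (simp add: Min_le_iff)
  ultimately have "(Max S - Min S)\<^sup>2 \<le> (\<Sum>v\<in>V. v - predecessor S v)\<^sup>2" by (intro power_mono) auto
  also have "\<dots> \<le> (\<Sum>v\<in>V. (v - predecessor S v)\<^sup>2) * real (card V)" by (rule sum_squared_le_sum_of_squares)
  also have "card V \<le> N"
  proof -
    have "card V \<le> card S" using S by (auto simp: V_def intro: card_mono)
    also have "\<dots> \<le> N" unfolding S_def using card_image_le[of "{1..N}" u] by simp
    finally show ?thesis .
  qed
  then have "(\<Sum>v\<in>V. (v - predecessor S v)\<^sup>2) * real (card V) \<le> (\<Sum>v\<in>V. (v - predecessor S v)\<^sup>2) * real N"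
    by (intro mult_left_mono sum_nonneg) auto
  finally have range: "(Max S - Min S)\<^sup>2 \<le> (\<Sum>v\<in>V. (v - predecessor S v)\<^sup>2) * real N" .
  have "\<theta> / 2 * (\<Sum>v\<in>V. (v - predecessor S v)\<^sup>2)
      = (\<Sum>p\<in>I. \<theta> / 2 * (\<Sum>v | v \<in> V \<and> h v = p. (v - predecessor S v)\<^sup>2))"
    unfolding sum_distrib_left[symmetric] by (subst sum.group) (use V hI in \<open>auto simp: I_def\<close>)
  also have "\<dots> \<le> (\<Sum>p\<in>I. row_variance N (P (fst p)) (x (fst p)) (snd p))"
    by (intro sum_mono fib)
  also have "\<dots> = (\<Sum>k<B. \<Sum>i=1..N. row_variance N (P k) (x k) i)"
    unfolding I_def sum.cartesian_product by (simp add: case_prod_beta')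
  also have "\<dots> = dispersion N u - dispersion N (x B)"
    using dispersion_mixes[where P = P, OF ds N, of u B] by (simp add: x_def)
  finally have drop: "\<theta> / 2 * (\<Sum>v\<in>V. (v - predecessor S v)\<^sup>2) \<le> dispersion N u - dispersion N (x B)" .
  have m: "Min S \<le> mean N u" "mean N u \<le> Max S"
  proof -
    have *: "mean N u = (\<Sum>i=1..N. u i) / real N" by (simp add: mean_def)
    have "real (card {1..N}) * Min S \<le> (\<Sum>i=1..N. u i)" by (rule sum_bounded_below) (use S(1) in \<open>auto simp: S_def\<close>)
    moreover have "(\<Sum>i=1..N. u i) \<le> real (card {1..N}) * Max S" by (rule sum_bounded_above) (use S(1) in \<open>auto simp: S_def\<close>)
    ultimately show "Min S \<le> mean N u" "mean N u \<le> Max S"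
      unfolding * using N by (simp_all add: field_simps)
  qed
  have "dispersion N u \<le> (\<Sum>i=1..N. (Max S - Min S)\<^sup>2)"
    unfolding dispersion_def
  proof (rule sum_mono)
    fix i assume "i \<in> {1..N}"
    then have "Min S \<le> u i" "u i \<le> Max S" using S(1) by (auto simp: S_def)
    then show "(norm (u i - mean N u))\<^sup>2 \<le> (Max S - Min S)\<^sup>2" using m by (intro power_mono) auto
  qed
  then have "dispersion N u \<le> real N * (Max S - Min S)\<^sup>2" by simp
  also have "\<dots> \<le> real N * ((\<Sum>v\<in>V. (v - predecessor S v)\<^sup>2) * real N)"
    using range by (intro mult_left_mono) auto
  finally have "\<theta> / (2 * (real N)\<^sup>2) * dispersion N u
      \<le> \<theta> / (2 * (real N)\<^sup>2) * (real N * ((\<Sum>v\<in>V. (v - predecessor S v)\<^sup>2) * real N))"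
    using \<theta> by (intro mult_left_mono) auto
  also have "\<dots> = \<theta> / 2 * (\<Sum>v\<in>V. (v - predecessor S v)\<^sup>2)"
    using N by (simp add: power2_eq_square)
  finally show ?thesis using drop by (simp add: x_def left_diff_distrib)
qed

section \<open>Geometric decay of disagreement on the network\<close>

lemma network_cut:
  assumes net: "network_assumption N P B \<theta>"
    and U: "U \<subseteq> {1..N}" "U \<noteq> {}" "U \<noteq> {1..N}"
  shows "\<exists>k<B. \<exists>i\<in>U. \<exists>j\<in>{1..N} - U. P (c * B + 1 + k) i j > 0"
proof -
  have "strongly_connected (with_proj
      \<lparr>pverts = {1..N}, parcs = (\<Union>t\<in>{c * B + 1..(c + 1) * B}. edges N (P t))\<rparr>)"
    using net by (simp only: network_assumption_def)
  then obtain i j where ij: "i \<in> U" "j \<in> {1..N} - U"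
    "(i, j) \<in> (\<Union>t\<in>{c * B + 1..(c + 1) * B}. edges N (P t))"
    using strongly_connected_cut[OF _ U] by blast
  then obtain t where t: "c * B + 1 \<le> t" "t \<le> c * B + B" "P t i j > 0"
    by (auto simp: edges_def)
  then show ?thesis
    using ij by (intro exI[of _ "t - (c * B + 1)"] conjI bexI[of _ i] bexI[of _ j]) auto
qed

text \<open>Averaging acts on each coordinate separately and the dispersion is the sum over the
  coordinates, so the scalar contraction carries over with the same factor.\<close>

lemma dispersion_mixes_block:
  fixes u :: "nat \<Rightarrow> 'a::euclidean_space"
  assumes net: "network_assumption N P B \<theta>" and N: "N \<ge> 1"
  shows "dispersion N (mixes N (\<lambda>k. P (c * B + 1 + k)) u B) \<le> (1 - \<theta> / (2 * (real N)\<^sup>2)) * dispersion N u"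
proof -
  define Q where "Q = (\<lambda>k. P (c * B + 1 + k))"
  have "dispersion N (mixes N Q (\<lambda>i. inner (u i) b) B)
      \<le> (1 - \<theta> / (2 * (real N)\<^sup>2)) * dispersion N (\<lambda>i. inner (u i) b)" for b
  proof (rule mixes_contraction)
    show "doubly_stochastic N (Q k)" for k
      using net by (simp add: network_assumption_def Q_def)
    show "\<theta> \<le> Q k i i" if "i \<in> {1..N}" for k i
      using net that by (simp add: network_assumption_def Q_def)
    show "\<theta> \<le> Q k i j" if "i \<in> {1..N}" "j \<in> {1..N}" "0 < Q k j i" for k i j
      using net that by (simp add: network_assumption_def Q_def edges_def)
    show "\<exists>k<B. \<exists>i\<in>U. \<exists>j\<in>{1..N} - U. 0 < Q k i j" if "U \<subseteq> {1..N}" "U \<noteq> {}" "U \<noteq> {1..N}" for U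
      using network_cut[OF net that] by (simp add: Q_def)
  qed (use net N in \<open>auto simp: network_assumption_def\<close>)
  then have "dispersion N (mixes N Q u B) \<le> (\<Sum>b\<in>Basis. (1 - \<theta> / (2 * (real N)\<^sup>2)) * dispersion N (\<lambda>i. inner (u i) b))"
    by (subst dispersion_inner, intro sum_mono) (simp add: mixes_inner)
  also have "\<dots> = (1 - \<theta> / (2 * (real N)\<^sup>2)) * dispersion N u"
    by (subst (2) dispersion_inner) (simp add: sum_distrib_left)
  finally show ?thesis by (simp only: Q_def)
qed

lemma dispersion_mixes_le:
  fixes u :: "nat \<Rightarrow> 'a::euclidean_space"
  assumes ds: "\<And>k. doubly_stochastic N (P k)" and N: "N \<ge> 1"
  shows "dispersion N (mixes N P u k) \<le> dispersion N u"
proof -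
  have le: "dispersion N (mixes N P (\<lambda>i. inner (u i) b) k) \<le> dispersion N (\<lambda>i. inner (u i) b)" for b
  proof -
    have "0 \<le> (\<Sum>l<k. \<Sum>i=1..N. row_variance N (P l) (mixes N P (\<lambda>i. inner (u i) b) l) i)"
      by (intro sum_nonneg row_variance_nonneg[OF ds])
    then show ?thesis
      using dispersion_mixes[where P = P, OF ds N, of "\<lambda>i. inner (u i) b" k] by linarith
  qed
  have "dispersion N (mixes N P u k) = (\<Sum>b\<in>Basis. dispersion N (\<lambda>i. inner (mixes N P u k i) b))"
    by (rule dispersion_inner)
  also have "\<dots> \<le> (\<Sum>b\<in>Basis. dispersion N (\<lambda>i. inner (u i) b))"
    by (intro sum_mono) (simp add: mixes_inner le)
  also have "\<dots> = dispersion N u" by (rule dispersion_inner[symmetric])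
  finally show ?thesis .
qed

lemma sdev_mixes_le:
  fixes u :: "nat \<Rightarrow> 'a::euclidean_space"
  assumes "\<And>k. doubly_stochastic N (P k)" "N \<ge> 1"
  shows "sdev N (mixes N P u k) \<le> sdev N u"
  using dispersion_mixes_le[OF assms] by (simp add: sdev_eq)

lemma contraction_factor_bounds:
  assumes net: "network_assumption N P B \<theta>" and N: "N \<ge> 1"
  shows "0 < 1 - \<theta> / (4 * (real N)\<^sup>2)" "1 - \<theta> / (4 * (real N)\<^sup>2) < 1"
proof -
  have \<theta>: "0 < \<theta>" "\<theta> < 1" using net by (auto simp: network_assumption_def)
  have "1 \<le> real N" using N by simp
  then have "1 \<le> (real N)\<^sup>2" by (rule one_le_power)
  then have "0 < 4 * (real N)\<^sup>2" "\<theta> < 4 * (real N)\<^sup>2" using \<theta> by linarith+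
  then have "0 < \<theta> / (4 * (real N)\<^sup>2)" "\<theta> / (4 * (real N)\<^sup>2) < 1"
    using \<theta>(1) by (simp_all only: divide_pos_pos divide_less_eq_1_pos)
  then show "0 < 1 - \<theta> / (4 * (real N)\<^sup>2)" "1 - \<theta> / (4 * (real N)\<^sup>2) < 1" by simp_all
qed

text \<open>With \<open>a = \<theta> / (4 * (real N)\<^sup>2)\<close> the variance factor
  \<open>1 - 2 * a\<close> is at most the square of \<open>1 - a\<close>. The square root explains
  why 2 becomes 4 in the base of \<open>omega_const\<close> and \<open>gamma_const\<close>.\<close>

lemma sdev_mixes_blocks:
  fixes u :: "nat \<Rightarrow> 'a::euclidean_space"
  assumes net: "network_assumption N P B \<theta>" and N: "N \<ge> 1"
  shows "sdev N (mixes N (\<lambda>k. P (c * B + 1 + k)) u (q * B)) \<le> (1 - \<theta> / (4 * (real N)\<^sup>2)) ^ q * sdev N u"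
proof (induction q)
  case 0
  then show ?case by simp
next
  case (Suc q)
  define \<rho> where "\<rho> = 1 - \<theta> / (4 * (real N)\<^sup>2)"
  define v where "v = mixes N (\<lambda>k. P (c * B + 1 + k)) u (q * B)"
  have \<rho>: "0 < \<rho>" using contraction_factor_bounds[OF net N] by (simp add: \<rho>_def)
  have "mixes N (\<lambda>k. P (c * B + 1 + k)) u (Suc q * B) = mixes N (\<lambda>k. P ((c + q) * B + 1 + k)) v B"
    using mixes_add[of N "\<lambda>k. P (c * B + 1 + k)" u "q * B" B] by (simp add: v_def algebra_simps)
  then have "dispersion N (mixes N (\<lambda>k. P (c * B + 1 + k)) u (Suc q * B)) \<le> (1 - \<theta> / (2 * (real N)\<^sup>2)) * dispersion N v"
    using dispersion_mixes_block[OF net N, of "c + q" v] by simp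
  also have "1 - \<theta> / (2 * (real N)\<^sup>2) = \<rho>\<^sup>2 - (\<theta> / (4 * (real N)\<^sup>2))\<^sup>2"
    by (simp add: \<rho>_def power2_diff)
  also have "\<dots> * dispersion N v \<le> \<rho>\<^sup>2 * dispersion N v"
    by (intro mult_right_mono dispersion_nonneg) simp
  finally have "sdev N (mixes N (\<lambda>k. P (c * B + 1 + k)) u (Suc q * B)) \<le> sqrt (\<rho>\<^sup>2 * dispersion N v)"
    by (simp only: sdev_eq real_sqrt_le_iff)
  also have "\<dots> = \<rho> * sdev N v" using \<rho> by (simp add: real_sqrt_mult sdev_eq)
  also have "\<dots> \<le> \<rho> * (\<rho> ^ q * sdev N u)"
    using Suc.IH \<rho> by (intro mult_left_mono) (simp_all only: v_def \<rho>_def)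
  finally show ?case by (simp add: \<rho>_def mult.assoc)
qed

lemma gamma_const_bounds:
  assumes net: "network_assumption N P B \<theta>" and N: "N \<ge> 1"
  shows "0 < gamma_const N B \<theta>" "gamma_const N B \<theta> < 1"
proof -
  have B: "B \<ge> 1" using net by (simp add: network_assumption_def)
  note \<rho> = contraction_factor_bounds[OF net N]
  show "0 < gamma_const N B \<theta>" unfolding gamma_const_def powr_gt_zero using \<rho> by linarith
  have "gamma_const N B \<theta> < 1 powr (1 / real B)"
    unfolding gamma_const_def using \<rho> B by (intro powr_less_mono2) auto
  then show "gamma_const N B \<theta> < 1" by simp
qed

lemma omega_const_ge_1:
  assumes net: "network_assumption N P B \<theta>" and N: "N \<ge> 1"
  shows "1 \<le> omega_const N \<theta>"
proof -
  define \<rho> where "\<rho> = 1 - \<theta> / (4 * (real N)\<^sup>2)"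
  have "0 < \<rho>" "\<rho> < 1" using contraction_factor_bounds[OF net N] by (simp_all add: \<rho>_def)
  then have "0 < \<rho>\<^sup>2" "\<rho>\<^sup>2 \<le> 1" by (auto intro: power_le_one)
  then have "1 \<le> 1 / \<rho>\<^sup>2" by simp
  then show ?thesis by (simp only: omega_const_def \<rho>_def)
qed

text \<open>The windows of the network assumption start at 1 modulo \<open>B\<close>, whereas the
  averaging starts at an arbitrary time \<open>s\<close>. At most \<open>B\<close> steps are lost
  before the first full window and fewer than \<open>B\<close> after the last one, so the number of
  full windows is at least \<open>K / B - 2\<close>. The two lost windows are the factor
  \<open>omega_const\<close>.\<close>

lemma sdev_mixes_decay:
  fixes u :: "nat \<Rightarrow> 'a::euclidean_space"
  assumes net: "network_assumption N P B \<theta>" and N: "N \<ge> 1"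
  shows "sdev N (mixes N (\<lambda>k. P (s + k)) u K) \<le> omega_const N \<theta> * gamma_const N B \<theta> ^ K * sdev N u"
proof -
  define \<rho> where "\<rho> = 1 - \<theta> / (4 * (real N)\<^sup>2)"
  have \<rho>: "0 < \<rho>" "\<rho> < 1" using contraction_factor_bounds[OF net N] by (simp_all add: \<rho>_def)
  have B: "B \<ge> 1" and ds: "\<And>t. doubly_stochastic N (P t)" using net by (auto simp: network_assumption_def)
  have const: "omega_const N \<theta> * gamma_const N B \<theta> ^ K = \<rho> powr (real K / real B - 2)"
  proof -
    have "gamma_const N B \<theta> ^ K = \<rho> powr (real K / real B)"
      using \<rho> by (simp add: gamma_const_def powr_power flip: \<rho>_def)
    moreover have "omega_const N \<theta> = \<rho> powr (- 2)"
      using \<rho> by (simp add: omega_const_def powr_minus_divide flip: \<rho>_def)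
    ultimately show ?thesis by (simp add: powr_add[symmetric])
  qed
  \<comment> \<open>\<open>c * B + 1\<close> is the first window start not before \<open>s\<close>;
    for \<open>s = 0\<close> this is time 1.\<close>
  obtain c where c: "s \<le> c * B + 1" "c * B + 1 \<le> s + B"
  proof (cases "s = 0")
    case True
    then show thesis using that[of 0] B by simp
  next
    case False
    define c where "c = (s - 1 + (B - 1)) div B"
    have "c * B \<le> s - 1 + (B - 1)" by (simp add: c_def)
    moreover have "s - 1 + (B - 1) < c * B + B"
      using B dividend_less_div_times[of B "s - 1 + (B - 1)"] by (simp only: c_def add.commute)
    ultimately show thesis using that[of c] False B by simp
  qed
  define j where "j = c * B + 1 - s"
  have main: "sdev N (mixes N (\<lambda>k. P (s + k)) u K) \<le> \<rho> powr (real K / real B - 2) * sdev N u"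
  proof (cases "K < j")
    \<comment> \<open>The run ends before the first window starts. Then the exponent is negative,
      the power is at least 1, and monotonicity of the dispersion is enough.\<close>
    case True
    then have "real K / real B \<le> 1" using c B by (simp add: j_def)
    then have "1 \<le> \<rho> powr (real K / real B - 2)"
      using \<rho> powr_mono'[of "real K / real B - 2" 0 \<rho>] by simp
    then have "sdev N u \<le> \<rho> powr (real K / real B - 2) * sdev N u"
      using sdev_nonneg[of N u] by (simp add: mult_le_cancel_right1)
    moreover have "sdev N (mixes N (\<lambda>k. P (s + k)) u K) \<le> sdev N u"
      by (intro sdev_mixes_le ds N)
    ultimately show ?thesis by linarith
  next
    case False
    define q where "q = (K - j) div B"
    define r where "r = (K - j) mod B"
    have K: "K = j + (q * B + r)" and r: "r < B" using False B by (auto simp: q_def r_def)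
    define v where "v = mixes N (\<lambda>k. P (s + k)) u j"
    define w where "w = mixes N (\<lambda>k. P (c * B + 1 + k)) v (q * B)"
    have "mixes N (\<lambda>k. P (s + k)) u K = mixes N (\<lambda>k. P (s + (j + k))) v (q * B + r)"
      unfolding K mixes_add v_def ..
    also have "(\<lambda>k. P (s + (j + k))) = (\<lambda>k. P (c * B + 1 + k))"
      using c(1) by (simp add: j_def)
    also have "mixes N \<dots> v (q * B + r) = mixes N (\<lambda>k. P (c * B + 1 + (q * B + k))) w r"
      unfolding mixes_add w_def ..
    finally have "sdev N (mixes N (\<lambda>k. P (s + k)) u K) \<le> sdev N w"
      using sdev_mixes_le[of N "\<lambda>k. P (c * B + 1 + (q * B + k))", OF ds N] by simp
    also have "\<dots> \<le> \<rho> ^ q * sdev N v"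
      unfolding w_def \<rho>_def by (rule sdev_mixes_blocks[OF net N])
    also have "\<dots> \<le> \<rho> ^ q * sdev N u"
      using \<rho> by (intro mult_left_mono) (auto simp: v_def intro: sdev_mixes_le ds N)
    also have "\<rho> ^ q = \<rho> powr real q" using \<rho> by (simp add: powr_realpow)
    also have "\<rho> powr real q \<le> \<rho> powr (real K / real B - 2)"
    proof (rule powr_mono')
      have "K \<le> (q + 2) * B" using K r c(2) by (simp add: j_def algebra_simps)
      then have "real K \<le> real ((q + 2) * B)" by (rule of_nat_mono)
      then have "real K \<le> (real q + 2) * real B" by (simp add: algebra_simps)
      then have "real K / real B \<le> real q + 2" using B by (simp add: pos_divide_le_eq)
      then show "real K / real B - 2 \<le> real q" by simp
    qed (use \<rho> in auto)
    finally show ?thesis using sdev_nonneg[of N u] by (simp add: mult_right_mono)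
  qed
  then show ?thesis by (simp only: const)
qed

text \<open>The error of time \<open>s\<close> enters after the averaging with \<open>P s\<close>,
  so by time \<open>t\<close> it has been averaged only \<open>t - 1 - s\<close> times.\<close>

lemma sdev_perturbed:
  fixes x e :: "nat \<Rightarrow> nat \<Rightarrow> 'a::euclidean_space"
  assumes net: "network_assumption N P B \<theta>" and N: "N \<ge> 1"
    and step: "\<And>t. x (Suc t) = (\<lambda>i. mix N (P t) (x t) i + e t i)"
  defines "\<omega> \<equiv> omega_const N \<theta>" and "\<gamma> \<equiv> gamma_const N B \<theta>"
  shows "sdev N (x t) \<le> \<omega> * \<gamma> ^ t * sdev N (x 0) + (\<Sum>s<t. \<omega> * \<gamma> ^ (t - 1 - s) * sdev N (e s))"
proof -
  \<comment> \<open>Stated with \<open>K\<close> further averaging steps, because the induction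
    moves one averaging step from the state into this tail.\<close>
  have "sdev N (mixes N (\<lambda>k. P (t + k)) (x t) K)
      \<le> \<omega> * \<gamma> ^ (t + K) * sdev N (x 0) + (\<Sum>s<t. \<omega> * \<gamma> ^ (t - 1 - s + K) * sdev N (e s))" for K
  proof (induction t arbitrary: K)
    case 0
    show ?case using sdev_mixes_decay[OF net N, of 0 "x 0" K] by (simp add: \<omega>_def \<gamma>_def)
  next
    case (Suc t)
    have "mixes N (\<lambda>k. P (Suc t + k)) (x (Suc t)) K
        = (\<lambda>i. mixes N (\<lambda>k. P (t + k)) (x t) (Suc K) i + mixes N (\<lambda>k. P (Suc t + k)) (e t) K i)"
      unfolding step mixes_plus mixes_Suc_left by simp
    then have "sdev N (mixes N (\<lambda>k. P (Suc t + k)) (x (Suc t)) K)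
        \<le> sdev N (mixes N (\<lambda>k. P (t + k)) (x t) (Suc K)) + sdev N (mixes N (\<lambda>k. P (Suc t + k)) (e t) K)"
      by (simp only: sdev_add)
    also have "sdev N (mixes N (\<lambda>k. P (Suc t + k)) (e t) K) \<le> \<omega> * \<gamma> ^ K * sdev N (e t)"
      unfolding \<omega>_def \<gamma>_def by (rule sdev_mixes_decay[OF net N])
    also note Suc.IH[of "Suc K"]
    also have "(\<Sum>s<t. \<omega> * \<gamma> ^ (t - 1 - s + Suc K) * sdev N (e s)) = (\<Sum>s<t. \<omega> * \<gamma> ^ (Suc t - 1 - s + K) * sdev N (e s))"
    proof (rule sum.cong[OF refl])
      fix s assume "s \<in> {..<t}"
      then have "t - 1 - s + Suc K = Suc t - 1 - s + K" by auto
      then show "\<omega> * \<gamma> ^ (t - 1 - s + Suc K) * sdev N (e s) = \<omega> * \<gamma> ^ (Suc t - 1 - s + K) * sdev N (e s)" by metis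
    qed
    finally show ?case by simp
  qed
  from this[of 0] show ?thesis by simp
qed

text \<open>The inner sum satisfies \<open>b (Suc t) = \<gamma> * b t + a (Suc t)\<close>; summing
  this recursion avoids exchanging the two sums. The term \<open>- \<gamma> * b T\<close> is carried
  along to make the induction close.\<close>

lemma sum_convolution_geometric_le:
  fixes a :: "nat \<Rightarrow> real"
  assumes \<gamma>: "0 \<le> \<gamma>" "\<gamma> < 1" and a: "\<And>s. 0 \<le> a s"
  shows "(\<Sum>t<T. \<Sum>s<Suc t. \<gamma> ^ (t - s) * a s) \<le> (\<Sum>s<T. a s) / (1 - \<gamma>)"
proof -
  define b where "b t = (\<Sum>s<Suc t. \<gamma> ^ (t - s) * a s)" for t
  have b_Suc: "b (Suc t) = \<gamma> * b t + a (Suc t)" for t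
  proof -
    have "(\<Sum>s<Suc t. \<gamma> ^ (Suc t - s) * a s) = \<gamma> * b t"
      unfolding b_def sum_distrib_left by (intro sum.cong) (auto simp: Suc_diff_le)
    then show ?thesis by (simp add: b_def)
  qed
  have b_nonneg: "0 \<le> b t" for t unfolding b_def using \<gamma> a by (intro sum_nonneg) auto
  have "(1 - \<gamma>) * (\<Sum>t<Suc T. b t) \<le> (\<Sum>s<Suc T. a s) - \<gamma> * b T" for T
  proof (induction T)
    case 0
    show ?case by (simp add: b_def algebra_simps)
  next
    case (Suc T)
    then show ?case by (simp add: b_Suc algebra_simps)
  qed
  then have "(1 - \<gamma>) * (\<Sum>t<Suc T. b t) \<le> (\<Sum>s<Suc T. a s)" for T
    using b_nonneg \<gamma> by (smt (verit) mult_nonneg_nonneg)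
  then have "(\<Sum>t<Suc T. b t) \<le> (\<Sum>s<Suc T. a s) / (1 - \<gamma>)" for T
    using \<gamma> by (simp add: pos_le_divide_eq mult.commute)
  then have "(\<Sum>t<T. b t) \<le> (\<Sum>s<T. a s) / (1 - \<gamma>)" by (cases T) auto
  then show ?thesis by (simp only: b_def)
qed

section \<open>Expected regret of the iteration\<close>

text \<open>Summation by parts with increasing weights, the reciprocals of the stepsizes: every
  weight increment multiplies a value of \<open>S\<close> that is at most \<open>c\<close>, and the
  increments add up to \<open>sqrt (real T)\<close>. The boundary term
  \<open>- sqrt (real T) * S T\<close> is kept for the induction and then dropped.\<close>

lemma sum_sqrt_weighted_telescope_le:
  fixes S :: "nat \<Rightarrow> real"
  assumes "\<And>t. S t \<le> c" "\<And>t. 0 \<le> S t"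
  shows "(\<Sum>t<T. sqrt (real t + 1) * (S t - S (Suc t))) \<le> sqrt (real T) * c"
proof -
  have "(\<Sum>t<T. sqrt (real t + 1) * (S t - S (Suc t))) \<le> sqrt (real T) * c - sqrt (real T) * S T"
  proof (induction T)
    case 0
    show ?case by simp
  next
    case (Suc T)
    have "(sqrt (real T + 1) - sqrt (real T)) * S T \<le> (sqrt (real T + 1) - sqrt (real T)) * c"
      using assms(1) by (intro mult_left_mono) auto
    then show ?case using Suc.IH by (simp add: algebra_simps)
  qed
  moreover have "0 \<le> sqrt (real T) * S T" using assms(2) by simp
  ultimately show ?thesis by linarith
qed

section \<open>Moments from conditional bounds\<close>

lemma (in prob_space)
  assumes sub: "subalgebra M G" and Z: "Z \<in> borel_measurable M"
    and c: "0 \<le> c" and le: "cond_second_moment_le M G Z c"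
  shows integrable_second_moment: "integrable M (\<lambda>\<omega>. (norm (Z \<omega>))\<^sup>2)"
    and second_moment_le: "(\<integral>\<omega>. (norm (Z \<omega>))\<^sup>2 \<partial>M) \<le> c"
    and integrable_first_moment: "integrable M (\<lambda>\<omega>. norm (Z \<omega>))"
    and first_moment_le: "(\<integral>\<omega>. norm (Z \<omega>) \<partial>M) \<le> sqrt c"
proof -
  note [measurable] = Z
  interpret finite_measure_subalgebra M G by unfold_locales (rule sub)
  have "(\<integral>\<^sup>+\<omega>. ennreal ((norm (Z \<omega>))\<^sup>2) \<partial>M) = (\<integral>\<^sup>+\<omega>. nn_cond_exp M G (\<lambda>\<omega>. ennreal ((norm (Z \<omega>))\<^sup>2)) \<omega> \<partial>M)"
    using nn_cond_exp_intg[of "\<lambda>_. 1" "\<lambda>\<omega>. ennreal ((norm (Z \<omega>))\<^sup>2)"] by simp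
  also have "\<dots> \<le> (\<integral>\<^sup>+\<omega>. ennreal c \<partial>M)"
    using le unfolding cond_second_moment_le_def by (rule nn_integral_mono_AE)
  also have "\<dots> = ennreal c" by (simp add: emeasure_space_1)
  finally have nn: "(\<integral>\<^sup>+\<omega>. ennreal ((norm (Z \<omega>))\<^sup>2) \<partial>M) \<le> ennreal c" .
  show i2: "integrable M (\<lambda>\<omega>. (norm (Z \<omega>))\<^sup>2)"
    by (rule integrableI_bounded) (use nn in \<open>auto simp: less_top[symmetric] top_unique\<close>)
  then have "ennreal (\<integral>\<omega>. (norm (Z \<omega>))\<^sup>2 \<partial>M) = (\<integral>\<^sup>+\<omega>. ennreal ((norm (Z \<omega>))\<^sup>2) \<partial>M)"
    by (intro nn_integral_eq_integral[symmetric]) auto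
  with nn have "ennreal (\<integral>\<omega>. (norm (Z \<omega>))\<^sup>2 \<partial>M) \<le> ennreal c" by simp
  then show le2: "(\<integral>\<omega>. (norm (Z \<omega>))\<^sup>2 \<partial>M) \<le> c" using ennreal_le_iff[OF c] by blast
  show i1: "integrable M (\<lambda>\<omega>. norm (Z \<omega>))"
    by (rule square_integrable_imp_integrable) (use i2 in auto)
  \<comment> \<open>Jensen's inequality for the square, read off from the nonnegativity of the
    variance.\<close>
  have "(\<integral>\<omega>. norm (Z \<omega>) \<partial>M)\<^sup>2 \<le> (\<integral>\<omega>. (norm (Z \<omega>))\<^sup>2 \<partial>M)"
    using variance_positive[of "\<lambda>\<omega>. norm (Z \<omega>)"] variance_eq[OF i1 i2] by simp
  then show "(\<integral>\<omega>. norm (Z \<omega>) \<partial>M) \<le> sqrt c" using le2 by (intro real_le_rsqrt) linarith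
qed

lemma vec_cond_exp_inner:
  "b \<in> Basis \<Longrightarrow> inner (vec_cond_exp M G Z \<omega>) b = real_cond_exp M G (\<lambda>\<omega>. inner (Z \<omega>) b) \<omega>"
  unfolding vec_cond_exp_def by (rule inner_sum_left_Basis)

lemma (in prob_space) integrable_mult_square_integrable:
  fixes u v :: "'a \<Rightarrow> real"
  assumes [measurable]: "u \<in> borel_measurable M" "v \<in> borel_measurable M"
    and "integrable M (\<lambda>\<omega>. (u \<omega>)\<^sup>2)" "integrable M (\<lambda>\<omega>. (v \<omega>)\<^sup>2)"
  shows "integrable M (\<lambda>\<omega>. u \<omega> * v \<omega>)"
proof (rule Bochner_Integration.integrable_bound)
  show "integrable M (\<lambda>\<omega>. (u \<omega>)\<^sup>2 + (v \<omega>)\<^sup>2)" using assms by simp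
  have "\<bar>a * b\<bar> \<le> a\<^sup>2 + b\<^sup>2" for a b :: real
  proof -
    have "0 \<le> (\<bar>a\<bar> - \<bar>b\<bar>)\<^sup>2" "0 \<le> a\<^sup>2" "0 \<le> b\<^sup>2" by simp_all
    moreover have "(\<bar>a\<bar> - \<bar>b\<bar>)\<^sup>2 = a\<^sup>2 + b\<^sup>2 - 2 * \<bar>a * b\<bar>" by (simp add: power2_diff abs_mult)
    ultimately show ?thesis by linarith
  qed
  then show "AE \<omega> in M. norm (u \<omega> * v \<omega>) \<le> norm ((u \<omega>)\<^sup>2 + (v \<omega>)\<^sup>2)" by simp
qed auto

section \<open>A run of the algorithm: measurability, moments and Lipschitz bounds\<close>

locale dscmd_run = prob_space M for M :: "'w measure" +
  fixes N B :: nat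
    and X :: "'a::euclidean_space set"
    and f chi :: "nat \<Rightarrow> 'a \<Rightarrow> real"
    and \<Phi> :: "'a \<Rightarrow> real"
    and \<sigma> L \<theta> Gf \<nu> :: real
    and P :: "nat \<Rightarrow> nat \<Rightarrow> nat \<Rightarrow> real"
    and \<alpha> r :: "nat \<Rightarrow> real"
    and \<F> :: "nat \<Rightarrow> 'w measure"
    and x0 :: "nat \<Rightarrow> 'a"
    and x y :: "nat \<Rightarrow> nat \<Rightarrow> 'w \<Rightarrow> 'a"
    and \<xi> :: "nat \<Rightarrow> nat \<Rightarrow> nat \<Rightarrow> 'w \<Rightarrow> 'a"
    and gt :: "nat \<Rightarrow> nat \<Rightarrow> 'a \<Rightarrow> 'w \<Rightarrow> 'a"
    and g :: "nat \<Rightarrow> 'a \<Rightarrow> 'a"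
  assumes N: "N \<ge> 1"
    and X: "X \<noteq> {}" "convex X" "compact X"
    and convex_f: "\<And>i. i \<in> {1..N} \<Longrightarrow> convex_on UNIV (f i)"
    and convex_chi: "\<And>i. i \<in> {1..N} \<Longrightarrow> convex_on UNIV (chi i)"
    and \<Phi>: "cont_differentiable \<Phi>" "\<sigma> > 0" "strongly_convex \<sigma> \<Phi>"
    and mirror: "mirror_map_assumption N \<Phi> L"
    and adapted: "adapted_processes N M \<F> X x y \<xi> gt"
    and iteration: "dscmd_n N M X chi \<Phi> P \<alpha> r x0 x y \<xi> gt"
    and network: "network_assumption N P B \<theta>"
    and subgradients: "stochastic_subgradient_assumption N M \<F> X f y \<xi> gt g Gf"
    and noise: "noise_assumption N M \<F> \<xi> \<nu>"
    and \<alpha>_pos: "\<And>t. 0 < \<alpha> t"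
    and r_nonneg: "\<And>t. 0 \<le> r t"
begin

definition gv :: "nat \<Rightarrow> nat \<Rightarrow> 'w \<Rightarrow> 'a" where
  "gv i t \<omega> = gt i t (y i t \<omega>) \<omega>"

definition noise_level :: "nat \<Rightarrow> nat \<Rightarrow> 'w \<Rightarrow> real" where
  "noise_level i t \<omega> = (\<Sum>j=1..N. P t i j * norm (\<xi> i j t \<omega>))"

abbreviation "Gchi \<equiv> G_chi N X chi"
abbreviation "D \<equiv> bregman_diam \<Phi> X"
abbreviation "\<omega>c \<equiv> omega_const N \<theta>"
abbreviation "\<gamma>c \<equiv> gamma_const N B \<theta>"

lemma ds: "doubly_stochastic N (P t)"
  using network by (simp add: network_assumption_def)

lemma P_nonneg: "i \<in> {1..N} \<Longrightarrow> j \<in> {1..N} \<Longrightarrow> 0 \<le> P t i j"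
  using ds[of t] by (simp add: doubly_stochastic_def)

lemma P_row_sum: "i \<in> {1..N} \<Longrightarrow> (\<Sum>j=1..N. P t i j) = 1"
  using ds[of t] by (simp add: doubly_stochastic_def)

lemma P_le_1: "i \<in> {1..N} \<Longrightarrow> j \<in> {1..N} \<Longrightarrow> P t i j \<le> 1"
  using member_le_sum[of j "{1..N}" "P t i"] P_nonneg P_row_sum by simp

lemma grad_lipschitz: "norm (grad \<Phi> z - grad \<Phi> w) \<le> L * norm (z - w)"
  using mirror by (simp add: mirror_map_assumption_def)

text \<open>The Lipschitz inequality at two distinct points forces the sign, and a Euclidean space
  has two distinct points.\<close>

lemma L_nonneg: "0 \<le> L"
proof -
  obtain b :: 'a where "b \<in> Basis" using nonempty_Basis by blast
  then have "norm b = 1" by simp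
  moreover have "0 \<le> L * norm (b - 0)" by (rule order_trans[OF norm_ge_zero grad_lipschitz])
  ultimately show ?thesis by simp
qed

lemma Gf_nonneg: "0 \<le> Gf" and \<nu>_nonneg: "0 \<le> \<nu>"
  using subgradients noise by (simp_all add: stochastic_subgradient_assumption_def noise_assumption_def)

lemma Gchi_nonneg: "0 \<le> Gchi"
proof -
  obtain z where "z \<in> X" using X by blast
  then show ?thesis using G_chi_nonneg[of chi 1 X z N] convex_chi N X by simp
qed

lemma D_nonneg: "0 \<le> D"
  using X bregman_diam_nonneg[OF \<Phi>(1) X(3)] by blast

lemma x_0: "\<omega> \<in> space M \<Longrightarrow> i \<in> {1..N} \<Longrightarrow> x i 0 \<omega> = x0 i"
  using iteration by (simp add: dscmd_n_def)

lemma x_arg_min: "\<omega> \<in> space M \<Longrightarrow> i \<in> {1..N} \<Longrightarrow>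
  is_arg_min (\<lambda>z. inner (gv i t \<omega>) z + 1 / \<alpha> t * bregman \<Phi> z (y i t \<omega>) + chi i z) (\<lambda>z. z \<in> X) (x i (Suc t) \<omega>)"
  using iteration unfolding dscmd_n_def gv_def by blast

lemma x_in: "\<omega> \<in> space M \<Longrightarrow> i \<in> {1..N} \<Longrightarrow> x i t \<omega> \<in> X"
proof (cases t)
  case 0
  then show "\<omega> \<in> space M \<Longrightarrow> i \<in> {1..N} \<Longrightarrow> x i t \<omega> \<in> X"
    using iteration by (simp add: dscmd_n_def)
next
  case (Suc s)
  then show "\<omega> \<in> space M \<Longrightarrow> i \<in> {1..N} \<Longrightarrow> x i t \<omega> \<in> X"
    using x_arg_min[of \<omega> i s] by (simp add: is_arg_min_def)
qed

lemma y_eq: "\<omega> \<in> space M \<Longrightarrow> i \<in> {1..N} \<Longrightarrow>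
  y i t \<omega> = (\<Sum>j=1..N. P t i j *\<^sub>R (x j t \<omega> + r t *\<^sub>R \<xi> i j t \<omega>))"
  using iteration by (simp add: dscmd_n_def)

lemma subalgebra_\<F>: "subalgebra M (\<F> t)"
  using adapted by (simp add: adapted_processes_def)

lemma subalgebra_past: "subalgebra M (past M \<F> t)"
proof (cases t)
  case 0
  then show ?thesis by (auto simp: past_def subalgebra_def sigma_sets_empty_eq)
next
  case (Suc s)
  then show ?thesis using subalgebra_\<F> by (simp add: past_def)
qed

lemma measurable_x [measurable]: "i \<in> {1..N} \<Longrightarrow> x i t \<in> borel_measurable M"
  by (rule measurable_from_subalg[OF subalgebra_past[of t]]) (use adapted in \<open>auto simp: adapted_processes_def\<close>)

lemma measurable_y [measurable]: "i \<in> {1..N} \<Longrightarrow> y i t \<in> borel_measurable M"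
  by (rule measurable_from_subalg[OF subalgebra_\<F>[of t]]) (use adapted in \<open>auto simp: adapted_processes_def\<close>)

lemma measurable_\<xi> [measurable]: "i \<in> {1..N} \<Longrightarrow> j \<in> {1..N} \<Longrightarrow> \<xi> i j t \<in> borel_measurable M"
  by (rule measurable_from_subalg[OF subalgebra_\<F>[of t]]) (use adapted in \<open>auto simp: adapted_processes_def\<close>)

lemma measurable_gv [measurable]: "i \<in> {1..N} \<Longrightarrow> gv i t \<in> borel_measurable M"
  by (rule measurable_from_subalg[OF subalgebra_\<F>[of t]]) (use adapted in \<open>auto simp: adapted_processes_def gv_def[abs_def]\<close>)

lemma space_pn: "space (past_and_noise N M \<F> \<xi> t) = space M"
  by (simp add: past_and_noise_def space_measure_of_conv)

lemma sets_pn: "sets (past_and_noise N M \<F> \<xi> t) = sigma_sets (space M) (sets (past M \<F> t) \<union>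
      {\<xi> i j t -` A \<inter> space M | i j A. i \<in> {1..N} \<and> j \<in> {1..N} \<and> A \<in> sets borel})"
  unfolding past_and_noise_def
  by (rule sets_measure_of) (use subalgebra_past[of t] sets.sets_into_space in \<open>fastforce simp: subalgebra_def\<close>)

lemma subalgebra_pn: "subalgebra M (past_and_noise N M \<F> \<xi> t)"
  unfolding subalgebra_def space_pn sets_pn
proof (intro conjI refl sets.sigma_sets_subset)
  show "sets (past M \<F> t) \<union> {\<xi> i j t -` A \<inter> space M | i j A. i \<in> {1..N} \<and> j \<in> {1..N} \<and> A \<in> sets borel} \<subseteq> sets M"
    using subalgebra_past[of t] by (auto simp: subalgebra_def intro!: measurable_sets[OF measurable_\<xi>])
qed

lemma measurable_\<xi>_pn: "i \<in> {1..N} \<Longrightarrow> j \<in> {1..N} \<Longrightarrow> \<xi> i j t \<in> borel_measurable (past_and_noise N M \<F> \<xi> t)"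
  by (rule measurableI) (auto simp: space_pn sets_pn intro!: sigma_sets.Basic)

lemma measurable_x_pn: "i \<in> {1..N} \<Longrightarrow> x i t \<in> borel_measurable (past_and_noise N M \<F> \<xi> t)"
proof -
  assume i: "i \<in> {1..N}"
  have "subalgebra (past_and_noise N M \<F> \<xi> t) (past M \<F> t)"
    using subalgebra_past[of t] unfolding subalgebra_def space_pn sets_pn by (auto intro: sigma_sets.Basic)
  then show ?thesis
    using adapted i by (auto simp: adapted_processes_def intro: measurable_from_subalg)
qed

text \<open>The query point is a function of the current states, which belong to the past, and of
  the current noises. This is what lets it be pulled out of the conditional expectation of the
  stochastic subgradient.\<close>

lemma measurable_y_pn: "i \<in> {1..N} \<Longrightarrow> y i t \<in> borel_measurable (past_and_noise N M \<F> \<xi> t)"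
proof -
  assume i: "i \<in> {1..N}"
  have "(\<lambda>\<omega>. \<Sum>j=1..N. P t i j *\<^sub>R (x j t \<omega> + r t *\<^sub>R \<xi> i j t \<omega>)) \<in> borel_measurable (past_and_noise N M \<F> \<xi> t)"
    using i measurable_x_pn measurable_\<xi>_pn
    by (intro borel_measurable_sum borel_measurable_scaleR borel_measurable_add borel_measurable_const) auto
  then show ?thesis
    by (subst measurable_cong[OF y_eq]) (use i in \<open>auto simp: space_pn\<close>)
qed

lemma
  assumes i: "i \<in> {1..N}"
  shows integrable_gv_sq: "integrable M (\<lambda>\<omega>. (norm (gv i t \<omega>))\<^sup>2)"
    and gv_sq_le: "(\<integral>\<omega>. (norm (gv i t \<omega>))\<^sup>2 \<partial>M) \<le> Gf\<^sup>2"
    and integrable_gv: "integrable M (\<lambda>\<omega>. norm (gv i t \<omega>))"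
    and gv_le: "(\<integral>\<omega>. norm (gv i t \<omega>) \<partial>M) \<le> Gf"
proof -
  have "cond_second_moment_le M (past_and_noise N M \<F> \<xi> t) (gv i t) (Gf\<^sup>2)"
    using subgradients i by (auto simp: stochastic_subgradient_assumption_def gv_def[abs_def])
  note * = subalgebra_pn measurable_gv[OF i] zero_le_power2 this
  show "integrable M (\<lambda>\<omega>. (norm (gv i t \<omega>))\<^sup>2)" "(\<integral>\<omega>. (norm (gv i t \<omega>))\<^sup>2 \<partial>M) \<le> Gf\<^sup>2"
    "integrable M (\<lambda>\<omega>. norm (gv i t \<omega>))" "(\<integral>\<omega>. norm (gv i t \<omega>) \<partial>M) \<le> Gf"
    using integrable_second_moment[OF *] second_moment_le[OF *] integrable_first_moment[OF *]
      first_moment_le[OF *] Gf_nonneg by auto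
qed

lemma
  assumes i: "i \<in> {1..N}" and j: "j \<in> {1..N}"
  shows integrable_\<xi>_sq: "integrable M (\<lambda>\<omega>. (norm (\<xi> i j t \<omega>))\<^sup>2)"
    and \<xi>_sq_le: "(\<integral>\<omega>. (norm (\<xi> i j t \<omega>))\<^sup>2 \<partial>M) \<le> \<nu>"
    and integrable_\<xi>: "integrable M (\<lambda>\<omega>. norm (\<xi> i j t \<omega>))"
    and \<xi>_le: "(\<integral>\<omega>. norm (\<xi> i j t \<omega>) \<partial>M) \<le> sqrt \<nu>"
proof -
  have "cond_second_moment_le M (past M \<F> t) (\<xi> i j t) \<nu>"
    using noise i j by (auto simp: noise_assumption_def)
  note * = subalgebra_past measurable_\<xi>[OF i j] \<nu>_nonneg this
  show "integrable M (\<lambda>\<omega>. (norm (\<xi> i j t \<omega>))\<^sup>2)" "(\<integral>\<omega>. (norm (\<xi> i j t \<omega>))\<^sup>2 \<partial>M) \<le> \<nu>"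
    "integrable M (\<lambda>\<omega>. norm (\<xi> i j t \<omega>))" "(\<integral>\<omega>. norm (\<xi> i j t \<omega>) \<partial>M) \<le> sqrt \<nu>"
    using integrable_second_moment[OF *] second_moment_le[OF *] integrable_first_moment[OF *]
      first_moment_le[OF *] by auto
qed

text \<open>The oracle assumption bounds the random answers rather than \<open>g\<close> itself. At
  a fixed point of \<open>X\<close> the vector \<open>g i z\<close> is the expectation of such an
  answer, so its norm is at most the expected norm. One time is enough for this, and time 0 is
  taken.\<close>

lemma norm_g_le:
  assumes i: "i \<in> {1..N}" and z: "z \<in> X"
  shows "norm (g i z) \<le> Gf"
proof -
  define Z where "Z = gt i 0 z"
  have Zm [measurable]: "Z \<in> borel_measurable M"
    by (rule measurable_from_subalg[OF subalgebra_\<F>[of 0]])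
      (use adapted i z in \<open>simp add: adapted_processes_def Z_def\<close>)
  have mean: "AE \<omega> in M. vec_cond_exp M (past M \<F> 0) Z \<omega> = g i z"
    and mom: "cond_second_moment_le M (past M \<F> 0) Z (Gf\<^sup>2)"
    using subgradients i z by (auto simp: stochastic_subgradient_assumption_def Z_def)
  interpret finite_measure_subalgebra M "past M \<F> 0" by unfold_locales (rule subalgebra_past)
  note mom' = subalgebra_past Zm zero_le_power2 mom
  have Zint: "integrable M Z"
    using integrable_first_moment[OF mom'] by (simp add: integrable_norm_iff)
  have comp: "inner (g i z) b = (\<integral>\<omega>. inner (Z \<omega>) b \<partial>M)" if b: "b \<in> Basis" for b
  proof -
    have ib: "integrable M (\<lambda>\<omega>. inner (Z \<omega>) b)" using Zint by simp
    have "(\<integral>\<omega>. inner (Z \<omega>) b \<partial>M) = (\<integral>\<omega>. real_cond_exp M (past M \<F> 0) (\<lambda>\<omega>. inner (Z \<omega>) b) \<omega> \<partial>M)"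
      using real_cond_exp_int(2)[OF ib] by simp
    also have "\<dots> = (\<integral>\<omega>. inner (g i z) b \<partial>M)"
    proof (rule integral_cong_AE)
      show "AE \<omega> in M. real_cond_exp M (past M \<F> 0) (\<lambda>\<omega>. inner (Z \<omega>) b) \<omega> = inner (g i z) b"
        using mean by eventually_elim (use b in \<open>simp flip: vec_cond_exp_inner\<close>)
    qed auto
    also have "\<dots> = inner (g i z) b" by (simp add: prob_space)
    finally show ?thesis by simp
  qed
  have "g i z = (\<integral>\<omega>. Z \<omega> \<partial>M)"
    by (rule euclidean_eqI) (simp add: comp Zint)
  then have "norm (g i z) \<le> (\<integral>\<omega>. norm (Z \<omega>) \<partial>M)" by simp
  also have "\<dots> \<le> Gf" using first_moment_le[OF mom'] Gf_nonneg by simp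
  finally show ?thesis .
qed

text \<open>The subgradient is taken at \<open>z\<close>, so only \<open>z\<close> has to lie in
  \<open>X\<close>; the other point may be a query point outside \<open>X\<close>.\<close>

lemma f_lipschitz:
  assumes i: "i \<in> {1..N}" and z: "z \<in> X"
  shows "f i z - f i w \<le> Gf * norm (z - w)"
proof -
  have "g i z \<in> subdiff (f i) z" using subgradients i z by (simp add: stochastic_subgradient_assumption_def)
  then have "f i z - f i w \<le> norm (g i z) * norm (z - w)"
    using subdiffD norm_cauchy_schwarz order_trans by blast
  also have "\<dots> \<le> Gf * norm (z - w)" using norm_g_le[OF i z] by (intro mult_right_mono) auto
  finally show ?thesis .
qed

lemma chi_lipschitz:
  "i \<in> {1..N} \<Longrightarrow> z \<in> X \<Longrightarrow> chi i z - chi i w \<le> Gchi * norm (z - w)"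
  by (rule G_chi_lipschitz[OF convex_chi X(3)])

lemma integrable_continuous_in_X:
  assumes z [measurable]: "z \<in> borel_measurable M" and zX: "\<And>\<omega>. \<omega> \<in> space M \<Longrightarrow> z \<omega> \<in> X"
    and h: "continuous_on UNIV (h :: 'a \<Rightarrow> real)"
  shows "integrable M (\<lambda>\<omega>. h (z \<omega>))"
proof -
  have "bounded (h ` X)"
    using compact_imp_bounded[OF compact_continuous_image[OF continuous_on_subset[OF h] X(3)]] by simp
  then obtain b where b: "\<And>z. z \<in> X \<Longrightarrow> \<bar>h z\<bar> \<le> b" by (auto simp: bounded_iff)
  have [measurable]: "h \<in> borel_measurable borel" using h by (rule borel_measurable_continuous_onI)
  show ?thesis using b zX by (intro integrable_const_bound[of _ b]) auto
qed

lemma integrable_continuous_x: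
  assumes "i \<in> {1..N}" "continuous_on UNIV (h :: 'a \<Rightarrow> real)"
  shows "integrable M (\<lambda>\<omega>. h (x i t \<omega>))"
  using assms by (intro integrable_continuous_in_X measurable_x x_in)

lemma integrable_norm_x: "i \<in> {1..N} \<Longrightarrow> integrable M (\<lambda>\<omega>. norm (x i t \<omega>))"
  by (rule integrable_continuous_x) (auto intro: continuous_intros)

text \<open>Query points are unbounded, and the stochastic subgradients have only two moments.
  Square integrability here makes the products of the two integrable.\<close>

lemma integrable_norm_y_sq:
  assumes i: "i \<in> {1..N}"
  shows "integrable M (\<lambda>\<omega>. (norm (y i t \<omega>))\<^sup>2)"
proof -
  have "bounded X" using X(3) by (rule compact_imp_bounded)
  then obtain b where b: "\<And>z. z \<in> X \<Longrightarrow> norm z \<le> b" by (auto simp: bounded_iff)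
  have bound: "(norm (y i t \<omega>))\<^sup>2 \<le> (\<Sum>j=1..N. 2 * b\<^sup>2 + 2 * (r t)\<^sup>2 * (norm (\<xi> i j t \<omega>))\<^sup>2) * real N"
    if \<omega>: "\<omega> \<in> space M" for \<omega>
  proof -
    have "norm (y i t \<omega>) \<le> (\<Sum>j=1..N. norm (x j t \<omega> + r t *\<^sub>R \<xi> i j t \<omega>))"
      unfolding y_eq[OF \<omega> i]
    proof (rule sum_norm_le)
      fix j assume j: "j \<in> {1..N}"
      have "norm (P t i j *\<^sub>R (x j t \<omega> + r t *\<^sub>R \<xi> i j t \<omega>)) = P t i j * norm (x j t \<omega> + r t *\<^sub>R \<xi> i j t \<omega>)"
        using P_nonneg[OF i j] by simp
      also have "\<dots> \<le> norm (x j t \<omega> + r t *\<^sub>R \<xi> i j t \<omega>)"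
        using P_le_1[OF i j] P_nonneg[OF i j] by (intro mult_left_le_one_le) auto
      finally show "norm (P t i j *\<^sub>R (x j t \<omega> + r t *\<^sub>R \<xi> i j t \<omega>)) \<le> norm (x j t \<omega> + r t *\<^sub>R \<xi> i j t \<omega>)" .
    qed
    then have "(norm (y i t \<omega>))\<^sup>2 \<le> (\<Sum>j=1..N. norm (x j t \<omega> + r t *\<^sub>R \<xi> i j t \<omega>))\<^sup>2"
      by (intro power_mono) auto
    also have "\<dots> \<le> (\<Sum>j=1..N. (norm (x j t \<omega> + r t *\<^sub>R \<xi> i j t \<omega>))\<^sup>2) * real (card {1..N})"
      by (rule sum_squared_le_sum_of_squares)
    also have "\<dots> \<le> (\<Sum>j=1..N. 2 * b\<^sup>2 + 2 * (r t)\<^sup>2 * (norm (\<xi> i j t \<omega>))\<^sup>2) * real (card {1..N})"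
    proof (intro mult_right_mono sum_mono)
      fix j assume j: "j \<in> {1..N}"
      have "(norm (x j t \<omega> + r t *\<^sub>R \<xi> i j t \<omega>))\<^sup>2 \<le> (b + r t * norm (\<xi> i j t \<omega>))\<^sup>2"
        using b[OF x_in[OF \<omega> j, of t]] r_nonneg[of t] norm_triangle_ineq[of "x j t \<omega>" "r t *\<^sub>R \<xi> i j t \<omega>"]
        by (intro power_mono) auto
      also have "\<dots> \<le> 2 * b\<^sup>2 + 2 * (r t * norm (\<xi> i j t \<omega>))\<^sup>2"
        using zero_le_power2[of "b - r t * norm (\<xi> i j t \<omega>)"] by (simp add: power2_sum power2_diff)
      finally show "(norm (x j t \<omega> + r t *\<^sub>R \<xi> i j t \<omega>))\<^sup>2 \<le> 2 * b\<^sup>2 + 2 * (r t)\<^sup>2 * (norm (\<xi> i j t \<omega>))\<^sup>2"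
        by (simp add: power_mult_distrib)
    qed auto
    finally show ?thesis by simp
  qed
  show ?thesis
  proof (rule Bochner_Integration.integrable_bound)
    show "integrable M (\<lambda>\<omega>. (\<Sum>j=1..N. 2 * b\<^sup>2 + 2 * (r t)\<^sup>2 * (norm (\<xi> i j t \<omega>))\<^sup>2) * real N)"
      by (intro integrable_mult_left Bochner_Integration.integrable_sum Bochner_Integration.integrable_add
          integrable_mult_right integrable_\<xi>_sq[OF i]) auto
    show "(\<lambda>\<omega>. (norm (y i t \<omega>))\<^sup>2) \<in> borel_measurable M" using i by measurable
    show "AE \<omega> in M. norm ((norm (y i t \<omega>))\<^sup>2)
        \<le> norm ((\<Sum>j=1..N. 2 * b\<^sup>2 + 2 * (r t)\<^sup>2 * (norm (\<xi> i j t \<omega>))\<^sup>2) * real N)"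
    proof (rule AE_I2)
      fix \<omega> assume "\<omega> \<in> space M"
      from bound[OF this] show "norm ((norm (y i t \<omega>))\<^sup>2)
        \<le> norm ((\<Sum>j=1..N. 2 * b\<^sup>2 + 2 * (r t)\<^sup>2 * (norm (\<xi> i j t \<omega>))\<^sup>2) * real N)" by simp
    qed
  qed
qed

text \<open>Given the past and the noises the query point is known, so coordinate by coordinate the
  stochastic subgradient may be replaced by \<open>g\<close> inside the expectation. The exact
  subgradient enters only through an integrable minorant \<open>W\<close>, so no integrability of
  its inner product has to be established.\<close>

lemma
  assumes i: "i \<in> {1..N}"
  shows integrable_inner_gv: "integrable M (\<lambda>\<omega>. inner (gv i t \<omega>) (y i t \<omega> - a))"
    and expectation_inner_gv_ge:
      "\<And>W. integrable M W \<Longrightarrow> AE \<omega> in M. W \<omega> \<le> inner (g i (y i t \<omega>)) (y i t \<omega> - a)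
        \<Longrightarrow> (\<integral>\<omega>. W \<omega> \<partial>M) \<le> (\<integral>\<omega>. inner (gv i t \<omega>) (y i t \<omega> - a) \<partial>M)"
proof -
  define G where "G = past_and_noise N M \<F> \<xi> t"
  define v where "v = (\<lambda>\<omega>. y i t \<omega> - a)"
  interpret finite_measure_subalgebra M G by unfold_locales (simp add: G_def subalgebra_pn)
  have gv_m [measurable]: "gv i t \<in> borel_measurable M" using i by (rule measurable_gv)
  have y_m [measurable]: "y i t \<in> borel_measurable M" using i by (rule measurable_y)
  have vG [measurable]: "v \<in> borel_measurable G"
    using measurable_y_pn[OF i, of t] unfolding v_def G_def by measurable
  have v_m [measurable]: "v \<in> borel_measurable M" unfolding v_def by measurable
  have y1: "integrable M (\<lambda>\<omega>. norm (y i t \<omega>))"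
    by (rule square_integrable_imp_integrable) (use integrable_norm_y_sq[OF i] in auto)
  have v2: "integrable M (\<lambda>\<omega>. (norm (v \<omega>))\<^sup>2)"
  proof (rule Bochner_Integration.integrable_bound)
    show "integrable M (\<lambda>\<omega>. 2 * (norm (y i t \<omega>))\<^sup>2 + 2 * (norm a)\<^sup>2)"
      using integrable_norm_y_sq[OF i] by simp
    show "AE \<omega> in M. norm ((norm (v \<omega>))\<^sup>2) \<le> norm (2 * (norm (y i t \<omega>))\<^sup>2 + 2 * (norm a)\<^sup>2)"
    proof (rule AE_I2)
      fix \<omega>
      have "(norm (v \<omega>))\<^sup>2 \<le> (norm (y i t \<omega>) + norm a)\<^sup>2"
        unfolding v_def by (intro power_mono norm_triangle_ineq4) auto
      also have "\<dots> \<le> 2 * (norm (y i t \<omega>))\<^sup>2 + 2 * (norm a)\<^sup>2"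
        using zero_le_power2[of "norm (y i t \<omega>) - norm a"] by (simp add: power2_sum power2_diff)
      finally show "norm ((norm (v \<omega>))\<^sup>2) \<le> norm (2 * (norm (y i t \<omega>))\<^sup>2 + 2 * (norm a)\<^sup>2)" by simp
    qed
  qed auto
  have comp_sq: "integrable M (\<lambda>\<omega>. (inner (z \<omega>) b)\<^sup>2)"
    if "z \<in> borel_measurable M" "integrable M (\<lambda>\<omega>. (norm (z \<omega>))\<^sup>2)" "b \<in> Basis" for z :: "'w \<Rightarrow> 'a" and b
  proof (rule Bochner_Integration.integrable_bound[OF that(2)])
    have [measurable]: "z \<in> borel_measurable M" by (rule that(1))
    show "(\<lambda>\<omega>. (inner (z \<omega>) b)\<^sup>2) \<in> borel_measurable M" by measurable
    show "AE \<omega> in M. norm ((inner (z \<omega>) b)\<^sup>2) \<le> norm ((norm (z \<omega>))\<^sup>2)"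
      using Basis_le_norm[OF that(3)] by (auto simp: abs_le_square_iff[symmetric])
  qed
  have prod: "integrable M (\<lambda>\<omega>. inner (v \<omega>) b * inner (gv i t \<omega>) b)" if b: "b \<in> Basis" for b
    by (intro integrable_mult_square_integrable comp_sq b v2 integrable_gv_sq[OF i]) auto
  have expand: "inner (gv i t \<omega>) (y i t \<omega> - a) = (\<Sum>b\<in>Basis. inner (v \<omega>) b * inner (gv i t \<omega>) b)" for \<omega>
    by (subst euclidean_inner) (simp add: v_def mult.commute)
  show int: "integrable M (\<lambda>\<omega>. inner (gv i t \<omega>) (y i t \<omega> - a))"
    unfolding expand by (intro Bochner_Integration.integrable_sum prod)
  fix W assume W: "integrable M W" "AE \<omega> in M. W \<omega> \<le> inner (g i (y i t \<omega>)) (y i t \<omega> - a)"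
  have cond: "AE \<omega> in M. vec_cond_exp M G (gv i t) \<omega> = g i (y i t \<omega>)"
    using subgradients i by (auto simp: stochastic_subgradient_assumption_def G_def gv_def[abs_def])
  define C where "C = (\<lambda>\<omega> b. inner (v \<omega>) b * real_cond_exp M G (\<lambda>\<omega>. inner (gv i t \<omega>) b) \<omega>)"
  have C: "integrable M (\<lambda>\<omega>. C \<omega> b)" "(\<integral>\<omega>. C \<omega> b \<partial>M) = (\<integral>\<omega>. inner (v \<omega>) b * inner (gv i t \<omega>) b \<partial>M)"
    if b: "b \<in> Basis" for b
    unfolding C_def using real_cond_exp_intg[OF prod[OF b]] by auto
  have "(\<integral>\<omega>. W \<omega> \<partial>M) \<le> (\<integral>\<omega>. (\<Sum>b\<in>Basis. C \<omega> b) \<partial>M)"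
  proof (rule integral_mono_AE)
    show "integrable M (\<lambda>\<omega>. \<Sum>b\<in>Basis. C \<omega> b)" by (intro Bochner_Integration.integrable_sum C)
    show "AE \<omega> in M. W \<omega> \<le> (\<Sum>b\<in>Basis. C \<omega> b)"
      using W(2) cond
    proof eventually_elim
      fix \<omega> assume le: "W \<omega> \<le> inner (g i (y i t \<omega>)) (y i t \<omega> - a)"
        and eq: "vec_cond_exp M G (gv i t) \<omega> = g i (y i t \<omega>)"
      have "inner (g i (y i t \<omega>)) (y i t \<omega> - a) = (\<Sum>b\<in>Basis. inner (g i (y i t \<omega>)) b * inner (v \<omega>) b)"
        unfolding v_def by (rule euclidean_inner)
      also have "\<dots> = (\<Sum>b\<in>Basis. C \<omega> b)"
        by (intro sum.cong refl) (simp add: C_def vec_cond_exp_inner flip: eq)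
      finally show "W \<omega> \<le> (\<Sum>b\<in>Basis. C \<omega> b)" using le by simp
    qed
  qed (rule W(1))
  also have "\<dots> = (\<Sum>b\<in>Basis. \<integral>\<omega>. C \<omega> b \<partial>M)" by (intro Bochner_Integration.integral_sum C)
  also have "\<dots> = (\<Sum>b\<in>Basis. \<integral>\<omega>. inner (v \<omega>) b * inner (gv i t \<omega>) b \<partial>M)" by (intro sum.cong refl C)
  also have "\<dots> = (\<integral>\<omega>. inner (gv i t \<omega>) (y i t \<omega> - a) \<partial>M)"
    unfolding expand by (intro Bochner_Integration.integral_sum[symmetric] prod)
  finally show "(\<integral>\<omega>. W \<omega> \<partial>M) \<le> (\<integral>\<omega>. inner (gv i t \<omega>) (y i t \<omega> - a) \<partial>M)" .
qed

text \<open>The term \<open>Gf * norm (x i (Suc t) \<omega> - y i t \<omega>)\<close> is absorbed by the strong convexity of the mirror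
  map, which is why no bound on the distance of the query point to \<open>X\<close> is needed here.\<close>

lemma prox_step:
  assumes \<omega>: "\<omega> \<in> space M" and i: "i \<in> {1..N}" and a: "a \<in> X"
  shows "chi i (x i (Suc t) \<omega>) - chi i a + inner (gv i t \<omega>) (y i t \<omega> - a) + Gf * norm (x i (Suc t) \<omega> - y i t \<omega>)
    \<le> (bregman \<Phi> a (y i t \<omega>) - bregman \<Phi> a (x i (Suc t) \<omega>)) / \<alpha> t + \<alpha> t / \<sigma> * ((norm (gv i t \<omega>))\<^sup>2 + Gf\<^sup>2)"
proof -
  define z where "z = x i (Suc t) \<omega>"
  define Y where "Y = y i t \<omega>"
  define h where "h = gv i t \<omega>"
  define s where "s = norm (z - Y)"
  define \<alpha>' where "\<alpha>' = \<alpha> t"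
  have \<alpha>': "0 < \<alpha>'" by (simp add: \<alpha>'_def \<alpha>_pos)
  have "\<alpha>' * inner h (z - a) + \<alpha>' * (chi i z - chi i a) \<le> bregman \<Phi> a Y - bregman \<Phi> z Y - bregman \<Phi> a z"
    unfolding z_def Y_def h_def \<alpha>'_def
    by (rule bregman_prox_ineq[OF X(2) convex_chi[OF i] \<alpha>_pos \<Phi>(3) less_imp_le[OF \<Phi>(2)] grad_lipschitz x_arg_min[OF \<omega> i] a])
  moreover have "\<sigma> / 2 * s\<^sup>2 \<le> bregman \<Phi> z Y" unfolding s_def by (rule bregman_ge[OF \<Phi>(3)])
  ultimately have "\<alpha>' * (inner h (z - a) + (chi i z - chi i a)) \<le> (bregman \<Phi> a Y - bregman \<Phi> a z) - \<sigma> / 2 * s\<^sup>2"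
    by (simp add: distrib_left)
  then have "inner h (z - a) + (chi i z - chi i a) \<le> ((bregman \<Phi> a Y - bregman \<Phi> a z) - \<sigma> / 2 * s\<^sup>2) / \<alpha>'"
    using \<alpha>' by (simp add: pos_le_divide_eq mult.commute)
  then have 1: "inner h (z - a) + (chi i z - chi i a) \<le> (bregman \<Phi> a Y - bregman \<Phi> a z) / \<alpha>' - \<sigma> / (2 * \<alpha>') * s\<^sup>2"
    by (simp add: diff_divide_distrib)
  have 2: "inner h (Y - a) \<le> inner h (z - a) + norm h * s"
  proof -
    have "inner h (Y - a) = inner h (z - a) + inner h (Y - z)" by (simp add: inner_diff_right)
    also have "inner h (Y - z) \<le> norm h * s" unfolding s_def by (metis norm_cauchy_schwarz norm_minus_commute)
    finally show ?thesis by simp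
  qed
  \<comment> \<open>Completing the square in \<open>s\<close>: the quadratic term from strong
    convexity pays for both linear terms, the one with the stochastic subgradient and the one with
    \<open>Gf\<close>.\<close>
  have 3: "(norm h + Gf) * s - \<sigma> / (2 * \<alpha>') * s\<^sup>2 \<le> \<alpha>' / \<sigma> * ((norm h)\<^sup>2 + Gf\<^sup>2)"
  proof -
    define q where "q = norm h + Gf"
    have "0 \<le> \<sigma> / (2 * \<alpha>') * (s - \<alpha>' / \<sigma> * q)\<^sup>2" using \<alpha>' \<Phi>(2) by simp
    also have "\<dots> = \<sigma> / (2 * \<alpha>') * s\<^sup>2 - q * s + \<alpha>' / (2 * \<sigma>) * q\<^sup>2"
      using \<alpha>' \<Phi>(2) by (simp add: power2_eq_square field_simps)
    finally have "q * s - \<sigma> / (2 * \<alpha>') * s\<^sup>2 \<le> \<alpha>' / (2 * \<sigma>) * q\<^sup>2" by simp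
    also have "\<dots> \<le> \<alpha>' / (2 * \<sigma>) * (2 * ((norm h)\<^sup>2 + Gf\<^sup>2))"
      using \<alpha>' \<Phi>(2) zero_le_power2[of "norm h - Gf"]
      by (intro mult_left_mono) (simp_all add: q_def power2_sum power2_diff)
    also have "\<dots> = \<alpha>' / \<sigma> * ((norm h)\<^sup>2 + Gf\<^sup>2)" using \<Phi>(2) by (simp add: field_simps)
    finally show ?thesis by (simp only: q_def)
  qed
  have "chi i z - chi i a + inner h (Y - a) + Gf * s
    \<le> (bregman \<Phi> a Y - bregman \<Phi> a z) / \<alpha>' + \<alpha>' / \<sigma> * ((norm h)\<^sup>2 + Gf\<^sup>2)"
    using 1 2 3 by (simp add: distrib_right)
  then show ?thesis by (simp only: z_def Y_def h_def s_def \<alpha>'_def)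
qed

text \<open>Convexity of the divergence in its second argument separates the links, and the
  three-point identity separates the noise from the state. Because the states lie in
  \<open>X\<close>, the cross term is controlled by the diameter. The term linear in the noise leads
  to \<open>C5\<close>, the quadratic one to \<open>C6\<close>.\<close>

lemma bregman_noisy_mix_le:
  assumes \<omega>: "\<omega> \<in> space M" and i: "i \<in> {1..N}" and a: "a \<in> X"
  shows "bregman \<Phi> a (y i t \<omega>) \<le> (\<Sum>j=1..N. P t i j * (bregman \<Phi> a (x j t \<omega>)
      + (L * (r t)\<^sup>2 * (norm (\<xi> i j t \<omega>))\<^sup>2 + L * r t * (sqrt (2 / \<sigma>) * D) * norm (\<xi> i j t \<omega>))))"
proof -
  have "bregman \<Phi> a (y i t \<omega>) \<le> (\<Sum>j=1..N. P t i j * bregman \<Phi> a (x j t \<omega> + r t *\<^sub>R \<xi> i j t \<omega>))"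
    unfolding y_eq[OF \<omega> i]
    using mirror P_nonneg[OF i] P_le_1[OF i] P_row_sum[OF i] by (auto simp: mirror_map_assumption_def)
  also have "\<dots> \<le> (\<Sum>j=1..N. P t i j * (bregman \<Phi> a (x j t \<omega>)
      + (L * (r t)\<^sup>2 * (norm (\<xi> i j t \<omega>))\<^sup>2 + L * r t * (sqrt (2 / \<sigma>) * D) * norm (\<xi> i j t \<omega>))))"
  proof (intro sum_mono mult_left_mono)
    fix j assume j: "j \<in> {1..N}"
    define b where "b = x j t \<omega>"
    define b' where "b' = b + r t *\<^sub>R \<xi> i j t \<omega>"
    have bX: "b \<in> X" unfolding b_def by (rule x_in[OF \<omega> j])
    have nb: "norm (b - b') = r t * norm (\<xi> i j t \<omega>)" using r_nonneg[of t] by (simp add: b'_def)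
    have "bregman \<Phi> b b' \<le> L * (norm (b - b'))\<^sup>2"
      by (rule bregman_le[OF \<Phi>(3) less_imp_le[OF \<Phi>(2)] grad_lipschitz])
    moreover have "inner (grad \<Phi> b - grad \<Phi> b') (a - b) \<le> (L * norm (b - b')) * (sqrt (2 / \<sigma>) * D)"
    proof (rule order_trans[OF norm_cauchy_schwarz mult_mono])
      show "norm (grad \<Phi> b - grad \<Phi> b') \<le> L * norm (b - b')" by (rule grad_lipschitz)
      show "norm (a - b) \<le> sqrt (2 / \<sigma>) * D" by (rule norm_le_bregman_diam[OF \<Phi>(1) X(3) a bX \<Phi>(3,2)])
    qed (use L_nonneg in auto)
    ultimately have "bregman \<Phi> a b' \<le> bregman \<Phi> a b + (L * (norm (b - b'))\<^sup>2 + (L * norm (b - b')) * (sqrt (2 / \<sigma>) * D))"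
      using bregman_three_point[of \<Phi> a b' b] by linarith
    also have "\<dots> = bregman \<Phi> a b + (L * (r t)\<^sup>2 * (norm (\<xi> i j t \<omega>))\<^sup>2 + L * r t * (sqrt (2 / \<sigma>) * D) * norm (\<xi> i j t \<omega>))"
      unfolding nb by (simp add: power_mult_distrib mult_ac)
    finally show "bregman \<Phi> a (x j t \<omega> + r t *\<^sub>R \<xi> i j t \<omega>) \<le> bregman \<Phi> a (x j t \<omega>)
      + (L * (r t)\<^sup>2 * (norm (\<xi> i j t \<omega>))\<^sup>2 + L * r t * (sqrt (2 / \<sigma>) * D) * norm (\<xi> i j t \<omega>))"
      by (simp only: b_def b'_def)
  qed (use P_nonneg[OF i] in auto)
  finally show ?thesis .
qed

section \<open>Disagreement of the agents\<close>

lemma mix_in: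
  assumes \<omega>: "\<omega> \<in> space M" and i: "i \<in> {1..N}"
  shows "mix N (P t) (\<lambda>j. x j t \<omega>) i \<in> X"
  unfolding mix_def
  using X(2) P_row_sum[OF i] P_nonneg[OF i] x_in[OF \<omega>] by (intro convex_sum) auto

lemma norm_mix_diff_y_le:
  assumes \<omega>: "\<omega> \<in> space M" and i: "i \<in> {1..N}"
  shows "norm (mix N (P t) (\<lambda>j. x j t \<omega>) i - y i t \<omega>) \<le> r t * noise_level i t \<omega>"
proof -
  have "mix N (P t) (\<lambda>j. x j t \<omega>) i - y i t \<omega> = (\<Sum>j=1..N. - (P t i j * r t) *\<^sub>R \<xi> i j t \<omega>)"
    unfolding mix_def y_eq[OF \<omega> i] by (simp add: scaleR_add_right sum.distrib sum_negf)
  also have "norm \<dots> \<le> (\<Sum>j=1..N. r t * (P t i j * norm (\<xi> i j t \<omega>)))"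
  proof (rule sum_norm_le)
    fix j assume "j \<in> {1..N}"
    then show "norm (- (P t i j * r t) *\<^sub>R \<xi> i j t \<omega>) \<le> r t * (P t i j * norm (\<xi> i j t \<omega>))"
      using P_nonneg[OF i] r_nonneg[of t] by (simp add: abs_mult)
  qed
  also have "\<dots> = r t * noise_level i t \<omega>" by (simp add: noise_level_def sum_distrib_left)
  finally show ?thesis .
qed

text \<open>A simple upper bound for the positive root of the quadratic inequality that appears in
  \<open>norm_diff_mix_le\<close>.\<close>

definition deviation :: "nat \<Rightarrow> nat \<Rightarrow> 'w \<Rightarrow> real" where
  "deviation i t \<omega> = 2 * \<alpha> t / \<sigma> * (norm (gv i t \<omega>) + Gchi) + sqrt (2 * L / \<sigma>) * (r t * noise_level i t \<omega>)"

text \<open>The comparison point of the prox inequality must lie in \<open>X\<close>, which the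
  noiseless average does by convexity. Its divergence from the query point is at most
  \<open>L\<close> times the squared noise, so the distance \<open>s\<close> satisfies
  \<open>s\<^sup>2 \<le> A * s + E\<^sup>2\<close>, and this forces
  \<open>s \<le> A + E\<close>.\<close>

lemma norm_diff_mix_le:
  assumes \<omega>: "\<omega> \<in> space M" and i: "i \<in> {1..N}"
  shows "norm (x i (Suc t) \<omega> - mix N (P t) (\<lambda>j. x j t \<omega>) i) \<le> deviation i t \<omega>"
proof -
  define z where "z = x i (Suc t) \<omega>"
  define w where "w = mix N (P t) (\<lambda>j. x j t \<omega>) i"
  define Y where "Y = y i t \<omega>"
  define h where "h = gv i t \<omega>"
  define s where "s = norm (z - w)"
  define n where "n = r t * noise_level i t \<omega>"
  define \<alpha>' where "\<alpha>' = \<alpha> t"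
  define A where "A = 2 * \<alpha>' / \<sigma> * (norm h + Gchi)"
  define E where "E = sqrt (2 * L / \<sigma>) * n"
  have \<alpha>': "0 < \<alpha>'" by (simp add: \<alpha>'_def \<alpha>_pos)
  have s0: "0 \<le> s" by (simp add: s_def)
  have wX: "w \<in> X" unfolding w_def by (rule mix_in[OF \<omega> i])
  have nY: "norm (w - Y) \<le> n" unfolding w_def Y_def n_def by (rule norm_mix_diff_y_le[OF \<omega> i])
  then have n: "0 \<le> n" using norm_ge_zero order_trans by blast
  have "\<alpha>' * inner h (z - w) + \<alpha>' * (chi i z - chi i w) \<le> bregman \<Phi> w Y - bregman \<Phi> z Y - bregman \<Phi> w z"
    unfolding z_def Y_def h_def \<alpha>'_def
    by (rule bregman_prox_ineq[OF X(2) convex_chi[OF i] \<alpha>_pos \<Phi>(3) less_imp_le[OF \<Phi>(2)] grad_lipschitz x_arg_min[OF \<omega> i] wX])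
  moreover have "\<sigma> / 2 * s\<^sup>2 \<le> bregman \<Phi> w z"
    using bregman_ge[OF \<Phi>(3), of w z] by (simp add: s_def norm_minus_commute)
  moreover have "0 \<le> bregman \<Phi> z Y"
    using bregman_ge[OF \<Phi>(3), of z Y] \<Phi>(2) by (smt (verit) divide_nonneg_nonneg mult_nonneg_nonneg zero_le_power2)
  moreover have "bregman \<Phi> w Y \<le> L * n\<^sup>2"
  proof -
    have "bregman \<Phi> w Y \<le> L * (norm (w - Y))\<^sup>2" by (rule bregman_le[OF \<Phi>(3) less_imp_le[OF \<Phi>(2)] grad_lipschitz])
    also have "\<dots> \<le> L * n\<^sup>2" using nY L_nonneg by (intro mult_left_mono power_mono) auto
    finally show ?thesis .
  qed
  moreover have "- (\<alpha>' * (norm h * s)) \<le> \<alpha>' * inner h (z - w)"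
  proof -
    have "- (norm h * s) \<le> inner h (z - w)"
      using Cauchy_Schwarz_ineq2[of h "z - w"] by (simp add: s_def)
    then show ?thesis using \<alpha>' mult_left_mono[of "- (norm h * s)" "inner h (z - w)" \<alpha>'] by simp
  qed
  moreover have "- (\<alpha>' * (Gchi * s)) \<le> \<alpha>' * (chi i z - chi i w)"
  proof -
    have "- (Gchi * s) \<le> chi i z - chi i w"
      using chi_lipschitz[OF i wX, of z] by (simp add: s_def norm_minus_commute)
    then show ?thesis using \<alpha>' mult_left_mono[of "- (Gchi * s)" "chi i z - chi i w" \<alpha>'] by simp
  qed
  ultimately have "\<sigma> / 2 * s\<^sup>2 \<le> \<alpha>' * (norm h * s) + \<alpha>' * (Gchi * s) + L * n\<^sup>2" by linarith
  then have "2 / \<sigma> * (\<sigma> / 2 * s\<^sup>2) \<le> 2 / \<sigma> * (\<alpha>' * (norm h * s) + \<alpha>' * (Gchi * s) + L * n\<^sup>2)"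
    using \<Phi>(2) by (intro mult_left_mono) auto
  also have "\<dots> = A * s + E\<^sup>2"
    using \<Phi>(2) L_nonneg by (simp add: A_def E_def power_mult_distrib field_simps)
  finally have quad: "s\<^sup>2 \<le> A * s + E\<^sup>2" using \<Phi>(2) by simp
  have A: "0 \<le> A" using \<alpha>' \<Phi>(2) Gchi_nonneg by (simp add: A_def)
  have E: "0 \<le> E" using n L_nonneg \<Phi>(2) by (simp add: E_def)
  have "s \<le> A + E"
  proof (rule ccontr)
    assume "\<not> s \<le> A + E"
    then have "E < s - A" "E \<le> s" using A by auto
    have "E * E \<le> s * E" using \<open>E \<le> s\<close> E by (rule mult_right_mono)
    also have "s * E < s * (s - A)" using \<open>E < s - A\<close> A E by (intro mult_strict_left_mono) auto
    finally show False using quad by (simp add: power2_eq_square algebra_simps)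
  qed
  then show ?thesis by (simp only: s_def z_def w_def A_def E_def n_def h_def \<alpha>'_def deviation_def)
qed

text \<open>Seen from the noiseless averages, the states follow a linear consensus recursion whose
  perturbation is the displacement bounded by \<open>deviation\<close>.\<close>

lemma sdev_x_le:
  assumes \<omega>: "\<omega> \<in> space M"
  shows "sdev N (\<lambda>i. x i t \<omega>) \<le> \<omega>c * \<gamma>c ^ t * (\<Sum>j=1..N. norm (x0 j))
    + (\<Sum>s<t. \<omega>c * \<gamma>c ^ (t - 1 - s) * (\<Sum>i=1..N. deviation i s \<omega>))"
proof -
  define e where "e s i = x i (Suc s) \<omega> - mix N (P s) (\<lambda>j. x j s \<omega>) i" for s i
  have \<omega>c: "0 \<le> \<omega>c" using omega_const_ge_1[OF network N] by simp
  have \<gamma>c: "0 \<le> \<gamma>c" using gamma_const_bounds[OF network N] by simp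
  have "sdev N (\<lambda>i. x i t \<omega>) \<le> \<omega>c * \<gamma>c ^ t * sdev N (\<lambda>i. x i 0 \<omega>) + (\<Sum>s<t. \<omega>c * \<gamma>c ^ (t - 1 - s) * sdev N (e s))"
    by (rule sdev_perturbed[OF network N, where x = "\<lambda>t i. x i t \<omega>"]) (simp add: e_def)
  also have "\<dots> \<le> \<omega>c * \<gamma>c ^ t * (\<Sum>j=1..N. norm (x0 j)) + (\<Sum>s<t. \<omega>c * \<gamma>c ^ (t - 1 - s) * (\<Sum>i=1..N. deviation i s \<omega>))"
  proof (intro add_mono mult_left_mono sum_mono)
    show "sdev N (\<lambda>i. x i 0 \<omega>) \<le> (\<Sum>j=1..N. norm (x0 j))"
      using sdev_le_sum_norm[OF N, of "\<lambda>i. x i 0 \<omega>"] x_0[OF \<omega>] by simp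
    fix s
    have "sdev N (e s) \<le> (\<Sum>i=1..N. norm (e s i))" by (rule sdev_le_sum_norm[OF N])
    also have "\<dots> \<le> (\<Sum>i=1..N. deviation i s \<omega>)"
      unfolding e_def by (intro sum_mono norm_diff_mix_le[OF \<omega>])
    finally show "sdev N (e s) \<le> (\<Sum>i=1..N. deviation i s \<omega>)" .
  qed (use \<omega>c \<gamma>c in auto)
  finally show ?thesis .
qed

definition mean_deviation :: "nat \<Rightarrow> real" where
  "mean_deviation t = 2 * \<alpha> t / \<sigma> * (Gf + Gchi) + sqrt (2 * L / \<sigma>) * (r t * sqrt \<nu>)"

lemma mean_deviation_nonneg: "0 \<le> mean_deviation t"
  using \<alpha>_pos[of t] r_nonneg[of t] \<Phi>(2) L_nonneg Gf_nonneg Gchi_nonneg \<nu>_nonneg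
  by (simp add: mean_deviation_def)

lemma
  assumes i: "i \<in> {1..N}"
  shows integrable_deviation: "integrable M (deviation i t)"
    and expectation_deviation_le: "(\<integral>\<omega>. deviation i t \<omega> \<partial>M) \<le> mean_deviation t"
proof -
  have n: "integrable M (noise_level i t)"
    unfolding noise_level_def by (intro Bochner_Integration.integrable_sum integrable_mult_right integrable_\<xi>[OF i])
  have "(\<integral>\<omega>. noise_level i t \<omega> \<partial>M) = (\<Sum>j=1..N. P t i j * (\<integral>\<omega>. norm (\<xi> i j t \<omega>) \<partial>M))"
    unfolding noise_level_def using integrable_\<xi>[OF i] by (subst Bochner_Integration.integral_sum) auto
  also have "\<dots> \<le> (\<Sum>j=1..N. P t i j * sqrt \<nu>)"
    using P_nonneg[OF i] \<xi>_le[OF i] by (intro sum_mono mult_left_mono) auto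
  also have "\<dots> = sqrt \<nu>" using P_row_sum[OF i] by (simp flip: sum_distrib_right)
  finally have n_le: "(\<integral>\<omega>. noise_level i t \<omega> \<partial>M) \<le> sqrt \<nu>" .
  have h: "integrable M (\<lambda>\<omega>. norm (gv i t \<omega>))" by (rule integrable_gv[OF i])
  show "integrable M (deviation i t)" unfolding deviation_def using n h by simp
  have "(\<integral>\<omega>. deviation i t \<omega> \<partial>M) = 2 * \<alpha> t / \<sigma> * ((\<integral>\<omega>. norm (gv i t \<omega>) \<partial>M) + Gchi)
      + sqrt (2 * L / \<sigma>) * (r t * (\<integral>\<omega>. noise_level i t \<omega> \<partial>M))"
    unfolding deviation_def using n h by (simp add: prob_space)
  also have "\<dots> \<le> mean_deviation t"
    unfolding mean_deviation_def using gv_le[OF i] n_le \<alpha>_pos[of t] r_nonneg[of t] \<Phi>(2) L_nonneg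
    by (intro add_mono mult_left_mono) auto
  finally show "(\<integral>\<omega>. deviation i t \<omega> \<partial>M) \<le> mean_deviation t" .
qed

lemma integrable_norm_diff_x:
  assumes "i \<in> {1..N}" "l \<in> {1..N}"
  shows "integrable M (\<lambda>\<omega>. norm (x l t \<omega> - x i t \<omega>))"
proof (rule Bochner_Integration.integrable_bound)
  show "integrable M (\<lambda>\<omega>. norm (x l t \<omega>) + norm (x i t \<omega>))" using assms integrable_norm_x by simp
  show "(\<lambda>\<omega>. norm (x l t \<omega> - x i t \<omega>)) \<in> borel_measurable M" using assms by measurable
qed (auto intro: norm_triangle_ineq4)

lemma expectation_disagreement_le:
  assumes l: "l \<in> {1..N}"
  shows "(\<Sum>i=1..N. \<integral>\<omega>. norm (x l t \<omega> - x i t \<omega>) \<partial>M) \<le> 2 * real N * (\<omega>c * \<gamma>c ^ t * (\<Sum>j=1..N. norm (x0 j))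
    + (\<Sum>s<t. \<omega>c * \<gamma>c ^ (t - 1 - s) * (real N * mean_deviation s)))"
proof -
  have \<omega>c: "0 \<le> \<omega>c" using omega_const_ge_1[OF network N] by simp
  have \<gamma>c: "0 \<le> \<gamma>c" using gamma_const_bounds[OF network N] by simp
  define U where "U \<omega> = \<omega>c * \<gamma>c ^ t * (\<Sum>j=1..N. norm (x0 j))
    + (\<Sum>s<t. \<omega>c * \<gamma>c ^ (t - 1 - s) * (\<Sum>i=1..N. deviation i s \<omega>))" for \<omega>
  have Ui: "integrable M U"
    unfolding U_def by (intro Bochner_Integration.integrable_add Bochner_Integration.integrable_sum
        integrable_mult_right integrable_deviation integrable_const)
  have di: "integrable M (\<lambda>\<omega>. \<Sum>i=1..N. norm (x l t \<omega> - x i t \<omega>))"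
    by (intro Bochner_Integration.integrable_sum integrable_norm_diff_x l)
  have "(\<Sum>i=1..N. \<integral>\<omega>. norm (x l t \<omega> - x i t \<omega>) \<partial>M) = (\<integral>\<omega>. (\<Sum>i=1..N. norm (x l t \<omega> - x i t \<omega>)) \<partial>M)"
    by (intro Bochner_Integration.integral_sum[symmetric] integrable_norm_diff_x l)
  also have "\<dots> \<le> (\<integral>\<omega>. 2 * real N * U \<omega> \<partial>M)"
  proof (rule integral_mono)
    fix \<omega> assume \<omega>: "\<omega> \<in> space M"
    have "(\<Sum>i=1..N. norm (x l t \<omega> - x i t \<omega>)) \<le> 2 * real N * sdev N (\<lambda>i. x i t \<omega>)"
      by (rule sum_norm_diff_le_sdev[OF l])
    also have "\<dots> \<le> 2 * real N * U \<omega>"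
      unfolding U_def by (intro mult_left_mono sdev_x_le[OF \<omega>]) auto
    finally show "(\<Sum>i=1..N. norm (x l t \<omega> - x i t \<omega>)) \<le> 2 * real N * U \<omega>" .
  qed (use di Ui in auto)
  also have "\<dots> = 2 * real N * (\<integral>\<omega>. U \<omega> \<partial>M)" by simp
  also have "(\<integral>\<omega>. U \<omega> \<partial>M) = \<omega>c * \<gamma>c ^ t * (\<Sum>j=1..N. norm (x0 j))
    + (\<Sum>s<t. \<omega>c * \<gamma>c ^ (t - 1 - s) * (\<Sum>i=1..N. \<integral>\<omega>. deviation i s \<omega> \<partial>M))"
  proof -
    define d where "d s \<omega> = (\<Sum>i=1..N. deviation i s \<omega>)" for s \<omega>
    have d: "integrable M (d s)" "(\<integral>\<omega>. d s \<omega> \<partial>M) = (\<Sum>i=1..N. \<integral>\<omega>. deviation i s \<omega> \<partial>M)" for s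
      unfolding d_def
      by (intro Bochner_Integration.integrable_sum Bochner_Integration.integral_sum integrable_deviation; assumption)+
    have cd: "integrable M (\<lambda>\<omega>. \<omega>c * \<gamma>c ^ (t - 1 - s) * d s \<omega>)" for s by (intro integrable_mult_right d)
    have "(\<integral>\<omega>. U \<omega> \<partial>M) = (\<integral>\<omega>. \<omega>c * \<gamma>c ^ t * (\<Sum>j=1..N. norm (x0 j)) \<partial>M)
        + (\<integral>\<omega>. (\<Sum>s<t. \<omega>c * \<gamma>c ^ (t - 1 - s) * d s \<omega>) \<partial>M)"
      unfolding U_def d_def[symmetric]
      by (intro Bochner_Integration.integral_add Bochner_Integration.integrable_sum cd integrable_const)
    also have "(\<integral>\<omega>. (\<Sum>s<t. \<omega>c * \<gamma>c ^ (t - 1 - s) * d s \<omega>) \<partial>M)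
        = (\<Sum>s<t. \<integral>\<omega>. \<omega>c * \<gamma>c ^ (t - 1 - s) * d s \<omega> \<partial>M)"
      by (intro Bochner_Integration.integral_sum cd)
    also have "\<dots> = (\<Sum>s<t. \<omega>c * \<gamma>c ^ (t - 1 - s) * (\<Sum>i=1..N. \<integral>\<omega>. deviation i s \<omega> \<partial>M))"
      by (simp only: integral_mult_right_zero d(2))
    finally show ?thesis by (simp add: prob_space)
  qed
  also have "2 * real N * \<dots> \<le> 2 * real N * (\<omega>c * \<gamma>c ^ t * (\<Sum>j=1..N. norm (x0 j))
    + (\<Sum>s<t. \<omega>c * \<gamma>c ^ (t - 1 - s) * (\<Sum>i=1..N. mean_deviation s)))"
    using \<omega>c \<gamma>c by (intro mult_left_mono add_left_mono sum_mono expectation_deviation_le) auto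
  finally show ?thesis by simp
qed

section \<open>Drift of the expected divergence\<close>

definition lyapunov :: "'a \<Rightarrow> nat \<Rightarrow> real" where
  "lyapunov a t = (\<Sum>i=1..N. \<integral>\<omega>. bregman \<Phi> a (x i t \<omega>) \<partial>M)"

lemma integrable_bregman_x:
  assumes "i \<in> {1..N}"
  shows "integrable M (\<lambda>\<omega>. bregman \<Phi> a (x i t \<omega>))"
proof (rule integrable_continuous_x[OF assms])
  show "continuous_on UNIV (bregman \<Phi> a)"
    using continuous_on_compose2[OF continuous_on_bregman[OF \<Phi>(1), of UNIV], of UNIV "Pair a"]
    by (simp add: continuous_on_Pair)
qed

lemma
  assumes a: "a \<in> X"
  shows lyapunov_nonneg: "0 \<le> lyapunov a t" and lyapunov_le: "lyapunov a t \<le> real N * D\<^sup>2"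
proof -
  have "0 \<le> bregman \<Phi> a z" for z
    using bregman_ge[OF \<Phi>(3), of a z] \<Phi>(2) by (smt (verit) divide_nonneg_nonneg mult_nonneg_nonneg zero_le_power2)
  then show "0 \<le> lyapunov a t" unfolding lyapunov_def by (intro sum_nonneg) simp
  have "(\<integral>\<omega>. bregman \<Phi> a (x i t \<omega>) \<partial>M) \<le> D\<^sup>2" if i: "i \<in> {1..N}" for i
  proof -
    have "(\<integral>\<omega>. bregman \<Phi> a (x i t \<omega>) \<partial>M) \<le> (\<integral>\<omega>. D\<^sup>2 \<partial>M)"
      by (intro integral_mono integrable_bregman_x[OF i] bregman_le_diam[OF \<Phi>(1) X(3) a] x_in i) auto
    then show ?thesis by (simp add: prob_space)
  qed
  then have "lyapunov a t \<le> (\<Sum>i=1..N. D\<^sup>2)" unfolding lyapunov_def by (intro sum_mono)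
  then show "lyapunov a t \<le> real N * D\<^sup>2" by simp
qed

text \<open>All summands are evaluated at the state of one agent \<open>l\<close>. For each
  \<open>i\<close> the loss of \<open>f i\<close> is moved to the query point of \<open>i\<close>,
  where the stochastic subgradient is unbiased. The distance from the query point to the prox step
  of \<open>i\<close> is paid by the extra term of \<open>prox_step\<close>, the distance from there
  to agent \<open>l\<close> by the disagreement. Unit column sums of \<open>P t\<close> turn the
  averaged divergences back into \<open>lyapunov a t\<close>.\<close>

lemma expected_step:
  assumes a: "a \<in> X" and l: "l \<in> {1..N}"
  shows "(\<Sum>i=1..N. \<integral>\<omega>. (f i (x l (Suc t) \<omega>) - f i a + (chi i (x l (Suc t) \<omega>) - chi i a)) \<partial>M)
    \<le> (Gf + Gchi) * (\<Sum>i=1..N. \<integral>\<omega>. norm (x l (Suc t) \<omega> - x i (Suc t) \<omega>) \<partial>M)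
      + (lyapunov a t - lyapunov a (Suc t)) / \<alpha> t
      + real N * (L * (r t)\<^sup>2 * \<nu> + L * r t * (sqrt (2 / \<sigma>) * D) * sqrt \<nu>) / \<alpha> t
      + 2 * real N * Gf\<^sup>2 * \<alpha> t / \<sigma>"
proof -
  define c where "c = sqrt (2 / \<sigma>) * D"
  have c: "0 \<le> c" using D_nonneg \<Phi>(2) by (simp add: c_def)
  define \<beta> where "\<beta> i = (\<integral>\<omega>. bregman \<Phi> a (x i t \<omega>) \<partial>M)" for i
  define K where "K = L * (r t)\<^sup>2 * \<nu> + L * r t * c * sqrt \<nu>"
  have one: "(\<integral>\<omega>. (f i (x l (Suc t) \<omega>) - f i a + (chi i (x l (Suc t) \<omega>) - chi i a)) \<partial>M)
    \<le> (Gf + Gchi) * (\<integral>\<omega>. norm (x l (Suc t) \<omega> - x i (Suc t) \<omega>) \<partial>M)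
      + (mix N (P t) \<beta> i + K - (\<integral>\<omega>. bregman \<Phi> a (x i (Suc t) \<omega>) \<partial>M)) / \<alpha> t
      + 2 * Gf\<^sup>2 * \<alpha> t / \<sigma>" if i: "i \<in> {1..N}" for i
  proof -
    define z where "z = x i (Suc t)"
    define w where "w = x l (Suc t)"
    \<comment> \<open>The minorant for \<open>expectation_inner_gv_ge\<close>. It contains neither
      \<open>g\<close> nor a value of \<open>f i\<close> at the query point, so first moments of the
      states and query points make it integrable.\<close>
    define W where "W \<omega> = f i (w \<omega>) - f i a - Gf * norm (w \<omega> - y i t \<omega>)" for \<omega>
    define I where "I \<omega> = inner (gv i t \<omega>) (y i t \<omega> - a)" for \<omega>
    define d where "d \<omega> = norm (w \<omega> - z \<omega>)" for \<omega>
    define Q where "Q \<omega> = (norm (gv i t \<omega>))\<^sup>2" for \<omega>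
    define R where "R \<omega> = (\<Sum>j=1..N. P t i j * (bregman \<Phi> a (x j t \<omega>)
      + (L * (r t)\<^sup>2 * (norm (\<xi> i j t \<omega>))\<^sup>2 + L * r t * c * norm (\<xi> i j t \<omega>))))" for \<omega>
    define b where "b \<omega> = bregman \<Phi> a (z \<omega>)" for \<omega>
    have [measurable]: "w \<in> borel_measurable M" "y i t \<in> borel_measurable M"
      using l i by (auto simp: w_def)
    have fw: "integrable M (\<lambda>\<omega>. f i (w \<omega>))" and cw: "integrable M (\<lambda>\<omega>. chi i (w \<omega>))"
      unfolding w_def using convex_f[OF i] convex_chi[OF i]
      by (auto intro!: integrable_continuous_x[OF l] convex_on_continuous)
    have y1: "integrable M (\<lambda>\<omega>. norm (y i t \<omega>))"
      by (rule square_integrable_imp_integrable) (use integrable_norm_y_sq[OF i] in auto)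
    have wy: "integrable M (\<lambda>\<omega>. norm (w \<omega> - y i t \<omega>))"
    proof (rule Bochner_Integration.integrable_bound)
      show "integrable M (\<lambda>\<omega>. norm (w \<omega>) + norm (y i t \<omega>))"
        using integrable_norm_x[OF l] y1 by (simp add: w_def)
    qed (auto intro: norm_triangle_ineq4)
    have Wi: "integrable M W" unfolding W_def using fw wy by simp
    have Ii: "integrable M I" unfolding I_def by (rule integrable_inner_gv[OF i])
    have di: "integrable M d" unfolding d_def w_def z_def by (rule integrable_norm_diff_x[OF i l])
    have Qi: "integrable M Q" unfolding Q_def by (rule integrable_gv_sq[OF i])
    have bi: "integrable M b" unfolding b_def z_def by (rule integrable_bregman_x[OF i])
    have Rterm: "integrable M (\<lambda>\<omega>. bregman \<Phi> a (x j t \<omega>)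
      + (L * (r t)\<^sup>2 * (norm (\<xi> i j t \<omega>))\<^sup>2 + L * r t * c * norm (\<xi> i j t \<omega>)))" if j: "j \<in> {1..N}" for j
      by (intro Bochner_Integration.integrable_add integrable_mult_right integrable_bregman_x j
          integrable_\<xi>_sq integrable_\<xi> i)
    have Ri: "integrable M R"
      unfolding R_def by (intro Bochner_Integration.integrable_sum integrable_mult_right Rterm)
    have WI: "(\<integral>\<omega>. W \<omega> \<partial>M) \<le> (\<integral>\<omega>. I \<omega> \<partial>M)"
      unfolding I_def
    proof (rule expectation_inner_gv_ge[OF i Wi])
      have "AE \<omega> in M. g i (y i t \<omega>) \<in> subdiff (f i) (y i t \<omega>)"
        using subgradients i by (simp add: stochastic_subgradient_assumption_def)
      then show "AE \<omega> in M. W \<omega> \<le> inner (g i (y i t \<omega>)) (y i t \<omega> - a)"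
      proof (rule AE_mp, intro AE_I2 impI)
        fix \<omega> assume \<omega>: "\<omega> \<in> space M" and sd: "g i (y i t \<omega>) \<in> subdiff (f i) (y i t \<omega>)"
        have "f i (w \<omega>) - f i (y i t \<omega>) \<le> Gf * norm (w \<omega> - y i t \<omega>)"
          unfolding w_def by (rule f_lipschitz[OF i x_in[OF \<omega> l]])
        then show "W \<omega> \<le> inner (g i (y i t \<omega>)) (y i t \<omega> - a)"
          using subdiffD[OF sd, of a] by (simp add: W_def)
      qed
    qed
    have QI: "(\<integral>\<omega>. Q \<omega> \<partial>M) \<le> Gf\<^sup>2" unfolding Q_def by (rule gv_sq_le[OF i])
    have RI: "(\<integral>\<omega>. R \<omega> \<partial>M) \<le> mix N (P t) \<beta> i + K"
    proof -
      have "(\<integral>\<omega>. R \<omega> \<partial>M) = (\<Sum>j=1..N. P t i j * (\<integral>\<omega>. (bregman \<Phi> a (x j t \<omega>)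
      + (L * (r t)\<^sup>2 * (norm (\<xi> i j t \<omega>))\<^sup>2 + L * r t * c * norm (\<xi> i j t \<omega>))) \<partial>M))"
        unfolding R_def using Rterm by (subst Bochner_Integration.integral_sum) auto
      also have "\<dots> \<le> (\<Sum>j=1..N. P t i j * (\<beta> j + K))"
      proof (intro sum_mono mult_left_mono)
        fix j assume j: "j \<in> {1..N}"
        have "(\<integral>\<omega>. (bregman \<Phi> a (x j t \<omega>)
            + (L * (r t)\<^sup>2 * (norm (\<xi> i j t \<omega>))\<^sup>2 + L * r t * c * norm (\<xi> i j t \<omega>))) \<partial>M)
          = \<beta> j + (L * (r t)\<^sup>2 * (\<integral>\<omega>. (norm (\<xi> i j t \<omega>))\<^sup>2 \<partial>M) + L * r t * c * (\<integral>\<omega>. norm (\<xi> i j t \<omega>) \<partial>M))"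
          using integrable_bregman_x[OF j] integrable_\<xi>_sq[OF i j] integrable_\<xi>[OF i j] by (simp add: \<beta>_def)
        also have "\<dots> \<le> \<beta> j + K"
          unfolding K_def using L_nonneg r_nonneg[of t] c \<xi>_sq_le[OF i j] \<xi>_le[OF i j]
          by (intro add_left_mono add_mono mult_left_mono) auto
        finally show "(\<integral>\<omega>. (bregman \<Phi> a (x j t \<omega>)
            + (L * (r t)\<^sup>2 * (norm (\<xi> i j t \<omega>))\<^sup>2 + L * r t * c * norm (\<xi> i j t \<omega>))) \<partial>M) \<le> \<beta> j + K" .
      qed (use P_nonneg[OF i] in auto)
      also have "\<dots> = mix N (P t) \<beta> i + K"
        using P_row_sum[OF i] by (simp add: mix_def distrib_left sum.distrib flip: sum_distrib_right)
      finally show ?thesis .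
    qed
    have path: "f i (w \<omega>) - f i a + (chi i (w \<omega>) - chi i a)
        \<le> W \<omega> - I \<omega> + (Gf + Gchi) * d \<omega> + (R \<omega> - b \<omega>) / \<alpha> t + \<alpha> t / \<sigma> * (Q \<omega> + Gf\<^sup>2)"
      if \<omega>: "\<omega> \<in> space M" for \<omega>
    proof -
      have "chi i (z \<omega>) - chi i a + I \<omega> + Gf * norm (z \<omega> - y i t \<omega>)
          \<le> (bregman \<Phi> a (y i t \<omega>) - b \<omega>) / \<alpha> t + \<alpha> t / \<sigma> * (Q \<omega> + Gf\<^sup>2)"
        unfolding z_def I_def b_def Q_def by (rule prox_step[OF \<omega> i a])
      moreover have "(bregman \<Phi> a (y i t \<omega>) - b \<omega>) / \<alpha> t \<le> (R \<omega> - b \<omega>) / \<alpha> t"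
        using bregman_noisy_mix_le[OF \<omega> i a, of t] \<alpha>_pos[of t]
        by (intro divide_right_mono diff_right_mono) (simp_all add: R_def c_def)
      moreover have "chi i (w \<omega>) - chi i (z \<omega>) \<le> Gchi * d \<omega>"
        unfolding d_def w_def by (rule chi_lipschitz[OF i x_in[OF \<omega> l]])
      moreover have "Gf * norm (w \<omega> - y i t \<omega>) \<le> Gf * d \<omega> + Gf * norm (z \<omega> - y i t \<omega>)"
        using Gf_nonneg norm_triangle_ineq[of "w \<omega> - z \<omega>" "z \<omega> - y i t \<omega>"]
          mult_left_mono[of "norm (w \<omega> - y i t \<omega>)" "d \<omega> + norm (z \<omega> - y i t \<omega>)" Gf]
        by (simp add: d_def distrib_left)
      ultimately show ?thesis by (simp add: W_def distrib_right)
    qed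
    have "(\<integral>\<omega>. (f i (w \<omega>) - f i a + (chi i (w \<omega>) - chi i a)) \<partial>M)
      \<le> (\<integral>\<omega>. W \<omega> - I \<omega> + (Gf + Gchi) * d \<omega> + (R \<omega> - b \<omega>) / \<alpha> t + \<alpha> t / \<sigma> * (Q \<omega> + Gf\<^sup>2) \<partial>M)"
      by (rule integral_mono) (use fw cw Wi Ii di Qi Ri bi path in auto)
    also have "\<dots> = (\<integral>\<omega>. W \<omega> \<partial>M) - (\<integral>\<omega>. I \<omega> \<partial>M) + (Gf + Gchi) * (\<integral>\<omega>. d \<omega> \<partial>M)
      + ((\<integral>\<omega>. R \<omega> \<partial>M) - (\<integral>\<omega>. b \<omega> \<partial>M)) / \<alpha> t + \<alpha> t / \<sigma> * ((\<integral>\<omega>. Q \<omega> \<partial>M) + Gf\<^sup>2)"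
      using Wi Ii di Qi Ri bi by (simp add: prob_space)
    also have "\<dots> \<le> (Gf + Gchi) * (\<integral>\<omega>. d \<omega> \<partial>M)
      + (mix N (P t) \<beta> i + K - (\<integral>\<omega>. b \<omega> \<partial>M)) / \<alpha> t + \<alpha> t / \<sigma> * (Gf\<^sup>2 + Gf\<^sup>2)"
    proof -
      have "((\<integral>\<omega>. R \<omega> \<partial>M) - (\<integral>\<omega>. b \<omega> \<partial>M)) / \<alpha> t \<le> (mix N (P t) \<beta> i + K - (\<integral>\<omega>. b \<omega> \<partial>M)) / \<alpha> t"
        using RI \<alpha>_pos[of t] by (intro divide_right_mono) auto
      moreover have "\<alpha> t / \<sigma> * ((\<integral>\<omega>. Q \<omega> \<partial>M) + Gf\<^sup>2) \<le> \<alpha> t / \<sigma> * (Gf\<^sup>2 + Gf\<^sup>2)"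
        using QI \<alpha>_pos[of t] \<Phi>(2) by (intro mult_left_mono) auto
      ultimately show ?thesis using WI by linarith
    qed
    finally show ?thesis by (simp add: d_def w_def z_def b_def mult.commute)
  qed
  have "(\<Sum>i=1..N. \<integral>\<omega>. (f i (x l (Suc t) \<omega>) - f i a + (chi i (x l (Suc t) \<omega>) - chi i a)) \<partial>M)
    \<le> (\<Sum>i=1..N. (Gf + Gchi) * (\<integral>\<omega>. norm (x l (Suc t) \<omega> - x i (Suc t) \<omega>) \<partial>M)
      + (mix N (P t) \<beta> i + K - (\<integral>\<omega>. bregman \<Phi> a (x i (Suc t) \<omega>) \<partial>M)) / \<alpha> t
      + 2 * Gf\<^sup>2 * \<alpha> t / \<sigma>)"
    by (intro sum_mono one)
  also have "\<dots> = (Gf + Gchi) * (\<Sum>i=1..N. \<integral>\<omega>. norm (x l (Suc t) \<omega> - x i (Suc t) \<omega>) \<partial>M)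
      + ((\<Sum>i=1..N. mix N (P t) \<beta> i) + real N * K - lyapunov a (Suc t)) / \<alpha> t + real N * (2 * Gf\<^sup>2 * \<alpha> t / \<sigma>)"
    unfolding lyapunov_def
    by (simp add: sum.distrib sum_subtractf sum_distrib_left flip: sum_divide_distrib)
  also have "(\<Sum>i=1..N. mix N (P t) \<beta> i) = lyapunov a t"
    unfolding sum_mix[OF ds] by (simp add: \<beta>_def lyapunov_def)
  finally show ?thesis by (simp add: K_def c_def add_divide_distrib diff_divide_distrib mult_ac)
qed

section \<open>Averaged iterates and their expected regret\<close>

definition average :: "nat \<Rightarrow> nat \<Rightarrow> 'w \<Rightarrow> 'a" where
  "average l T \<omega> = (1 / real T) *\<^sub>R (\<Sum>t=1..T. x l t \<omega>)"

abbreviation objective :: "'a \<Rightarrow> real" where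
  "objective z \<equiv> (\<Sum>i=1..N. (f i z + chi i z))"

lemma average_eq: "average l T \<omega> = (\<Sum>t<T. (1 / real T) *\<^sub>R x l (Suc t) \<omega>)"
  unfolding average_def by (simp add: scaleR_sum_right sum.atLeast1_atMost_eq)

lemma average_in:
  assumes \<omega>: "\<omega> \<in> space M" and l: "l \<in> {1..N}" and T: "T \<ge> 1"
  shows "average l T \<omega> \<in> X"
  unfolding average_eq using X(2) x_in[OF \<omega> l] T by (intro convex_sum) auto

lemma average_measurable: "l \<in> {1..N} \<Longrightarrow> average l T \<in> borel_measurable M"
  unfolding average_def by measurable

lemma objective_diff_le:
  assumes "z \<in> X" "a \<in> X"
  shows "objective z - objective a \<le> real N * ((Gf + Gchi) * (sqrt (2 / \<sigma>) * D))"
proof -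
  have "objective z - objective a = (\<Sum>i=1..N. (f i z - f i a) + (chi i z - chi i a))"
    by (simp add: sum.distrib sum_subtractf)
  also have "\<dots> \<le> (\<Sum>i=1..N. (Gf + Gchi) * (sqrt (2 / \<sigma>) * D))"
  proof (rule sum_mono)
    fix i assume i: "i \<in> {1..N}"
    have "(f i z - f i a) + (chi i z - chi i a) \<le> (Gf + Gchi) * norm (z - a)"
      using f_lipschitz[OF i assms(1), of a] chi_lipschitz[OF i assms(1), of a] by (simp add: distrib_right)
    also have "\<dots> \<le> (Gf + Gchi) * (sqrt (2 / \<sigma>) * D)"
      using norm_le_bregman_diam[OF \<Phi>(1) X(3) assms \<Phi>(3,2)] Gf_nonneg Gchi_nonneg by (intro mult_left_mono) auto
    finally show "(f i z - f i a) + (chi i z - chi i a) \<le> (Gf + Gchi) * (sqrt (2 / \<sigma>) * D)" .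
  qed
  finally show ?thesis by simp
qed

lemma continuous_on_objective: "continuous_on UNIV objective"
proof (rule continuous_on_sum)
  fix i assume i: "i \<in> {1..N}"
  show "continuous_on UNIV (\<lambda>z. f i z + chi i z)"
    using convex_f[OF i] convex_chi[OF i] by (intro continuous_on_add convex_on_continuous) auto
qed

lemma integrable_objective_average:
  assumes "l \<in> {1..N}" "T \<ge> 1"
  shows "integrable M (\<lambda>\<omega>. objective (average l T \<omega>))"
  by (rule integrable_continuous_in_X[OF average_measurable[OF assms(1)] average_in[OF _ assms] continuous_on_objective])

text \<open>The estimate by the oscillation of the objective on \<open>X\<close>. It serves as the
  alternative when the noise surplus cannot be absorbed.\<close>

lemma expected_gap_le_diam:
  assumes l: "l \<in> {1..N}" and T: "T \<ge> 1" and a: "a \<in> X"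
  shows "(\<integral>\<omega>. objective (average l T \<omega>) \<partial>M) - objective a \<le> real N * ((Gf + Gchi) * (sqrt (2 / \<sigma>) * D))"
proof -
  have "(\<integral>\<omega>. objective (average l T \<omega>) \<partial>M) \<le> (\<integral>\<omega>. objective a + real N * ((Gf + Gchi) * (sqrt (2 / \<sigma>) * D)) \<partial>M)"
  proof (rule integral_mono)
    fix \<omega> assume "\<omega> \<in> space M"
    then show "objective (average l T \<omega>) \<le> objective a + real N * ((Gf + Gchi) * (sqrt (2 / \<sigma>) * D))"
      using objective_diff_le[OF average_in[OF _ l T] a] by fastforce
  qed (use integrable_objective_average[OF l T] in auto)
  then show ?thesis by (simp add: prob_space)
qed

lemma expected_gap_le_regret:
  assumes l: "l \<in> {1..N}" and T: "T \<ge> 1"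
  shows "(\<integral>\<omega>. objective (average l T \<omega>) \<partial>M) - objective a
    \<le> (\<Sum>t<T. \<Sum>i=1..N. \<integral>\<omega>. (f i (x l (Suc t) \<omega>) - f i a + (chi i (x l (Suc t) \<omega>) - chi i a)) \<partial>M) / real T"
proof -
  define h where "h t i \<omega> = f i (x l (Suc t) \<omega>) - f i a + (chi i (x l (Suc t) \<omega>) - chi i a)" for t i \<omega>
  have hi: "integrable M (h t i)" if i: "i \<in> {1..N}" for t i
    unfolding h_def
    using integrable_continuous_x[OF l convex_on_continuous[OF open_UNIV convex_f[OF i]]]
      integrable_continuous_x[OF l convex_on_continuous[OF open_UNIV convex_chi[OF i]]]
    by simp
  have path: "objective (average l T \<omega>) - objective a \<le> (\<Sum>t<T. \<Sum>i=1..N. h t i \<omega>) / real T" for \<omega>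
  proof -
    have avg: "k (average l T \<omega>) - k a \<le> (\<Sum>t<T. k (x l (Suc t) \<omega>) - k a) / real T"
      if k: "convex_on UNIV k" for k
    proof -
      have "k (average l T \<omega>) \<le> (\<Sum>t<T. 1 / real T * k (x l (Suc t) \<omega>))"
        unfolding average_eq using T by (intro convex_on_sum[OF _ _ k]) (auto simp: lessThan_empty_iff)
      also have "\<dots> = (\<Sum>t<T. k (x l (Suc t) \<omega>) - k a) / real T + k a"
        using T by (simp add: sum_subtractf sum_divide_distrib[symmetric] diff_divide_distrib)
      finally show ?thesis by simp
    qed
    have "objective (average l T \<omega>) - objective a
        = (\<Sum>i=1..N. (f i (average l T \<omega>) - f i a) + (chi i (average l T \<omega>) - chi i a))"
      by (simp add: sum.distrib sum_subtractf)
    also have "\<dots> \<le> (\<Sum>i=1..N. (\<Sum>t<T. f i (x l (Suc t) \<omega>) - f i a) / real T + (\<Sum>t<T. chi i (x l (Suc t) \<omega>) - chi i a) / real T)"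
      by (intro sum_mono add_mono avg convex_f convex_chi)
    also have "\<dots> = (\<Sum>i=1..N. \<Sum>t<T. h t i \<omega>) / real T"
      by (simp add: h_def sum.distrib add_divide_distrib sum_divide_distrib)
    also have "(\<Sum>i=1..N. \<Sum>t<T. h t i \<omega>) = (\<Sum>t<T. \<Sum>i=1..N. h t i \<omega>)" by (rule sum.swap)
    finally show ?thesis .
  qed
  have "(\<integral>\<omega>. objective (average l T \<omega>) \<partial>M) - objective a = (\<integral>\<omega>. objective (average l T \<omega>) - objective a \<partial>M)"
    using integrable_objective_average[OF l T] by (simp add: prob_space)
  also have "\<dots> \<le> (\<integral>\<omega>. (\<Sum>t<T. \<Sum>i=1..N. h t i \<omega>) / real T \<partial>M)"
    using path integrable_objective_average[OF l T]
    by (intro integral_mono integrable_divide Bochner_Integration.integrable_sum hi) auto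
  also have "\<dots> = (\<integral>\<omega>. (\<Sum>t<T. \<Sum>i=1..N. h t i \<omega>) \<partial>M) / real T" by simp
  also have "(\<integral>\<omega>. (\<Sum>t<T. \<Sum>i=1..N. h t i \<omega>) \<partial>M) = (\<Sum>t<T. \<integral>\<omega>. (\<Sum>i=1..N. h t i \<omega>) \<partial>M)"
    by (intro Bochner_Integration.integral_sum Bochner_Integration.integrable_sum hi)
  also have "\<dots> = (\<Sum>t<T. \<Sum>i=1..N. \<integral>\<omega>. h t i \<omega> \<partial>M)"
    by (intro sum.cong refl Bochner_Integration.integral_sum hi)
  finally show ?thesis by (simp only: h_def)
qed

text \<open>The divergences, weighted by the increasing \<open>1 / \<alpha> t\<close>, telescope up
  to \<open>sqrt (real T)\<close> times their upper bound. The disagreement is a geometric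
  convolution of \<open>mean_deviation\<close>, whose sum costs the factor
  \<open>1 / (1 - \<gamma>c)\<close>.\<close>

lemma regret_le:
  assumes a: "a \<in> X" and l: "l \<in> {1..N}" and \<alpha>: "\<And>t. \<alpha> t = 1 / sqrt (real t + 1)"
  shows "(\<Sum>t<T. \<Sum>i=1..N. \<integral>\<omega>. (f i (x l (Suc t) \<omega>) - f i a + (chi i (x l (Suc t) \<omega>) - chi i a)) \<partial>M)
    \<le> (Gf + Gchi) * (2 * real N * (\<omega>c / (1 - \<gamma>c)) * ((\<Sum>j=1..N. norm (x0 j)) + real N * (\<Sum>t<T. mean_deviation t)))
      + sqrt (real T) * (real N * D\<^sup>2)
      + real N * L * \<nu> * (\<Sum>t<T. (r t)\<^sup>2 / \<alpha> t)
      + real N * L * (sqrt (2 / \<sigma>) * D) * sqrt \<nu> * (\<Sum>t<T. r t / \<alpha> t)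
      + 2 * real N * Gf\<^sup>2 / \<sigma> * (\<Sum>t<T. \<alpha> t)"
proof -
  define H where "H = (\<Sum>j=1..N. norm (x0 j))"
  define \<gamma> where "\<gamma> = \<gamma>c"
  have H: "0 \<le> H" by (simp add: H_def sum_nonneg)
  have \<omega>c: "0 \<le> \<omega>c" using omega_const_ge_1[OF network N] by simp
  have \<gamma>: "0 \<le> \<gamma>" "\<gamma> < 1" using gamma_const_bounds[OF network N] by (simp_all add: \<gamma>_def)
  define d where "d t = (\<Sum>i=1..N. \<integral>\<omega>. norm (x l (Suc t) \<omega> - x i (Suc t) \<omega>) \<partial>M)" for t
  have dis: "(\<Sum>t<T. d t) \<le> 2 * real N * (\<omega>c / (1 - \<gamma>)) * (H + real N * (\<Sum>t<T. mean_deviation t))"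
  proof -
    have "(\<Sum>t<T. d t) \<le> (\<Sum>t<T. 2 * real N * (\<omega>c * (\<gamma> ^ t * H) + \<omega>c * (real N * (\<Sum>s<Suc t. \<gamma> ^ (t - s) * mean_deviation s))))"
    proof (rule sum_mono)
      fix t
      have "d t \<le> 2 * real N * (\<omega>c * \<gamma> ^ Suc t * H + (\<Sum>s<Suc t. \<omega>c * \<gamma> ^ (Suc t - 1 - s) * (real N * mean_deviation s)))"
        unfolding d_def H_def \<gamma>_def by (rule expectation_disagreement_le[OF l])
      also have "(\<Sum>s<Suc t. \<omega>c * \<gamma> ^ (Suc t - 1 - s) * (real N * mean_deviation s))
          = \<omega>c * (real N * (\<Sum>s<Suc t. \<gamma> ^ (t - s) * mean_deviation s))"
        unfolding sum_distrib_left by (simp add: mult_ac)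
      \<comment> \<open>One factor \<open>\<gamma>\<close> is given away so that the initial states
        contribute a geometric series starting at 1.\<close>
      also have "\<omega>c * \<gamma> ^ Suc t * H \<le> \<omega>c * (\<gamma> ^ t * H)"
        using \<omega>c H \<gamma> by (simp add: mult.assoc mult_left_mono mult_right_mono mult_left_le_one_le)
      finally show "d t \<le> 2 * real N * (\<omega>c * (\<gamma> ^ t * H) + \<omega>c * (real N * (\<Sum>s<Suc t. \<gamma> ^ (t - s) * mean_deviation s)))"
        by (simp add: mult_left_mono)
    qed
    also have "\<dots> = 2 * real N * \<omega>c * ((\<Sum>t<T. \<gamma> ^ t) * H + real N * (\<Sum>t<T. \<Sum>s<Suc t. \<gamma> ^ (t - s) * mean_deviation s))"
      by (simp only: sum_distrib_left sum_distrib_right distrib_left sum.distrib mult_ac)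
    also have "\<dots> \<le> 2 * real N * \<omega>c * (1 / (1 - \<gamma>) * H + real N * ((\<Sum>t<T. mean_deviation t) / (1 - \<gamma>)))"
    proof (intro mult_left_mono add_mono mult_right_mono)
      have "(1 - \<gamma>) * (\<Sum>t<T. \<gamma> ^ t) \<le> 1" 
        using one_diff_power_eq[of \<gamma> T] zero_le_power[OF \<gamma>(1), of T] by linarith
      then show "(\<Sum>t<T. \<gamma> ^ t) \<le> 1 / (1 - \<gamma>)" using \<gamma> by (simp add: pos_le_divide_eq mult.commute)
      show "(\<Sum>t<T. \<Sum>s<Suc t. \<gamma> ^ (t - s) * mean_deviation s) \<le> (\<Sum>t<T. mean_deviation t) / (1 - \<gamma>)"
        by (rule sum_convolution_geometric_le[OF \<gamma> mean_deviation_nonneg])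
    qed (use H \<omega>c in auto)
    also have "\<dots> = 2 * real N * (\<omega>c / (1 - \<gamma>)) * (H + real N * (\<Sum>t<T. mean_deviation t))"
      by (simp add: divide_inverse algebra_simps)
    finally show ?thesis .
  qed
  have tel: "(\<Sum>t<T. (lyapunov a t - lyapunov a (Suc t)) / \<alpha> t) \<le> sqrt (real T) * (real N * D\<^sup>2)"
    using sum_sqrt_weighted_telescope_le[of "lyapunov a" "real N * D\<^sup>2" T] lyapunov_nonneg[OF a] lyapunov_le[OF a]
    by (simp add: \<alpha> mult.commute)
  have "(\<Sum>t<T. \<Sum>i=1..N. \<integral>\<omega>. (f i (x l (Suc t) \<omega>) - f i a + (chi i (x l (Suc t) \<omega>) - chi i a)) \<partial>M)
    \<le> (\<Sum>t<T. (Gf + Gchi) * d t + (lyapunov a t - lyapunov a (Suc t)) / \<alpha> t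
      + real N * (L * (r t)\<^sup>2 * \<nu> + L * r t * (sqrt (2 / \<sigma>) * D) * sqrt \<nu>) / \<alpha> t
      + 2 * real N * Gf\<^sup>2 * \<alpha> t / \<sigma>)"
    unfolding d_def by (intro sum_mono expected_step[OF a l])
  also have "\<dots> = (Gf + Gchi) * (\<Sum>t<T. d t) + (\<Sum>t<T. (lyapunov a t - lyapunov a (Suc t)) / \<alpha> t)
      + (\<Sum>t<T. real N * L * \<nu> * ((r t)\<^sup>2 / \<alpha> t) + real N * L * (sqrt (2 / \<sigma>) * D) * sqrt \<nu> * (r t / \<alpha> t))
      + (\<Sum>t<T. 2 * real N * Gf\<^sup>2 / \<sigma> * \<alpha> t)"
    by (simp add: sum.distrib sum_distrib_left add_divide_distrib distrib_left mult_ac)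
  also have "\<dots> = (Gf + Gchi) * (\<Sum>t<T. d t) + (\<Sum>t<T. (lyapunov a t - lyapunov a (Suc t)) / \<alpha> t)
      + (real N * L * \<nu> * (\<Sum>t<T. (r t)\<^sup>2 / \<alpha> t) + real N * L * (sqrt (2 / \<sigma>) * D) * sqrt \<nu> * (\<Sum>t<T. r t / \<alpha> t))
      + 2 * real N * Gf\<^sup>2 / \<sigma> * (\<Sum>t<T. \<alpha> t)"
    by (simp only: sum.distrib sum_distrib_left)
  also have "(Gf + Gchi) * (\<Sum>t<T. d t)
      \<le> (Gf + Gchi) * (2 * real N * (\<omega>c / (1 - \<gamma>)) * (H + real N * (\<Sum>t<T. mean_deviation t)))"
    using dis Gf_nonneg Gchi_nonneg by (intro mult_left_mono) auto
  finally show ?thesis using tel by (simp add: \<gamma>_def H_def)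
qed

end

section \<open>Convergence rate\<close>

lemma sum_inverse_powr_le:
  fixes p :: real
  assumes p: "0 \<le> p" "p < 1"
  shows "(\<Sum>t<T. 1 / (real t + 1) powr p) \<le> real T powr (1 - p) / (1 - p)"
proof (induction T)
  case 0
  show ?case by simp
next
  case (Suc T)
  define w where "w = (real T + 1) powr p"
  have w: "w > 0" by (simp add: w_def)
  \<comment> \<open>Young's inequality in place of an integral comparison: with weights
    \<open>1 - p\<close> and \<open>p\<close>, the numbers \<open>T\<close> and \<open>T + 1\<close>
    have arithmetic mean \<open>T + p\<close>.\<close>
  have "real T powr (1 - p) * w \<le> real T + p"
  proof (cases "T = 0")
    case True
    then show ?thesis using p by simp
  next
    case False
    then show ?thesis
      using Youngs_inequality_0[of "1 - p" p "real T" "real T + 1"] p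
      by (simp add: w_def algebra_simps)
  qed
  then have a: "real T powr (1 - p) \<le> (real T + p) / w"
    using w by (simp add: pos_le_divide_eq)
  have b: "(real T + 1) powr (1 - p) = (real T + 1) / w"
    by (simp add: powr_diff w_def)
  have "1 / w * (1 - p) \<le> (real T + 1) powr (1 - p) - real T powr (1 - p)"
    using a unfolding b by (simp add: diff_divide_distrib add_divide_distrib algebra_simps)
  then have "1 / w \<le> ((real T + 1) powr (1 - p) - real T powr (1 - p)) / (1 - p)"
    using p by (simp add: pos_le_divide_eq)
  then show ?case
    using Suc.IH by (simp add: w_def diff_divide_distrib add.commute)
qed

text \<open>The first summand is kept apart, since the difference estimate for the tail needs a
  positive base: \<open>p / (p - 1)\<close> is \<open>1 + 1 / (p - 1)\<close>.\<close>

lemma sum_inverse_powr_le_of_gt_one: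
  fixes p :: real
  assumes p: "1 < p"
  shows "(\<Sum>t<T. 1 / (real t + 1) powr p) \<le> p / (p - 1)"
proof -
  have step: "1 / (n + 1) powr p \<le> (n powr (1 - p) - (n + 1) powr (1 - p)) / (p - 1)"
    if n: "n > 0" for n :: real
  proof -
    \<comment> \<open>Chosen so that the geometric mean of \<open>Y\<close> and \<open>n\<close>
      with weights \<open>1 / p\<close> and \<open>1 - 1 / p\<close> is exactly
      \<open>n + 1\<close>.\<close>
    define Y where "Y = n powr (1 - p) * (n + 1) powr p"
    define w where "w = (n + 1) powr p"
    have w: "w > 0" and Y: "Y > 0" using n by (simp_all add: w_def Y_def)
    have "Y powr (1 / p) * n powr (1 - 1 / p) = n powr ((1 - p) / p + (1 - 1 / p)) * (n + 1)"
      using n p by (simp add: Y_def powr_mult powr_powr powr_add)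
    also have "(1 - p) / p + (1 - 1 / p) = 0" using p by (simp add: field_simps)
    finally have "n + 1 \<le> (1 / p) * Y + (1 - 1 / p) * n"
      using Youngs_inequality_0[of "1 / p" "1 - 1 / p" Y n] n p Y by simp
    then have "p * (n + 1) \<le> p * ((1 / p) * Y + (1 - 1 / p) * n)"
      using p by (intro mult_left_mono) auto
    then have "n + p \<le> Y" using p by (simp add: algebra_simps)
    then have a: "(n + p) / w \<le> n powr (1 - p)"
      using w by (simp add: Y_def w_def pos_divide_le_eq)
    have b: "(n + 1) powr (1 - p) = (n + 1) / w" using n by (simp add: powr_diff w_def)
    have "1 / w * (p - 1) \<le> n powr (1 - p) - (n + 1) powr (1 - p)"
      using a unfolding b by (simp add: diff_divide_distrib add_divide_distrib algebra_simps)
    then show ?thesis using p by (simp add: pos_le_divide_eq w_def)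
  qed
  have "(\<Sum>t<Suc n. 1 / (real t + 1) powr p) \<le> p / (p - 1) - (real n + 1) powr (1 - p) / (p - 1)" for n
  proof (induction n)
    case 0
    show ?case using p by (simp add: diff_divide_distrib[symmetric])
  next
    case (Suc n)
    show ?case using Suc.IH step[of "real n + 1"] by (simp add: diff_divide_distrib add.commute)
  qed
  moreover have "0 \<le> (real n + 1) powr (1 - p) / (p - 1)" for n using p by simp
  ultimately have "(\<Sum>t<Suc n. 1 / (real t + 1) powr p) \<le> p / (p - 1)" for n
    by (smt (verit))
  moreover have "0 \<le> p / (p - 1)" using p by simp
  ultimately show ?thesis by (cases T) auto
qed

lemma sum_inverse_sqrt_le: "(\<Sum>t<T. 1 / sqrt (real t + 1)) \<le> 2 * sqrt (real T)"
  using sum_inverse_powr_le[of "1/2" T] by (simp add: powr_half_sqrt)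

text \<open>One bound for the sum has the right order in \<open>T\<close> but carries
  \<open>1 / (1 - \<kappa>)\<close>; another loses \<open>sqrt (real T)\<close> but is uniform in
  \<open>\<kappa>\<close>. Their product contains \<open>1 / (1 - \<kappa>)\<close> only once, which
  is as much as the term with \<open>C4\<close> can cancel.\<close>

lemma sum_noise_radius_le:
  fixes \<kappa> :: real
  assumes \<kappa>: "1/2 < \<kappa>" "\<kappa> < 1"
  shows "(1 - \<kappa>) * (\<Sum>t<T. 1 / (real t + 1) powr \<kappa>)\<^sup>2 \<le> 2 * real T powr (5/2 - 2 * \<kappa>)"
proof (cases "T = 0")
  case False
  define S where "S = (\<Sum>t<T. 1 / (real t + 1) powr \<kappa>)"
  have T: "0 < real T" using False by simp
  have S0: "0 \<le> S" by (simp add: S_def sum_nonneg)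
  have "S \<le> real T powr (1 - \<kappa>) / (1 - \<kappa>)" unfolding S_def using \<kappa> by (intro sum_inverse_powr_le) auto
  then have 1: "(1 - \<kappa>) * S \<le> real T powr (1 - \<kappa>)" using \<kappa> by (simp add: pos_le_divide_eq mult.commute)
  have "S \<le> (\<Sum>t<T. real T powr (1 - \<kappa>) * (1 / sqrt (real t + 1)))"
    unfolding S_def
  proof (rule sum_mono)
    fix t assume "t \<in> {..<T}"
    then have t: "real t + 1 \<le> real T" by simp
    have "1 / (real t + 1) powr \<kappa> = (real t + 1) powr (1 - \<kappa>) * (1 / (real t + 1))"
      by (simp add: powr_diff)
    also have "\<dots> \<le> real T powr (1 - \<kappa>) * (1 / sqrt (real t + 1))"
    proof (intro mult_mono powr_mono2)
      have "sqrt (real t + 1) * 1 \<le> sqrt (real t + 1) * sqrt (real t + 1)" by (intro mult_left_mono) auto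
      then have "sqrt (real t + 1) \<le> real t + 1" by simp
      then show "1 / (real t + 1) \<le> 1 / sqrt (real t + 1)" by (intro divide_left_mono) auto
    qed (use t \<kappa> in auto)
    finally show "1 / (real t + 1) powr \<kappa> \<le> real T powr (1 - \<kappa>) * (1 / sqrt (real t + 1))" .
  qed
  also have "\<dots> \<le> real T powr (1 - \<kappa>) * (2 * sqrt (real T))"
    unfolding sum_distrib_left[symmetric] by (intro mult_left_mono sum_inverse_sqrt_le) auto
  finally have 2: "S \<le> real T powr (1 - \<kappa>) * (2 * sqrt (real T))" .
  have "(1 - \<kappa>) * S\<^sup>2 = ((1 - \<kappa>) * S) * S" by (simp add: power2_eq_square)
  also have "\<dots> \<le> real T powr (1 - \<kappa>) * (real T powr (1 - \<kappa>) * (2 * sqrt (real T)))"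
    using 1 2 S0 \<kappa> by (intro mult_mono) auto
  also have "\<dots> = 2 * real T powr ((1 - \<kappa>) + (1 - \<kappa>) + 1/2)"
    using T by (simp only: powr_add powr_half_sqrt mult_ac)
  finally show ?thesis by (simp add: S_def)
qed simp

text \<open>The assumptions \<open>q3\<close>, \<open>q4\<close>, \<open>q5\<close> bound \<open>C_kappa\<close> from below by its terms with \<open>C3\<close>, \<open>C4\<close>, \<open>C5\<close>;
  \<open>nontrivial\<close> says that the claimed bound is smaller than the oscillation of the objective on \<open>X\<close>.\<close>

lemma noise_consensus_budget:
  fixes n K G L \<nu> \<sigma> D \<kappa> Q :: real
  assumes n: "1 \<le> n" and nonneg: "0 \<le> K" "0 \<le> G" "0 \<le> L" "0 \<le> \<nu>" "0 \<le> D" "0 \<le> Q" and \<sigma>: "0 < \<sigma>"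
    and \<kappa>: "1/2 < \<kappa>" "\<kappa> < 1" and T: "1 \<le> T"
    and q3: "4 * sqrt 2 * n ^ 3 * (K * G\<^sup>2 / \<sigma>) \<le> Q"
    and q4: "2 * n ^ 4 * (K * G * sqrt \<nu>) \<le> Q * (1 - \<kappa>)"
    and q5: "sqrt 2 * n * (D * L * sqrt \<nu> / sqrt \<sigma>) \<le> Q"
    and nontrivial: "5 * Q < n * (G * (sqrt (2 / \<sigma>) * D)) * real T powr (\<kappa> - 1/2)"
  shows "2 * n\<^sup>2 * K * G * sqrt (2 * L / \<sigma>) * sqrt \<nu> * (\<Sum>t<T. 1 / (real t + 1) powr \<kappa>)
    \<le> 11/20 * (Q * real T powr (3/2 - \<kappa>))"
proof -
  define \<tau> where "\<tau> = G * D / sqrt \<sigma>"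
  define \<theta> where "\<theta> = real T powr (\<kappa> - 1/2)"
  define b where "b = 2 * n\<^sup>2 * K * G * sqrt (2 * L / \<sigma>) * sqrt \<nu>"
  define S where "S = (\<Sum>t<T. 1 / (real t + 1) powr \<kappa>)"
  have T0: "0 < real T" using T by simp
  have \<theta>: "0 < \<theta>" using T0 by (simp add: \<theta>_def)
  have \<tau>0: "0 \<le> \<tau>" using nonneg \<sigma> by (simp add: \<tau>_def)
  have b0: "0 \<le> b" using nonneg n \<sigma> by (simp add: b_def)
  have S0: "0 \<le> S" by (simp add: S_def sum_nonneg)
  have nt: "5 * Q < sqrt 2 * n * \<tau> * \<theta>"
    using nontrivial \<sigma> by (simp add: \<tau>_def \<theta>_def real_sqrt_divide mult_ac)
  have \<tau>: "0 < \<tau>"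
  proof (rule ccontr)
    assume "\<not> 0 < \<tau>"
    then have "\<tau> = 0" using \<tau>0 by simp
    then show False using nt nonneg by simp
  qed
  have bsq: "b\<^sup>2 = 8 * n ^ 4 * (K\<^sup>2 * G\<^sup>2 * L * \<nu> / \<sigma>)"
    using nonneg \<sigma> by (simp add: b_def power_mult_distrib)
  \<comment> \<open>The product of the three quantities contains \<open>L * \<nu> / \<sigma>\<close>
    to the first power, just as the square of \<open>b\<close> does; the remaining factor is
    \<open>\<tau>\<close>.\<close>
  have prod: "(K * G\<^sup>2 / \<sigma>) * (K * G * sqrt \<nu>) * (D * L * sqrt \<nu> / sqrt \<sigma>) = (K\<^sup>2 * G\<^sup>2 * L * \<nu> / \<sigma>) * \<tau>"
  proof -
    have "(K * G\<^sup>2 / \<sigma>) * (K * G * sqrt \<nu>) * (D * L * sqrt \<nu> / sqrt \<sigma>)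
        = (K\<^sup>2 * G\<^sup>2 * L * (sqrt \<nu> * sqrt \<nu>) / \<sigma>) * (G * D / sqrt \<sigma>)"
      by (simp add: power2_eq_square)
    then show ?thesis using nonneg by (simp add: \<tau>_def)
  qed
  have "(4 * sqrt 2 * n ^ 3 * (K * G\<^sup>2 / \<sigma>)) * (2 * n ^ 4 * (K * G * sqrt \<nu>)) * (sqrt 2 * n * (D * L * sqrt \<nu> / sqrt \<sigma>))
      \<le> Q * (Q * (1 - \<kappa>)) * Q"
    by (rule mult_mono[OF mult_mono[OF q3 q4] q5]) (use nonneg n \<sigma> \<kappa> in auto)
  also have "(4 * sqrt 2 * n ^ 3 * (K * G\<^sup>2 / \<sigma>)) * (2 * n ^ 4 * (K * G * sqrt \<nu>)) * (sqrt 2 * n * (D * L * sqrt \<nu> / sqrt \<sigma>))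
      = (sqrt 2 * sqrt 2) * (4 * 2) * (n ^ 3 * n ^ 4 * n) * ((K * G\<^sup>2 / \<sigma>) * (K * G * sqrt \<nu>) * (D * L * sqrt \<nu> / sqrt \<sigma>))"
    by (simp only: mult_ac)
  also have "\<dots> = 16 * n ^ 8 * ((K\<^sup>2 * G\<^sup>2 * L * \<nu> / \<sigma>) * \<tau>)"
    unfolding prod by (simp add: power_add[symmetric] flip: power_Suc2)
  also have "\<dots> = 2 * n ^ 4 * (b\<^sup>2 * \<tau>)" unfolding bsq by (simp add: power_add[symmetric] mult_ac)
  finally have "2 * n ^ 4 * (b\<^sup>2 * \<tau>) \<le> (1 - \<kappa>) * Q ^ 3" by (simp add: power3_eq_cube mult_ac)
  moreover have "2 * n * (b\<^sup>2 * \<tau>) \<le> 2 * n ^ 4 * (b\<^sup>2 * \<tau>)"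
    using n \<tau>0 power_increasing[of 1 4 n] by (intro mult_right_mono mult_left_mono) auto
  ultimately have bt: "2 * n * (b\<^sup>2 * \<tau>) \<le> (1 - \<kappa>) * Q ^ 3" by linarith
  \<comment> \<open>\<open>nontrivial\<close> bounds \<open>Q\<close> by a multiple of
    \<open>n * \<tau> * \<theta>\<close>. This eliminates \<open>\<tau>\<close> and lowers the power
    of \<open>Q\<close> from three to two; for \<open>Q = 0\<close> the bound \<open>bt\<close>
    already gives \<open>b = 0\<close>.\<close>
  have b2: "10 * b\<^sup>2 \<le> sqrt 2 * \<theta> * ((1 - \<kappa>) * Q\<^sup>2)"
  proof (cases "Q = 0")
    case True
    then have "(1 - \<kappa>) * Q ^ 3 = 0" by simp
    then have "n * (b\<^sup>2 * \<tau>) \<le> 0" using bt by linarith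
    then have "b\<^sup>2 * \<tau> \<le> 0" using n by (simp add: mult_le_0_iff)
    then have "b\<^sup>2 \<le> 0" using \<tau> by (simp add: mult_le_0_iff)
    then show ?thesis using True by simp
  next
    case False
    then have Q: "0 < Q" using nonneg by simp
    have "2 * b\<^sup>2 * (5 * Q) \<le> 2 * b\<^sup>2 * (sqrt 2 * n * \<tau> * \<theta>)"
      using nt by (intro mult_left_mono) auto
    also have "\<dots> = sqrt 2 * \<theta> * (2 * n * (b\<^sup>2 * \<tau>))" by (simp only: mult_ac)
    also have "\<dots> \<le> sqrt 2 * \<theta> * ((1 - \<kappa>) * Q ^ 3)" using bt \<theta> by (intro mult_left_mono) auto
    finally have "(10 * b\<^sup>2) * Q \<le> (sqrt 2 * \<theta> * ((1 - \<kappa>) * Q\<^sup>2)) * Q"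
      by (simp add: power3_eq_cube power2_eq_square mult_ac)
    then show ?thesis using Q by simp
  qed
  have SS: "(1 - \<kappa>) * S\<^sup>2 \<le> 2 * real T powr (5/2 - 2 * \<kappa>)"
    unfolding S_def by (rule sum_noise_radius_le[OF \<kappa>])
  have "10 * (b * S)\<^sup>2 = (10 * b\<^sup>2) * S\<^sup>2" by (simp add: power_mult_distrib)
  also have "\<dots> \<le> sqrt 2 * \<theta> * ((1 - \<kappa>) * Q\<^sup>2) * S\<^sup>2" using b2 by (intro mult_right_mono) auto
  also have "\<dots> = sqrt 2 * \<theta> * Q\<^sup>2 * ((1 - \<kappa>) * S\<^sup>2)" by (simp only: mult_ac)
  also have "\<dots> \<le> sqrt 2 * \<theta> * Q\<^sup>2 * (2 * real T powr (5/2 - 2 * \<kappa>))"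
    using SS \<theta> by (intro mult_left_mono) auto
  also have "\<dots> = 2 * sqrt 2 * Q\<^sup>2 * real T powr ((\<kappa> - 1/2) + (5/2 - 2 * \<kappa>))"
    unfolding \<theta>_def powr_add by (simp only: mult_ac)
  \<comment> \<open>The exponent on the left is \<open>2 - \<kappa>\<close>, at most
    \<open>3 - 2 * \<kappa>\<close> because \<open>\<kappa> \<le> 1\<close>.\<close>
  also have "\<dots> \<le> 2 * sqrt 2 * Q\<^sup>2 * real T powr (2 * (3/2 - \<kappa>))"
    using T \<kappa> by (intro mult_left_mono powr_mono) auto
  also have "real T powr (2 * (3/2 - \<kappa>)) = (real T powr (3/2 - \<kappa>))\<^sup>2"
    using T0 by (simp add: power2_eq_square flip: powr_add)
  finally have "10 * (b * S)\<^sup>2 \<le> 2 * sqrt 2 * (Q * real T powr (3/2 - \<kappa>))\<^sup>2"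
    by (simp add: power_mult_distrib)
  \<comment> \<open>\<open>121/40\<close> is ten times the square of \<open>11/20\<close>, the share
    of the final constant 5 that is reserved for this term.\<close>
  also have "\<dots> \<le> 121/40 * (Q * real T powr (3/2 - \<kappa>))\<^sup>2"
  proof (rule mult_right_mono)
    have "sqrt 2 \<le> 3/2" by (rule real_le_lsqrt) (simp_all add: power2_eq_square)
    then show "2 * sqrt 2 \<le> 121/40" by simp
  qed simp
  also have "\<dots> = 10 * (11/20 * (Q * real T powr (3/2 - \<kappa>)))\<^sup>2" by (simp add: power2_eq_square)
  finally have "(b * S)\<^sup>2 \<le> (11/20 * (Q * real T powr (3/2 - \<kappa>)))\<^sup>2" by simp
  then have "b * S \<le> 11/20 * (Q * real T powr (3/2 - \<kappa>))"
    using nonneg by (intro power2_le_imp_le[of "b * S"]) auto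
  then show ?thesis by (simp only: b_def S_def)
qed

lemma C_kappa_ge:
  "c1 + \<bar>(1 - 2 * (2 * \<kappa> - 1/2)) / (1 - (2 * \<kappa> - 1/2))\<bar> * c6 \<le> C_kappa \<kappa> c1 c2 c3 c4 c5 c6"
  "sqrt 2 * c2 + 2 * sqrt 2 * c3 \<le> C_kappa \<kappa> c1 c2 c3 c4 c5 c6"
  "2 powr (1 - \<kappa>) * c4 / (1 - \<kappa>) \<le> C_kappa \<kappa> c1 c2 c3 c4 c5 c6"
  "2 powr (3/2 - \<kappa>) * c5 / (3/2 - \<kappa>) \<le> C_kappa \<kappa> c1 c2 c3 c4 c5 c6"
  "c6 / \<bar>3/2 - 2 * \<kappa>\<bar> \<le> C_kappa \<kappa> c1 c2 c3 c4 c5 c6"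
  unfolding C_kappa_def by (rule Max_ge; simp)+

text \<open>The sum grows like a power of \<open>T\<close> for \<open>\<kappa> < 3/4\<close> and
  stays bounded for \<open>\<kappa> > 3/4\<close>; in both regimes the estimate has the denominator
  \<open>\<bar>3/2 - 2 * \<kappa>\<bar>\<close>, which explains the excluded value.\<close>

lemma noise_energy_budget:
  fixes \<kappa> c Q :: real
  assumes \<kappa>: "1/2 < \<kappa>" "\<kappa> < 1" "\<kappa> \<noteq> 3/4" and T: "3 \<le> T"
    and c: "0 \<le> c" "c / \<bar>3/2 - 2 * \<kappa>\<bar> \<le> Q"
  shows "c * (\<Sum>t<T. 1 / (real t + 1) powr (2 * \<kappa> - 1/2)) \<le> Q * real T powr (3/2 - \<kappa>)"
proof (cases "\<kappa> < 3/4")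
  case True
  have "c * (\<Sum>t<T. 1 / (real t + 1) powr (2 * \<kappa> - 1/2)) \<le> c * (real T powr (1 - (2 * \<kappa> - 1/2)) / (1 - (2 * \<kappa> - 1/2)))"
    using True \<kappa> c by (intro mult_left_mono sum_inverse_powr_le) auto
  also have "\<dots> = c / \<bar>3/2 - 2 * \<kappa>\<bar> * real T powr (3/2 - 2 * \<kappa>)" using True by (simp add: algebra_simps)
  also have "\<dots> \<le> Q * real T powr (3/2 - \<kappa>)"
    using c \<kappa> T by (intro mult_mono powr_mono) (auto intro: order_trans[OF _ c(2)])
  finally show ?thesis .
next
  case False
  then have k: "3/4 < \<kappa>" using \<kappa> by simp
  have Q: "0 \<le> Q" by (rule order_trans[OF _ c(2)]) (use c in simp)
  have "c * (\<Sum>t<T. 1 / (real t + 1) powr (2 * \<kappa> - 1/2)) \<le> c * ((2 * \<kappa> - 1/2) / (2 * \<kappa> - 1/2 - 1))"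
    using k c by (intro mult_left_mono sum_inverse_powr_le_of_gt_one) auto
  also have "\<dots> = c / \<bar>3/2 - 2 * \<kappa>\<bar> * (2 * \<kappa> - 1/2)" using k by (simp add: algebra_simps)
  \<comment> \<open>The numerator \<open>2 * \<kappa> - 1/2\<close> is below \<open>3/2\<close>, and
    \<open>3/2\<close> is at most \<open>sqrt (real T)\<close> because \<open>T\<close> is at least
    3.\<close>
  also have "\<dots> \<le> Q * (3/2)"
    using c k \<kappa> Q by (intro mult_mono) auto
  also have "\<dots> \<le> Q * real T powr (3/2 - \<kappa>)"
  proof (rule mult_left_mono[OF _ Q])
    have "3/2 \<le> sqrt (real T)" using T by (intro real_le_rsqrt) (simp add: power2_eq_square)
    also have "\<dots> = real T powr (1/2)" by (simp add: powr_half_sqrt)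
    also have "\<dots> \<le> real T powr (3/2 - \<kappa>)" using T \<kappa> by (intro powr_mono) auto
    finally show "3/2 \<le> real T powr (3/2 - \<kappa>)" .
  qed
  finally show ?thesis .
qed

section \<open>Assembly of the rate\<close>

context dscmd_run begin

text \<open>The constant 5 is spent as follows, in units of \<open>Q * E\<close>: one each for the
  initial states (\<open>C1\<close>), the linear noise (\<open>C5\<close>) and the quadratic noise
  (\<open>C6\<close>), \<open>29/20\<close> for \<open>C2\<close> and \<open>C3\<close> together,
  and \<open>11/20\<close> for the noise part of the disagreement.\<close>

lemma expected_gap_rate:
  assumes a: "a \<in> X" and l: "l \<in> {1..N}" and T: "3 \<le> T"
    and \<alpha>: "\<And>t. \<alpha> t = 1 / sqrt (real t + 1)" and r: "\<And>t. r t = 1 / (real t + 1) powr \<kappa>"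
    and \<kappa>: "1/2 < \<kappa>" "\<kappa> < 1" "\<kappa> \<noteq> 3/4"
  shows "(\<integral>\<omega>. objective (average l T \<omega>) \<partial>M) - objective a
    \<le> 5 * C_kappa \<kappa> (C1 N \<omega>c \<gamma>c Gf Gchi x0) (C2 N D) (C3 N \<omega>c \<gamma>c Gf Gchi \<sigma>)
        (C4 N \<omega>c \<gamma>c Gf Gchi \<nu>) (C5 N \<sigma> D L \<nu>) (C6 N L \<nu>) / real T powr (\<kappa> - 1/2)"
proof -
  define n where "n = real N"
  define K where "K = \<omega>c / (1 - \<gamma>c)"
  define G where "G = Gf + Gchi"
  define G' where "G' = (n + 1) * Gf + n * Gchi"
  define Z where "Z = 4 * n + 2 * n\<^sup>2 * K"
  define H where "H = (\<Sum>j=1..N. norm (x0 j))"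
  define c1 where "c1 = C1 N \<omega>c \<gamma>c Gf Gchi x0"
  define c2 where "c2 = C2 N D"
  define c3 where "c3 = C3 N \<omega>c \<gamma>c Gf Gchi \<sigma>"
  define c4 where "c4 = C4 N \<omega>c \<gamma>c Gf Gchi \<nu>"
  define c5 where "c5 = C5 N \<sigma> D L \<nu>"
  define c6 where "c6 = C6 N L \<nu>"
  define Q where "Q = C_kappa \<kappa> c1 c2 c3 c4 c5 c6"
  define E where "E = real T powr (3/2 - \<kappa>)"
  define gap where "gap = (\<integral>\<omega>. objective (average l T \<omega>) \<partial>M) - objective a"
  note \<sigma> = \<Phi>(2)
  have n: "1 \<le> n" using N by (simp add: n_def)
  have K: "0 \<le> K" using omega_const_ge_1[OF network N] gamma_const_bounds[OF network N] by (simp add: K_def)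
  have G: "0 \<le> G" "Gf \<le> G" using Gf_nonneg Gchi_nonneg by (simp_all add: G_def)
  have G': "n * G \<le> G'" "G \<le> G'"
  proof -
    show "n * G \<le> G'" using Gf_nonneg by (simp add: G_def G'_def algebra_simps)
    moreover have "1 * G \<le> n * G" using n G by (intro mult_right_mono) auto
    ultimately show "G \<le> G'" by simp
  qed
  have H: "0 \<le> H" by (simp add: H_def sum_nonneg)
  have Z: "0 \<le> Z" using n K by (simp add: Z_def)
  have Zeq: "4 * real N + 2 * (real N)\<^sup>2 * \<omega>c / (1 - \<gamma>c) = Z" by (simp add: Z_def n_def K_def)
  have c1: "2 * n * K * G * H \<le> c1"
  proof -
    have "2 * n * K * G * H \<le> 2 * n * K * G' * H" using G' n K H by (intro mult_right_mono mult_left_mono) auto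
    then show ?thesis by (simp add: c1_def C1_def n_def K_def G'_def H_def)
  qed
  have c2: "c2 = n * D\<^sup>2" by (simp add: c2_def C2_def n_def)
  have c3: "(4 * n\<^sup>2 + 2 * n ^ 3 * K) * (G\<^sup>2 / \<sigma>) \<le> c3"
  proof -
    have "c3 = (Z * G' + n * Gchi) * (G / \<sigma>) + n * Gf\<^sup>2 / (2 * \<sigma>)"
      unfolding c3_def C3_def Zeq by (simp add: G'_def n_def G_def)
    moreover have "Z * (n * G) * (G / \<sigma>) \<le> (Z * G' + n * Gchi) * (G / \<sigma>)"
    proof (rule mult_right_mono)
      have "Z * (n * G) \<le> Z * G'" using G' Z by (intro mult_left_mono) auto
      moreover have "0 \<le> n * Gchi" using n Gchi_nonneg by simp
      ultimately show "Z * (n * G) \<le> Z * G' + n * Gchi" by linarith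
    qed (use G \<sigma> in auto)
    moreover have "0 \<le> n * Gf\<^sup>2 / (2 * \<sigma>)" using n \<sigma> by simp
    moreover have "(4 * n\<^sup>2 + 2 * n ^ 3 * K) * (G\<^sup>2 / \<sigma>) = Z * (n * G) * (G / \<sigma>)"
      by (simp add: Z_def power2_eq_square power3_eq_cube algebra_simps)
    ultimately show ?thesis by linarith
  qed
  have c4: "2 * n ^ 4 * (K * G * sqrt \<nu>) \<le> c4"
  proof -
    have "c4 = Z * G' * n * sqrt \<nu> + G * n\<^sup>2 * sqrt \<nu>"
      unfolding c4_def C4_def Zeq by (simp add: G'_def n_def G_def)
    moreover have "0 \<le> G * n\<^sup>2 * sqrt \<nu>" using G \<nu>_nonneg by simp
    moreover have "(2 * n\<^sup>2 * K) * (n * G) * n * sqrt \<nu> \<le> Z * G' * n * sqrt \<nu>"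
      using G' G Z n K \<nu>_nonneg by (intro mult_right_mono mult_mono) (auto simp: Z_def)
    moreover have "2 * n ^ 4 * (K * G * sqrt \<nu>) = (2 * n\<^sup>2 * K) * (n * G) * n * sqrt \<nu>"
      by (simp add: power2_eq_square power4_eq_xxxx)
    ultimately show ?thesis by linarith
  qed
  have c5: "c5 = sqrt (2 / \<sigma>) * D * L * n * sqrt \<nu>" by (simp add: c5_def C5_def n_def)
  have c6: "c6 = n * L * \<nu>" by (simp add: c6_def C6_def n_def)
  have pos: "0 \<le> c2" "0 \<le> c3" "0 \<le> c4" "0 \<le> c5" "0 \<le> c6"
  proof -
    show "0 \<le> c2" "0 \<le> c6" using n L_nonneg \<nu>_nonneg by (simp_all add: c2 c6)
    show "0 \<le> c5" using n \<sigma> L_nonneg \<nu>_nonneg D_nonneg by (simp add: c5)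
    show "0 \<le> c3" by (rule order_trans[OF _ c3]) (use n K \<sigma> in simp)
    show "0 \<le> c4" by (rule order_trans[OF _ c4]) (use n K G \<nu>_nonneg in simp)
  qed
  have Q_ge: "c1 + \<bar>(1 - 2 * (2 * \<kappa> - 1/2)) / (1 - (2 * \<kappa> - 1/2))\<bar> * c6 \<le> Q"
    "sqrt 2 * c2 + 2 * sqrt 2 * c3 \<le> Q" "2 powr (1 - \<kappa>) * c4 / (1 - \<kappa>) \<le> Q"
    "2 powr (3/2 - \<kappa>) * c5 / (3/2 - \<kappa>) \<le> Q" "c6 / \<bar>3/2 - 2 * \<kappa>\<bar> \<le> Q"
    unfolding Q_def by (rule C_kappa_ge)+
  have Q1: "c1 \<le> Q" using Q_ge(1) pos(5) by (smt (verit) abs_ge_zero mult_nonneg_nonneg)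
  have Q2: "sqrt 2 * c2 + 2 * sqrt 2 * c3 \<le> Q" by (rule Q_ge(2))
  have Q0: "0 \<le> Q" by (rule order_trans[OF _ Q2]) (use pos in simp)
  have Q4: "c4 \<le> Q * (1 - \<kappa>)"
  proof -
    have "1 * c4 \<le> 2 powr (1 - \<kappa>) * c4" using pos \<kappa> by (intro mult_right_mono ge_one_powr_ge_zero) auto
    also have "\<dots> \<le> Q * (1 - \<kappa>)" using Q_ge(3) \<kappa> by (simp add: pos_divide_le_eq)
    finally show ?thesis by simp
  qed
  have Q5: "c5 / (3/2 - \<kappa>) \<le> Q"
  proof -
    have "1 * c5 \<le> 2 powr (3/2 - \<kappa>) * c5" using pos \<kappa> by (intro mult_right_mono ge_one_powr_ge_zero) auto
    then have "c5 / (3/2 - \<kappa>) \<le> 2 powr (3/2 - \<kappa>) * c5 / (3/2 - \<kappa>)"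
      using \<kappa> by (intro divide_right_mono) auto
    then show ?thesis using Q_ge(4) by linarith
  qed
  have Q5': "c5 \<le> Q"
  proof -
    have "c5 * 1 \<le> c5 * (1 / (3/2 - \<kappa>))" using pos \<kappa> by (intro mult_left_mono) auto
    then show ?thesis using Q5 by simp
  qed
  have T0: "0 < real T" using T by simp
  have E1: "1 \<le> E" using T \<kappa> by (simp add: E_def ge_one_powr_ge_zero)
  have sqrtT: "sqrt (real T) \<le> E"
  proof -
    have "sqrt (real T) = real T powr (1/2)" by (simp add: powr_half_sqrt)
    also have "\<dots> \<le> E" unfolding E_def using T \<kappa> by (intro powr_mono) auto
    finally show ?thesis .
  qed
  have "gap \<le> 5 * Q / real T powr (\<kappa> - 1/2)"
  \<comment> \<open>The condition is the premise \<open>nontrivial\<close> of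
    \<open>noise_consensus_budget\<close>. If it fails, the oscillation bound is already below the
    claim.\<close>
  proof (cases "5 * Q < n * (G * (sqrt (2 / \<sigma>) * D)) * real T powr (\<kappa> - 1/2)")
    case False
    have "gap \<le> n * (G * (sqrt (2 / \<sigma>) * D))"
      unfolding gap_def n_def G_def by (rule expected_gap_le_diam[OF l _ a]) (use T in simp)
    also have "\<dots> \<le> 5 * Q / real T powr (\<kappa> - 1/2)" using False T0 by (simp add: pos_le_divide_eq)
    finally show ?thesis .
  next
    case True
    define A where "A = (\<Sum>t<T. \<alpha> t)"
    define S where "S = (\<Sum>t<T. 1 / (real t + 1) powr \<kappa>)"
    define b where "b = 2 * n\<^sup>2 * K * G * sqrt (2 * L / \<sigma>) * sqrt \<nu>"
    have A: "0 \<le> A" "A \<le> 2 * sqrt (real T)"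
      using sum_inverse_sqrt_le[of T] by (simp_all add: A_def \<alpha> sum_nonneg)
    have bS: "b * S \<le> 11/20 * (Q * E)"
      unfolding b_def S_def E_def
    proof (rule noise_consensus_budget[OF n K G(1) L_nonneg \<nu>_nonneg D_nonneg Q0 \<sigma> \<kappa>(1,2) _ _ _ _ True])
      have "2 * sqrt 2 * (2 * n ^ 3 * K * (G\<^sup>2 / \<sigma>)) \<le> 2 * sqrt 2 * ((4 * n\<^sup>2 + 2 * n ^ 3 * K) * (G\<^sup>2 / \<sigma>))"
        using \<sigma> by (intro mult_left_mono mult_right_mono) auto
      also have "\<dots> \<le> 2 * sqrt 2 * c3" using c3 by (intro mult_left_mono) auto
      also have "\<dots> \<le> Q" using Q2 pos by (smt (verit) mult_nonneg_nonneg real_sqrt_ge_zero)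
      finally show "4 * sqrt 2 * n ^ 3 * (K * G\<^sup>2 / \<sigma>) \<le> Q" by (simp add: mult_ac)
      show "2 * n ^ 4 * (K * G * sqrt \<nu>) \<le> Q * (1 - \<kappa>)" using c4 Q4 by linarith
      have "sqrt 2 * n * (D * L * sqrt \<nu> / sqrt \<sigma>) = c5" by (simp add: c5 real_sqrt_divide)
      then show "sqrt 2 * n * (D * L * sqrt \<nu> / sqrt \<sigma>) \<le> Q" using Q5' by simp
    qed (use T in simp)
    \<comment> \<open>The quotient decays with exponent \<open>\<kappa> - 1/2\<close>, whence the
      denominator \<open>3/2 - \<kappa>\<close> that \<open>C_kappa\<close> attaches to
      \<open>C5\<close>.\<close>
    have ratio: "(\<Sum>t<T. r t / \<alpha> t) \<le> E / (3/2 - \<kappa>)"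
    proof -
      have "r t / \<alpha> t = 1 / (real t + 1) powr (\<kappa> - 1/2)" for t
        by (simp add: r \<alpha> powr_diff powr_half_sqrt)
      then have "(\<Sum>t<T. r t / \<alpha> t) \<le> real T powr (1 - (\<kappa> - 1/2)) / (1 - (\<kappa> - 1/2))"
        using sum_inverse_powr_le[of "\<kappa> - 1/2" T] \<kappa> by simp
      then show ?thesis by (simp add: E_def)
    qed
    have ratio2: "(r t)\<^sup>2 / \<alpha> t = 1 / (real t + 1) powr (2 * \<kappa> - 1/2)" for t
      by (simp add: r \<alpha> powr_diff powr_half_sqrt power_divide powr_power mult.commute)
    have md: "(\<Sum>t<T. mean_deviation t) = 2 * G / \<sigma> * A + sqrt (2 * L / \<sigma>) * sqrt \<nu> * S"
      unfolding mean_deviation_def A_def S_def G_def sum_distrib_left sum.distrib[symmetric]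
      by (simp add: r mult_ac)
    have "T * gap \<le> G * (2 * n * K * (H + n * (\<Sum>t<T. mean_deviation t)))
      + sqrt (real T) * (n * D\<^sup>2)
      + n * L * \<nu> * (\<Sum>t<T. (r t)\<^sup>2 / \<alpha> t)
      + n * L * (sqrt (2 / \<sigma>) * D) * sqrt \<nu> * (\<Sum>t<T. r t / \<alpha> t)
      + 2 * n * Gf\<^sup>2 / \<sigma> * (\<Sum>t<T. \<alpha> t)"
    proof -
      have "T * gap \<le> (\<Sum>t<T. \<Sum>i=1..N. \<integral>\<omega>. (f i (x l (Suc t) \<omega>) - f i a + (chi i (x l (Suc t) \<omega>) - chi i a)) \<partial>M)"
        using expected_gap_le_regret[OF l, of T a] T T0 by (simp add: gap_def pos_le_divide_eq mult.commute)
      also note regret_le[OF a l \<alpha>]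
      finally show ?thesis by (simp only: n_def G_def K_def H_def)
    qed
    also have "\<dots> = 2 * n * K * G * H + (4 * n\<^sup>2 * K * (G\<^sup>2 / \<sigma>) + 2 * n * (Gf\<^sup>2 / \<sigma>)) * A + b * S
        + sqrt (real T) * c2 + c6 * (\<Sum>t<T. (r t)\<^sup>2 / \<alpha> t) + c5 * (\<Sum>t<T. r t / \<alpha> t)"
      unfolding md c2 c5 c6 b_def A_def[symmetric] by (simp add: power2_eq_square algebra_simps)
    also have "\<dots> \<le> Q * E + 2 * c3 * (2 * sqrt (real T)) + 11/20 * (Q * E) + sqrt (real T) * c2 + Q * E + Q * E"
    proof (intro add_mono order_refl)
      have "2 * n * K * G * H \<le> Q * 1" using c1 Q1 by simp
      also have "\<dots> \<le> Q * E" using E1 Q0 by (intro mult_left_mono)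
      finally show "2 * n * K * G * H \<le> Q * E" .
      show "(4 * n\<^sup>2 * K * (G\<^sup>2 / \<sigma>) + 2 * n * (Gf\<^sup>2 / \<sigma>)) * A \<le> 2 * c3 * (2 * sqrt (real T))"
      proof (rule mult_mono)
        have n23: "n\<^sup>2 \<le> n ^ 3" "n \<le> n\<^sup>2" using n by (auto intro: power_increasing self_le_power)
        have "Gf\<^sup>2 / \<sigma> \<le> G\<^sup>2 / \<sigma>" using G Gf_nonneg \<sigma> by (intro divide_right_mono power_mono) auto
        \<comment> \<open>The summand \<open>4 * N\<close> in the prefactor of \<open>C3\<close>
          absorbs the second moments of the stochastic subgradients, the summand with
          \<open>\<omega>c / (1 - \<gamma>c)\<close> the disagreement caused by the
          stepsizes.\<close>
        then have "4 * n\<^sup>2 * K * (G\<^sup>2 / \<sigma>) + 2 * n * (Gf\<^sup>2 / \<sigma>) \<le> 4 * n ^ 3 * K * (G\<^sup>2 / \<sigma>) + 8 * n\<^sup>2 * (G\<^sup>2 / \<sigma>)"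
          using n n23 K \<sigma> by (intro add_mono mult_mono mult_right_mono) auto
        also have "\<dots> = 2 * ((4 * n\<^sup>2 + 2 * n ^ 3 * K) * (G\<^sup>2 / \<sigma>))" by (simp add: algebra_simps)
        also have "\<dots> \<le> 2 * c3" using c3 by simp
        finally show "4 * n\<^sup>2 * K * (G\<^sup>2 / \<sigma>) + 2 * n * (Gf\<^sup>2 / \<sigma>) \<le> 2 * c3" .
      qed (use A pos in auto)
      show "c6 * (\<Sum>t<T. (r t)\<^sup>2 / \<alpha> t) \<le> Q * E"
        unfolding ratio2 E_def by (rule noise_energy_budget[OF \<kappa> T pos(5) Q_ge(5)])
      have "c5 * (\<Sum>t<T. r t / \<alpha> t) \<le> c5 * (E / (3/2 - \<kappa>))" using ratio pos by (intro mult_left_mono)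
      also have "\<dots> = c5 / (3/2 - \<kappa>) * E" by simp
      also have "\<dots> \<le> Q * E" using Q5 E1 by (intro mult_right_mono) auto
      finally show "c5 * (\<Sum>t<T. r t / \<alpha> t) \<le> Q * E" .
    qed (rule bS)
    also have "\<dots> = sqrt (real T) * (c2 + 4 * c3) + 71/20 * (Q * E)" by (simp add: algebra_simps)
    also have "sqrt (real T) * (c2 + 4 * c3) \<le> E * (29/20 * Q)"
    proof (intro mult_mono sqrtT)
      \<comment> \<open>\<open>sqrt 2\<close> times the second entry of the maximum is
        \<open>2 * c2 + 4 * c3\<close>, so the wanted combination is at most
        \<open>sqrt 2 * Q\<close>.\<close>
      have s: "sqrt 2 \<le> 29/20" by (rule real_le_lsqrt) (simp_all add: power2_eq_square)
      have "2 * c2 + 4 * c3 = (sqrt 2 * sqrt 2) * c2 + 2 * (sqrt 2 * sqrt 2) * c3" by simp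
      also have "\<dots> = sqrt 2 * (sqrt 2 * c2 + 2 * sqrt 2 * c3)" by (simp only: distrib_left mult_ac)
      also have "\<dots> \<le> sqrt 2 * Q" using Q2 by (intro mult_left_mono) auto
      also have "\<dots> \<le> 29/20 * Q" using s Q0 by (intro mult_right_mono)
      finally show "c2 + 4 * c3 \<le> 29/20 * Q" using pos by linarith
    qed (use E1 pos in auto)
    finally have "T * gap \<le> 5 * (Q * E)" by (simp add: mult.commute)
    then have "gap \<le> 5 * (Q * E) / T" using T0 by (simp add: pos_le_divide_eq mult.commute)
    also have "E / T = 1 / real T powr (\<kappa> - 1/2)"
    proof -
      have "E = T * real T powr (- (\<kappa> - 1/2))" using T0 by (simp add: E_def powr_mult_base)
      then show ?thesis using T0 by (simp only: powr_minus_divide) simp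
    qed
    then have "5 * (Q * E) / T = 5 * Q / real T powr (\<kappa> - 1/2)" by (metis mult.assoc times_divide_eq_right mult.right_neutral)
    finally show ?thesis .
  qed
  then show ?thesis by (simp only: gap_def Q_def c1_def c2_def c3_def c4_def c5_def c6_def)
qed

end

theorem corollary1:
  fixes N B :: nat
    and X :: "(real ^ 'n) set"
    and f chi :: "nat \<Rightarrow> real ^ 'n \<Rightarrow> real"
    and F :: "real ^ 'n \<Rightarrow> real"
    and \<Phi> :: "real ^ 'n \<Rightarrow> real"
    and \<sigma> L \<theta> Gf \<nu> \<kappa> :: real
    and P :: "nat \<Rightarrow> nat \<Rightarrow> nat \<Rightarrow> real"
    and \<alpha> r :: "nat \<Rightarrow> real"
    and M :: "'w measure"
    and \<F> :: "nat \<Rightarrow> 'w measure"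
    and x0 :: "nat \<Rightarrow> real ^ 'n"
    and x y :: "nat \<Rightarrow> nat \<Rightarrow> 'w \<Rightarrow> real ^ 'n"
    and \<xi> :: "nat \<Rightarrow> nat \<Rightarrow> nat \<Rightarrow> 'w \<Rightarrow> real ^ 'n"
    and gt :: "nat \<Rightarrow> nat \<Rightarrow> real ^ 'n \<Rightarrow> 'w \<Rightarrow> real ^ 'n"
    and g :: "nat \<Rightarrow> real ^ 'n \<Rightarrow> real ^ 'n"
    and xstar :: "real ^ 'n"
    and \<omega>c \<gamma>c Gchi D C\<kappa> :: real
  assumes X: "X \<noteq> {}" "convex X" "compact X"
    and convex_f: "\<And>i. i \<in> {1..N} \<Longrightarrow> convex_on UNIV (f i)"
    and convex_chi: "\<And>i. i \<in> {1..N} \<Longrightarrow> convex_on UNIV (chi i)"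
    and F: "F = (\<lambda>z. \<Sum>i=1..N. (f i z + chi i z))"
    and xstar: "is_arg_min F (\<lambda>z. z \<in> X) xstar"
    and \<Phi>: "cont_differentiable \<Phi>" "\<sigma> > 0" "strongly_convex \<sigma> \<Phi>"
    and mirror: "mirror_map_assumption N \<Phi> L"
    and prob: "prob_space M"
    and adapted: "adapted_processes N M \<F> X x y \<xi> gt"
    and iteration: "dscmd_n N M X chi \<Phi> P \<alpha> r x0 x y \<xi> gt"
    and network: "network_assumption N P B \<theta>"
    and subgradients: "stochastic_subgradient_assumption N M \<F> X f y \<xi> gt g Gf"
    and noise: "noise_assumption N M \<F> \<xi> \<nu>"
    and \<kappa>: "1/2 < \<kappa>" "\<kappa> < 1" "\<kappa> \<noteq> 3/4"
    and \<alpha>: "\<And>t. \<alpha> t = 1 / sqrt (real t + 1)"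
    and r: "\<And>t. r t = 1 / (real t + 1) powr \<kappa>"
    and constants: "\<omega>c = omega_const N \<theta>" "\<gamma>c = gamma_const N B \<theta>"
      "Gchi = G_chi N X chi" "D = bregman_diam \<Phi> X"
    and C\<kappa>: "C\<kappa> = C_kappa \<kappa> (C1 N \<omega>c \<gamma>c Gf Gchi x0) (C2 N D) (C3 N \<omega>c \<gamma>c Gf Gchi \<sigma>)
                  (C4 N \<omega>c \<gamma>c Gf Gchi \<nu>) (C5 N \<sigma> D L \<nu>) (C6 N L \<nu>)"
  shows "\<forall>l\<in>{1..N}. \<forall>T\<ge>3.
           (\<integral>\<omega>. F ((1 / real T) *\<^sub>R (\<Sum>t=1..T. x l t \<omega>)) \<partial>M) - F xstar
             \<le> 5 * C\<kappa> / real T powr (\<kappa> - 1/2)"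
proof (intro ballI allI impI)
  fix l T :: nat assume l: "l \<in> {1..N}" and T: "3 \<le> T"
  \<comment> \<open>The locale requires at least one agent; the index \<open>l\<close> provides
    it.\<close>
  have N: "1 \<le> N" using l by simp
  interpret prob_space M by (rule prob)
  interpret dscmd_run M N B X f chi \<Phi> \<sigma> L \<theta> Gf \<nu> P \<alpha> r \<F> x0 x y \<xi> gt g
  proof
    show "0 < \<alpha> t" "0 \<le> r t" for t by (simp_all add: \<alpha> r)
  qed (fact N X convex_f convex_chi \<Phi> mirror adapted iteration network subgradients noise)+
  have "xstar \<in> X" using xstar by (simp add: is_arg_min_def)
  from expected_gap_rate[OF this l T \<alpha> r \<kappa>]
  show "(\<integral>\<omega>. F ((1 / real T) *\<^sub>R (\<Sum>t=1..T. x l t \<omega>)) \<partial>M) - F xstar \<le> 5 * C\<kappa> / real T powr (\<kappa> - 1/2)"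
    by (simp only: F C\<kappa> constants average_def)
qed

end
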